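(* Let $d,m\ge 1$, let $x_0\in\mathbb{R}^d$ be fixed, and let $A,G_1,\dots,G_m\in\mathbb{R}^{d\times d}$. Put $$\mathcal{A}:=A\oplus A+\sum_{k=1}^m G_k\otimes G_k\in\mathbb{R}^{d^2\times d^2},\qquad v:=\operatorname{vec}(x_0x_0^{\top})\in\mathbb{R}^{d^2}.$$ If (A1) $\operatorname{rank}([x_0\,|\,Ax_0\,|\cdots|\,A^{d-1}x_0])=d$, and (A2) $\operatorname{rank}([v\,|\,\mathcal{A}v\,|\cdots|\,\mathcal{A}^{(d^2+d-2)/2}v])=(d^2+d)/2$, then the generator of the SDE $$dX_t=AX_t\,dt+\sum_{k=1}^m G_kX_t\,dW_{k,t},\qquad X_0=x_0,\qquad 0\le t<\infty,$$ is identifiable from $x_0$.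
   Context: $W=\{W_t=[W_{1,t},\dots,W_{m,t}]^{\top}:0\le t<\infty\}$ is an $m$-dimensional standard Brownian motion on a filtered probability space. $X(\cdot;x_0,A,\{G_k\}_{k=1}^m)$ denotes the unique (strong) solution process of $dX_t=AX_t\,dt+\sum_{k=1}^m G_kX_t\,dW_{k,t}$, $X_0=x_0$. For continuous processes, $\overset{d}{=}$ means having the same distribution on path space (equivalently, the same finite-dimensional distributions), and $\overset{d}{\neq}$ is the negation. Definition (identifiability). For $x_0\in\mathbb{R}^d$ and $A,G_1,\dots,G_m\in\mathbb{R}^{d\times d}$, the generator of this SDE is said to be identifiable from $x_0$ if for all $\tilde A,\tilde G_1,\dots,\tilde G_m\in\mathbb{R}^{d\times d}$ for which there exists $x\in\mathbb{R}^d$ with $$\Big(A,\sum_{k=1}^mG_kxx^{\top}G_k^{\top}\Big)\neq\Big(\tilde A,\sum_{k=1}^m\tilde G_kxx^{\top}\tilde G_k^{\top}\Big),$$ it holds that $X(\cdot;x_0,A,\{G_k\}_{k=1}^m)\overset{d}{\neq}X(\cdot;x_0,\tilde A,\{\tilde G_k\}_{k=1}^m)$. $\otimes$ is the Kronecker product, $\oplus$ the Kronecker sum, so $A\oplus A=A\otimes I_d+I_d\otimes A$, and $\operatorname{vec}(M)$ is the vector obtained by stacking the columns of $M$. $[\,\cdot\,|\cdots|\,\cdot\,]$ denotes horizontal concatenation of columns. *)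

theory Defs
  imports "HOL-Probability.Probability"
begin

section \<open>Kronecker calculus and rank\<close>

text \<open>Pairs are read lexicographically, the first component being the outer (block) index. With this
  reading \<open>vectorize\<close> stacks columns: its outer index is the column of the matrix.\<close>

definition kronecker_product ::
  "real^'n^'m \<Rightarrow> real^'q^'p \<Rightarrow> real^('n \<times> 'q)^('m \<times> 'p)" where
  "kronecker_product A B = (\<chi> i j. A $ fst i $ fst j * B $ snd i $ snd j)"

definition kronecker_sum ::
  "real^'n^'n \<Rightarrow> real^'p^'p \<Rightarrow> real^('n \<times> 'p)^('n \<times> 'p)" where
  "kronecker_sum A B = kronecker_product A (mat 1) + kronecker_product (mat 1) B"

definition vectorize :: "real^'n^'m \<Rightarrow> real^('n \<times> 'm)" where
  "vectorize P = (\<chi> i. P $ snd i $ fst i)"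

definition outer :: "real^'n \<Rightarrow> real^'n \<Rightarrow> real^'n^'n" where
  "outer x y = (\<chi> i j. x $ i * y $ j)"

text \<open>\<open>hconcat_rank c n\<close> is the rank of the matrix \<open>[c 0 | c 1 | \<dots> | c n]\<close>, as the dimension of the
  span of its columns. The library constant \<open>rank\<close> needs the columns to be indexed by a type, and
  there is none of the right size when their number is a function of the dimension;
  \<open>hconcat_rank_eq_rank\<close> relates the two.\<close>

definition hconcat_rank :: "(nat \<Rightarrow> real^'n) \<Rightarrow> nat \<Rightarrow> nat" where
  "hconcat_rank c n = dim (c ` {..n})"

lemma hconcat_rank_eq_rank:
  fixes P :: "real^'c^'n"
  assumes "columns P = c ` {..n}"
  shows "hconcat_rank c n = rank P"
  by (simp add: hconcat_rank_def column_rank_def assms)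

text \<open>The power \<open>A ^ j\<close> on \<open>real^'n^'n\<close> would be componentwise, hence the iteration.\<close>

definition krylov :: "real^'n^'n \<Rightarrow> real^'n \<Rightarrow> nat \<Rightarrow> real^'n" where
  "krylov A x j = (((*v) A) ^^ j) x"

section \<open>Filtered probability spaces and Brownian motion\<close>

text \<open>Time is the half-line \<open>{0..}\<close>; values at negative times play no role (a filtration on \<open>{0..}\<close>
  extends by \<open>F t = F 0\<close> for \<open>t < 0\<close>).\<close>

locale filtered_prob_space = prob_space M + filtration "space M" F
  for M :: "'a measure" and F :: "real \<Rightarrow> 'a measure" +
  assumes sets_F_subset: "sets (F t) \<subseteq> sets M"

locale brownian_motion = filtered_prob_space M F
  for M :: "'a measure" and F :: "real \<Rightarrow> 'a measure" +
  fixes W :: "real \<Rightarrow> 'a \<Rightarrow> real^'m"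
  assumes adapted: "0 \<le> t \<Longrightarrow> W t \<in> borel_measurable (F t)"
    and start: "AE \<omega> in M. W 0 \<omega> = 0"
    and continuous_paths: "AE \<omega> in M. continuous_on {0..} (\<lambda>t. W t \<omega>)"
    and increment_indep_past: "0 \<le> s \<Longrightarrow> s < t \<Longrightarrow>
      indep_set (sets (F s)) {(\<lambda>\<omega>. W t \<omega> - W s \<omega>) -` B \<inter> space M |B. B \<in> sets borel}"
    and increment_components_indep: "0 \<le> s \<Longrightarrow> s < t \<Longrightarrow>
      indep_vars (\<lambda>_. borel) (\<lambda>k \<omega>. W t \<omega> $ k - W s \<omega> $ k) UNIV"
    and increment_normal: "0 \<le> s \<Longrightarrow> s < t \<Longrightarrow>
      distributed M lborel (\<lambda>\<omega>. W t \<omega> $ k - W s \<omega> $ k) (normal_density 0 (sqrt (t - s)))"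

text \<open>Augmentation by the null events of \<open>M\<close>. Solutions are only required to be adapted to the
  augmented filtration, so that no completeness condition on \<open>F\<close> is needed for them to exist; a
  Brownian motion for \<open>F\<close> is one for the augmentation.\<close>

definition augmentation :: "'a measure \<Rightarrow> (real \<Rightarrow> 'a measure) \<Rightarrow> real \<Rightarrow> 'a measure" where
  "augmentation M F t = sigma (space M) (sets (F t) \<union> null_sets M)"

definition progressively_measurable ::
  "(real \<Rightarrow> 'a measure) \<Rightarrow> (real \<Rightarrow> 'a \<Rightarrow> 'b::topological_space) \<Rightarrow> bool" where
  "progressively_measurable F Y \<longleftrightarrow>
     (\<forall>t\<ge>0. (\<lambda>(s, \<omega>). Y s \<omega>) \<in> borel_measurable (restrict_space borel {0..t} \<Otimes>\<^sub>M F t))"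

section \<open>The Ito integral\<close>

text \<open>Measurability is part of the notion, since \<open>measure\<close> is \<open>0\<close> on non-measurable sets.\<close>

definition tendsto_in_probability ::
  "'a measure \<Rightarrow> (nat \<Rightarrow> 'a \<Rightarrow> 'b::{second_countable_topology, metric_space}) \<Rightarrow> ('a \<Rightarrow> 'b) \<Rightarrow> bool" where
  "tendsto_in_probability M Z L \<longleftrightarrow>
     (\<forall>n. Z n \<in> borel_measurable M) \<and> L \<in> borel_measurable M \<and>
     (\<forall>\<epsilon>>0. (\<lambda>n. measure M {\<omega> \<in> space M. dist (Z n \<omega>) (L \<omega>) > \<epsilon>}) \<longlonglongrightarrow> 0)"

text \<open>\<open>N\<close>, \<open>\<tau>\<close>, \<open>\<xi>\<close> encode the simple process that equals \<open>\<xi> i\<close> on \<open>{\<tau> i<..\<tau> (Suc i)}\<close> for \<open>i < N\<close>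
  and vanishes elsewhere.\<close>

definition simple_process ::
  "(real \<Rightarrow> 'a measure) \<Rightarrow> nat \<Rightarrow> (nat \<Rightarrow> real) \<Rightarrow> (nat \<Rightarrow> 'a \<Rightarrow> 'b::real_normed_vector) \<Rightarrow> bool" where
  "simple_process F N \<tau> \<xi> \<longleftrightarrow> 0 \<le> \<tau> 0 \<and>
     (\<forall>i<N. \<tau> i \<le> \<tau> (Suc i) \<and> \<xi> i \<in> borel_measurable (F (\<tau> i)) \<and> bounded (\<xi> i ` space (F (\<tau> i))))"

definition simple_value ::
  "nat \<Rightarrow> (nat \<Rightarrow> real) \<Rightarrow> (nat \<Rightarrow> 'a \<Rightarrow> 'b::real_normed_vector) \<Rightarrow> real \<Rightarrow> 'a \<Rightarrow> 'b" where
  "simple_value N \<tau> \<xi> s \<omega> = (\<Sum>i<N. indicator {\<tau> i<..\<tau> (Suc i)} s *\<^sub>R \<xi> i \<omega>)"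

definition simple_integral ::
  "(real \<Rightarrow> 'a \<Rightarrow> real) \<Rightarrow> nat \<Rightarrow> (nat \<Rightarrow> real) \<Rightarrow> (nat \<Rightarrow> 'a \<Rightarrow> 'b::real_normed_vector) \<Rightarrow> real \<Rightarrow> 'a \<Rightarrow> 'b" where
  "simple_integral B N \<tau> \<xi> t \<omega> =
     (\<Sum>i<N. (B (min t (\<tau> (Suc i))) \<omega> - B (min t (\<tau> i)) \<omega>) *\<^sub>R \<xi> i \<omega>)"

text \<open>\<open>I\<close> is (a version of) the integral of \<open>Y\<close> over \<open>{0..t}\<close> against the scalar Brownian motion \<open>B\<close>,
  for progressively measurable \<open>Y\<close> that is almost surely square integrable in time: the limit in
  probability of the integrals of simple processes approximating \<open>Y\<close> in time-\<open>L\<^sup>2\<close> in probability.\<close>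

definition has_ito_integral ::
  "'a measure \<Rightarrow> (real \<Rightarrow> 'a measure) \<Rightarrow> (real \<Rightarrow> 'a \<Rightarrow> real) \<Rightarrow>
   (real \<Rightarrow> 'a \<Rightarrow> 'b::euclidean_space) \<Rightarrow> real \<Rightarrow> ('a \<Rightarrow> 'b) \<Rightarrow> bool" where
  "has_ito_integral M F B Y t I \<longleftrightarrow>
     progressively_measurable F Y \<and>
     (AE \<omega> in M. (\<integral>\<^sup>+s\<in>{0..t}. ennreal ((norm (Y s \<omega>))\<^sup>2) \<partial>lborel) < \<infinity>) \<and>
     (\<exists>N \<tau> \<xi>. (\<forall>n. simple_process F (N n) (\<tau> n) (\<xi> n)) \<and>
        (\<forall>\<epsilon>>0. (\<lambda>n. measure M {\<omega> \<in> space M.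
           (\<integral>\<^sup>+s\<in>{0..t}. ennreal ((norm (simple_value (N n) (\<tau> n) (\<xi> n) s \<omega> - Y s \<omega>))\<^sup>2) \<partial>lborel)
             > ennreal \<epsilon>}) \<longlonglongrightarrow> 0) \<and>
        tendsto_in_probability M (\<lambda>n. simple_integral B (N n) (\<tau> n) (\<xi> n) t) I)"

section \<open>Linear SDEs with multiplicative noise and identifiability\<close>

definition linear_sde_solution ::
  "'a measure \<Rightarrow> (real \<Rightarrow> 'a measure) \<Rightarrow> (real \<Rightarrow> 'a \<Rightarrow> real^'m) \<Rightarrow>
   real^'d \<Rightarrow> real^'d^'d \<Rightarrow> ('m \<Rightarrow> real^'d^'d) \<Rightarrow> (real \<Rightarrow> 'a \<Rightarrow> real^'d) \<Rightarrow> bool" where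
  "linear_sde_solution M F W x0 A G X \<longleftrightarrow>
     (\<forall>t\<ge>0. X t \<in> borel_measurable (augmentation M F t)) \<and>
     (\<forall>\<omega>\<in>space M. continuous_on {0..} (\<lambda>t. X t \<omega>)) \<and>
     (AE \<omega> in M. X 0 \<omega> = x0) \<and>
     (\<forall>t\<ge>0. \<exists>I.
        (\<forall>k. has_ito_integral M (augmentation M F) (\<lambda>s \<omega>. W s \<omega> $ k) (\<lambda>s \<omega>. G k *v X s \<omega>) t (I k)) \<and>
        (AE \<omega> in M. X t \<omega> = x0 + (LINT s:{0..t}|lborel. A *v X s \<omega>) + (\<Sum>k\<in>UNIV. I k \<omega>)))"

text \<open>For continuous processes the Borel sets of path space are generated by the coordinates, so the
  law on path space is determined by, and is taken as, the law on the product \<open>\<sigma>\<close>-algebra.\<close>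

definition same_law ::
  "'a measure \<Rightarrow> (real \<Rightarrow> 'a \<Rightarrow> 'b::topological_space) \<Rightarrow> (real \<Rightarrow> 'a \<Rightarrow> 'b) \<Rightarrow> bool" where
  "same_law M X Y \<longleftrightarrow>
     distr M (PiM {0..} (\<lambda>_. borel)) (\<lambda>\<omega>. \<lambda>t\<in>{0..}. X t \<omega>) =
     distr M (PiM {0..} (\<lambda>_. borel)) (\<lambda>\<omega>. \<lambda>t\<in>{0..}. Y t \<omega>)"

definition diffusion_matrix :: "('m::finite \<Rightarrow> real^'d^'d) \<Rightarrow> real^'d \<Rightarrow> real^'d^'d" where
  "diffusion_matrix G x = (\<Sum>k\<in>UNIV. G k ** outer x x ** transpose (G k))"

text \<open>The solution of the SDE is unique only up to indistinguishability, so the statement about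
  \<^emph>\<open>the\<close> solution is made for every version of it.\<close>

definition identifiable_from ::
  "'a measure \<Rightarrow> (real \<Rightarrow> 'a measure) \<Rightarrow> (real \<Rightarrow> 'a \<Rightarrow> real^'m) \<Rightarrow>
   real^'d \<Rightarrow> real^'d^'d \<Rightarrow> ('m \<Rightarrow> real^'d^'d) \<Rightarrow> bool" where
  "identifiable_from M F W x0 A G \<longleftrightarrow>
     (\<forall>A' G'. (\<exists>x. (A, diffusion_matrix G x) \<noteq> (A', diffusion_matrix G' x)) \<longrightarrow>
        (\<forall>X X'. linear_sde_solution M F W x0 A G X \<longrightarrow> linear_sde_solution M F W x0 A' G' X' \<longrightarrow>
           \<not> same_law M X X'))"

end

theory Submission
  imports Defs
begin

text \<open>The law of a solution determines the moments \<open>m t = E (X t)\<close> and \<open>P t = E (X t (X t)\<^sup>T)\<close>, and these solve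
  \<open>m' = A m\<close> and \<open>(vec P)' = AA (vec P)\<close>. Two parameter sets with the same law therefore have the same
  Krylov vectors \<open>A\<^sup>j x0\<close> and \<open>AA\<^sup>j v\<close>. By (A1) the former span the whole space, so \<open>A\<close> is determined; by (A2)
  the latter span the vectorized symmetric matrices, whose dimension is \<open>(d\<^sup>2 + d) / 2\<close>, so \<open>AA\<close> is determined
  on every \<open>vec (x x\<^sup>T)\<close>, and with \<open>A\<close> also the diffusion matrix.

  The moment equations need no Ito formula. Any two sequences of simple processes approximating the
  integrand have the same limiting integrals, so one may take left-point Riemann sums of \<open>X\<close>, cut off
  once the running maximum of \<open>X\<close> passes a level; the isometry and a Gronwall argument then bound
  the second moments uniformly in the level, after which the Riemann sums converge in \<open>L\<^sup>2\<close>. The equation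
  for \<open>P\<close> follows by splitting \<open>X\<close> into drift and martingale part.\<close>

section \<open>Linear algebra\<close>

text \<open>The obstacle is that no moments are given: an Ito integral is only a limit in
  probability along some approximating sequence, so expectations do not pass to the limit, and
  integrability of the square of a solution has to be proved. The freedom in the approximation rests
  on a tail bound: the chance of a large simple integral is at most that of a large energy plus a
  Chebyshev term. The cutoff replaces stopping times: the event that a path stays below a level up
  to t shrinks as t grows, so on it the cutoff is inactive at all earlier times. Fatou's lemma then
  bounds the integral on that event by the energy of the cut-off process alone, with constants free
  of the level. Noise integrals are chosen for each time separately, with no joint measurability in
  time at hand, so the cross term is handled with the integral at the final time held fixed.
  Everything is done for linear functionals; matrix entries are recovered by polarization, since the
  moment equation preserves symmetry.\<close>

lemma kronecker_product_vectorize: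
  "kronecker_product B C *v vectorize P = vectorize (C ** P ** transpose B)"
proof -
  have "(\<Sum>j\<in>UNIV. B $ fst i $ fst j * C $ snd i $ snd j * P $ snd j $ fst j)
      = (\<Sum>b\<in>UNIV. (\<Sum>c\<in>UNIV. C $ snd i $ c * P $ c $ b) * B $ fst i $ b)" for i
    unfolding UNIV_Times_UNIV[symmetric] sum.cartesian_product' sum_distrib_right
    by (simp add: ac_simps)
  then show ?thesis
    by (simp add: vec_eq_iff kronecker_product_def vectorize_def matrix_vector_mult_def
        matrix_matrix_mult_def transpose_def)
qed

lemma vectorize_add: "vectorize (P + Q) = vectorize P + vectorize Q"
  by (simp add: vec_eq_iff vectorize_def)

lemma vectorize_sum: "vectorize (\<Sum>k\<in>K. P k) = (\<Sum>k\<in>K. vectorize (P k))"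
  by (simp add: vec_eq_iff vectorize_def sum_component)

lemma vectorize_inject: "vectorize P = vectorize Q \<longleftrightarrow> P = Q"
  by (auto simp: vec_eq_iff vectorize_def)

lemma matrix_vector_mult_sum_distrib: "(\<Sum>k\<in>K. B k) *v x = (\<Sum>k\<in>K. B k *v x)"
  by (induction K rule: infinite_finite_induct) (auto simp: matrix_vector_mult_add_rdistrib)

text \<open>The right-hand side of the linear equation for the second moment matrix; the Kronecker
  matrix of the theorem is this operator in vectorized form.\<close>

definition moment_operator :: "real^'d^'d \<Rightarrow> ('m::finite \<Rightarrow> real^'d^'d) \<Rightarrow> real^'d^'d \<Rightarrow> real^'d^'d" where
  "moment_operator A G P = P ** transpose A + A ** P + (\<Sum>k\<in>UNIV. G k ** P ** transpose (G k))"

lemma moment_operator_vectorize: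
  fixes A :: "real^'d^'d" and G :: "'m::finite \<Rightarrow> real^'d^'d"
  shows "(kronecker_sum A A + (\<Sum>k\<in>UNIV. kronecker_product (G k) (G k))) *v vectorize P
    = vectorize (moment_operator A G P)"
  by (simp add: moment_operator_def kronecker_sum_def matrix_vector_mult_add_rdistrib
      matrix_vector_mult_sum_distrib kronecker_product_vectorize vectorize_add vectorize_sum transpose_mat)

text \<open>Keeps the Krylov sequence of a symmetric matrix inside the symmetric ones, and later
  allows the moment equation to be recovered from quadratic forms.\<close>

lemma transpose_moment_operator:
  fixes A :: "real^'d^'d" and G :: "'m::finite \<Rightarrow> real^'d^'d"
  assumes "transpose P = P"
  shows "transpose (moment_operator A G P) = moment_operator A G P"
proof -
  have T: "transpose (X + Y) = transpose X + transpose Y" for X Y :: "real^'d^'d"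
    by (simp add: transpose_def vec_eq_iff)
  have S: "transpose (\<Sum>k\<in>UNIV. R k) = (\<Sum>k\<in>UNIV. transpose (R k))" for R :: "'m \<Rightarrow> real^'d^'d"
    by (simp add: transpose_def vec_eq_iff sum_component)
  show ?thesis
    unfolding moment_operator_def T S by (simp add: matrix_transpose_mul assms matrix_mul_assoc add.commute)
qed

lemma transpose_outer: "transpose (outer x x) = outer x x"
  by (simp add: outer_def transpose_def vec_eq_iff mult.commute)

lemma sum_lessThan_Suc_id: "(\<Sum>a<n. Suc a) = (n\<^sup>2 + n) div 2"
proof -
  have "2 * (\<Sum>a<n. Suc a) = n\<^sup>2 + n"
    by (induction n) (auto simp: power2_eq_square algebra_simps)
  then show ?thesis by simp
qed

text \<open>Makes derivatives within the half-line unique, including the one-sided one at 0.\<close>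

lemma islimpt_Ici: "(t::real) islimpt {0..}" if "0 \<le> t"
proof -
  have "t islimpt {t<..<t+1}" by (intro islimpt_greaterThanLessThan1) simp
  then show ?thesis by (rule islimpt_subset) (use that in auto)
qed

section \<open>Dimension of the space of symmetric matrices\<close>

definition symmetric_vectors :: "(real^('d::finite \<times> 'd)) set" where
  "symmetric_vectors = {w. \<forall>i j. w $ (i, j) = w $ (j, i)}"

lemma vectorize_symmetric_iff:
  "vectorize P \<in> symmetric_vectors \<longleftrightarrow> transpose P = P"
  by (auto simp: symmetric_vectors_def vectorize_def transpose_def vec_eq_iff)

lemma subspace_symmetric_vectors: "subspace symmetric_vectors"
  by (auto simp: subspace_def symmetric_vectors_def)

text \<open>One spanning vector per unordered index pair. The upper bound is enough, since the
  vectors counted by (A2) give the matching lower bound.\<close>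

lemma dim_symmetric_vectors:
  "dim (symmetric_vectors :: (real^('d::finite \<times> 'd)) set) \<le> (CARD('d)^2 + CARD('d)) div 2"
proof -
  \<comment> \<open>The index type carries no order, so an enumeration \<open>h\<close> singles out
    one representative of each unordered pair.\<close>
  obtain h :: "'d \<Rightarrow> nat" where h: "bij_betw h UNIV {..<CARD('d)}"
    using ex_bij_betw_finite_nat[of "UNIV :: 'd set"] by (metis atLeast0LessThan finite)
  then have inj: "h x = h y \<longleftrightarrow> x = y" for x y
    by (auto simp: bij_betw_def inj_on_def)
  define T where "T = {ij :: 'd \<times> 'd. h (fst ij) \<le> h (snd ij)}"
  define b where "b ij = (if fst ij = snd ij then axis ij 1 else
     axis ij 1 + axis (snd ij, fst ij) 1 :: real^('d \<times> 'd))" for ij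
  have "symmetric_vectors \<subseteq> span (b ` T)"
  proof
    fix w :: "real^('d \<times> 'd)" assume w: "w \<in> symmetric_vectors"
    have "w = (\<Sum>ij\<in>T. (w $ ij) *\<^sub>R b ij)"
    proof (subst vec_eq_iff, intro allI)
      fix kl :: "'d \<times> 'd"
      obtain k l where kl: "kl = (k, l)" by (cases kl)
      \<comment> \<open>The representative in \<open>T\<close> of the unordered pair behind
        \<open>kl\<close>; among the vectors indexed by \<open>T\<close>, only the one for
        \<open>mn\<close> has a nonzero entry at \<open>kl\<close>.\<close>
      define mn where "mn = (if h k \<le> h l then (k, l) else (l, k))"
      have sym: "w $ (l, k) = w $ (k, l)"
        using w unfolding symmetric_vectors_def by blast
      have mn: "mn \<in> T" "w $ mn = w $ kl"
        using sym by (simp_all add: mn_def T_def kl)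
      have "b (k, l) $ (k, l) = 1" "b (l, k) $ (k, l) = 1"
        by (cases "k = l"; simp add: b_def axis_def)+
      then have b_mn: "b mn $ kl = 1"
        by (simp add: mn_def kl)
      have "b ij $ kl = 0" if "ij \<in> T" "ij \<noteq> mn" for ij
      proof -
        obtain i j where ij: "ij = (i, j)" by (cases ij)
        have "(k, l) \<noteq> (i, j)" "(k, l) \<noteq> (j, i)"
          using that inj[of i j] by (auto simp: ij mn_def T_def split: if_splits)
        then show ?thesis
          by (auto simp: ij kl b_def axis_def)
      qed
      then have "(\<Sum>ij\<in>T. (w $ ij) *\<^sub>R b ij) $ kl = (\<Sum>ij\<in>T. if ij = mn then w $ mn else 0)"
        by (subst sum_component, intro sum.cong) (auto simp: b_mn)
      then show "w $ kl = (\<Sum>ij\<in>T. (w $ ij) *\<^sub>R b ij) $ kl"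
        using mn by simp
    qed
    also have "\<dots> \<in> span (b ` T)"
      by (intro span_sum span_scale span_base) auto
    finally show "w \<in> span (b ` T)" .
  qed
  then have "dim (symmetric_vectors :: (real^('d \<times> 'd)) set) \<le> dim (span (b ` T))"
    by (rule dim_subset)
  also have "\<dots> \<le> card (b ` T)"
    by (metis dim_span dim_le_card' finite_imageI finite)
  also have "\<dots> \<le> card T" by (rule card_image_le) auto
  also have "card T = card (map_prod h h ` T)"
    by (rule card_image[symmetric]) (auto simp: inj_on_def inj)
  \<comment> \<open>Swapping puts the larger number first, so the fibre \<open>{..b}\<close> has
    size \<open>b + 1\<close> and the count is a triangular number.\<close>
  also have "map_prod h h ` T = prod.swap ` (SIGMA b:{..<CARD('d)}. {..b})"
  proof (intro equalityI subsetI)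
    fix x assume "x \<in> prod.swap ` (SIGMA b:{..<CARD('d)}. {..b})"
    then obtain u v where x: "x = (u, v)" "v < CARD('d)" "u \<le> v" by auto
    then obtain i j where "u = h i" "v = h j"
      using h by (metis bij_betw_imp_surj_on imageE lessThan_iff le_less_trans)
    then show "x \<in> map_prod h h ` T"
      using x by (intro image_eqI[of _ _ "(i, j)"]) (simp_all add: T_def)
  next
    fix x assume "x \<in> map_prod h h ` T"
    then obtain i j where ij: "x = (h i, h j)" "h i \<le> h j" by (auto simp: T_def)
    moreover have "h j < CARD('d)" using bij_betw_apply[OF h, of j] by simp
    ultimately show "x \<in> prod.swap ` (SIGMA b:{..<CARD('d)}. {..b})"
      by (intro image_eqI[of _ _ "(h j, h i)"]) simp_all
  qed
  also have "card \<dots> = card (SIGMA b:{..<CARD('d)}. {..b})"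
    by (rule card_image) (auto simp: inj_on_def)
  also have "\<dots> = (CARD('d)^2 + CARD('d)) div 2"
    by (simp add: sum_lessThan_Suc_id)
  finally show ?thesis .
qed

section \<open>Krylov sequences and what they determine\<close>

lemma krylov_0 [simp]: "krylov B x 0 = x"
  by (simp add: krylov_def)

lemma krylov_Suc [simp]: "krylov B x (Suc j) = B *v krylov B x j"
  by (simp add: krylov_def)

text \<open>\<open>B\<close> and \<open>B'\<close> both send the common Krylov vector of index
  \<open>j\<close> to the common one of index \<open>j + 1\<close>, so they agree on all of them and
  hence on their span.\<close>

lemma eq_on_krylov_span:
  fixes B B' :: "real^'n^'n"
  assumes "\<And>j. krylov B x j = krylov B' x j" and "y \<in> span (krylov B x ` J)"
  shows "B *v y = B' *v y"
  using assms(2)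
proof (induction rule: span_induct_alt)
  case base
  then show ?case by simp
next
  case (step c z y)
  then obtain j where z: "z = krylov B x j" by auto
  have "B *v z = B' *v z"
    using assms(1)[of "Suc j"] assms(1)[of j] by (simp add: z)
  with step show ?case
    by (simp add: matrix_vector_right_distrib matrix_vector_mult_scaleR)
qed

lemma krylov_symmetric:
  fixes A :: "real^'d^'d" and G :: "'m::finite \<Rightarrow> real^'d^'d"
  assumes "AA = kronecker_sum A A + (\<Sum>k\<in>UNIV. kronecker_product (G k) (G k))"
  shows "krylov AA (vectorize (outer x x)) j \<in> symmetric_vectors"
proof -
  have "\<exists>P. transpose P = P \<and> krylov AA (vectorize (outer x x)) j = vectorize P"
  proof (induction j)
    case 0
    show ?case by (rule exI[of _ "outer x x"]) (simp add: transpose_outer)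
  next
    case (Suc j)
    then obtain P where P: "transpose P = P" "krylov AA (vectorize (outer x x)) j = vectorize P"
      by blast
    then show ?case
      by (intro exI[of _ "moment_operator A G P"]) (simp add: assms moment_operator_vectorize transpose_moment_operator)
  qed
  then show ?thesis by (auto simp: vectorize_symmetric_iff)
qed

text \<open>The Krylov equalities reach beyond the columns counted by the ranks: agreement of the
  two matrices on the last column compares the vectors of the next index.\<close>

lemma identifiable_of_krylov_eq:
  fixes A A' :: "real^'d^'d" and G G' :: "'m::finite \<Rightarrow> real^'d^'d"
  assumes AA: "AA = kronecker_sum A A + (\<Sum>k\<in>UNIV. kronecker_product (G k) (G k))"
    and AA': "AA' = kronecker_sum A' A' + (\<Sum>k\<in>UNIV. kronecker_product (G' k) (G' k))"
    and v: "v = vectorize (outer x0 x0)"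
    and rank1: "hconcat_rank (krylov A x0) (CARD('d) - 1) = CARD('d)"
    and rank2: "hconcat_rank (krylov AA v) n = (CARD('d)^2 + CARD('d)) div 2"
    and eq1: "\<And>j. krylov A x0 j = krylov A' x0 j"
    and eq2: "\<And>j. krylov AA v j = krylov AA' v j"
  shows "A = A'" and "diffusion_matrix G x = diffusion_matrix G' x"
proof -
  have "span (krylov A x0 ` {..CARD('d) - 1}) = UNIV"
    using rank1 by (simp add: hconcat_rank_def dim_eq_full[symmetric])
  then show A: "A = A'"
    using eq_on_krylov_span[OF eq1] by (metis UNIV_I matrix_eq)
  define V where "V = krylov AA v ` {..n}"
  have "V \<subseteq> symmetric_vectors"
    using krylov_symmetric[OF AA] by (auto simp: V_def v)
  then have "span V \<subseteq> symmetric_vectors"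
    by (simp add: span_minimal subspace_symmetric_vectors)
  moreover have "dim (symmetric_vectors :: (real^('d \<times> 'd)) set) \<le> dim (span V)"
    using dim_symmetric_vectors[where 'd='d] rank2 by (simp add: hconcat_rank_def V_def)
  \<comment> \<open>By the rank hypothesis the span is at least as large as the space of symmetric
    vectors that contains it.\<close>
  ultimately have "span V = symmetric_vectors"
    by (intro subspace_dim_equal subspace_symmetric_vectors) auto
  then have "vectorize (outer x x) \<in> span V"
    by (simp add: vectorize_symmetric_iff transpose_outer)
  then have "AA *v vectorize (outer x x) = AA' *v vectorize (outer x x)"
    unfolding V_def by (rule eq_on_krylov_span[OF eq2])
  \<comment> \<open>As \<open>A = A'\<close>, the drift terms of the two moment operators cancel and
    only the noise terms remain.\<close>
  then show "diffusion_matrix G x = diffusion_matrix G' x"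
    by (simp add: AA AA' A moment_operator_vectorize moment_operator_def vectorize_inject diffusion_matrix_def)
qed

text \<open>Differentiating \<open>B\<^sup>j p = B'\<^sup>j p\<close> along the common trajectory yields the same identity for \<open>j + 1\<close>.\<close>

lemma krylov_eq_of_linear_ode:
  fixes B B' :: "real^'n^'n" and p :: "real \<Rightarrow> real^'n"
  assumes "\<And>t. 0 \<le> t \<Longrightarrow> (p has_vector_derivative B *v p t) (at t within {0..})"
    and "\<And>t. 0 \<le> t \<Longrightarrow> (p has_vector_derivative B' *v p t) (at t within {0..})"
  shows "krylov B (p 0) j = krylov B' (p 0) j"
proof -
  have deriv: "((\<lambda>s. krylov C (p s) j) has_vector_derivative krylov C (q t) j) (at t within {0..})"
    if "(p has_vector_derivative q t) (at t within {0..})" for C :: "real^'n^'n" and q t j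
  proof (induction j)
    case 0
    show ?case using that by simp
  next
    case (Suc j)
    then show ?case
      by (auto intro: bounded_linear.has_vector_derivative[OF matrix_vector_mul_bounded_linear])
  qed
  have comm: "krylov C (C *v y) j = krylov C y (Suc j)" for C :: "real^'n^'n" and y j
    by (induction j) auto
  \<comment> \<open>The induction runs over all times at once, since differentiating needs equality
    of functions, not of values at one time.\<close>
  have "\<forall>t\<ge>0. krylov B (p t) j = krylov B' (p t) j"
  proof (induction j)
    case 0
    show ?case by simp
  next
    case (Suc j)
    show ?case
    proof (intro allI impI)
      fix t :: real assume t: "0 \<le> t"
      have 1: "((\<lambda>s. krylov B (p s) j) has_vector_derivative krylov B (B *v p t) j) (at t within {0..})"
        by (rule deriv[where q = "\<lambda>t. B *v p t"]) (rule assms(1)[OF t])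
      have 2: "((\<lambda>s. krylov B' (p s) j) has_vector_derivative krylov B' (B' *v p t) j) (at t within {0..})"
        by (rule deriv[where q = "\<lambda>t. B' *v p t"]) (rule assms(2)[OF t])
      have 3: "((\<lambda>s. krylov B (p s) j) has_vector_derivative krylov B' (B' *v p t) j) (at t within {0..})"
        by (rule has_vector_derivative_transform[OF _ _ 2]) (use t Suc in auto)
      have "at t within {0..} \<noteq> bot"
        using t by (simp add: trivial_limit_within islimpt_Ici)
      then have "krylov B (B *v p t) j = krylov B' (B' *v p t) j"
        by (rule vector_derivative_unique_within[OF _ 1 3])
      then show "krylov B (p t) (Suc j) = krylov B' (p t) (Suc j)"
        by (simp only: comm)
    qed
  qed
  then show ?thesis by simp
qed

section \<open>Brownian increments and step sums\<close>

lemma borel_measurable_vec_nth [measurable (raw)]: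
  "f \<in> borel_measurable N \<Longrightarrow> (\<lambda>x. (f x :: real^'n) $ k) \<in> borel_measurable N"
  by (rule measurable_compose[where g = "\<lambda>x. x $ k"]) auto

section \<open>The augmented filtration and the independence of Brownian increments\<close>

context brownian_motion
begin

abbreviation Fb :: "real \<Rightarrow> 'a measure" where "Fb \<equiv> augmentation M F"

lemma space_Fb [simp]: "space (Fb t) = space M"
  by (simp add: augmentation_def space_measure_of_conv)

lemma F_Pow: "sets (F t) \<union> null_sets M \<subseteq> Pow (space M)"
  using sets.space_closed[of M] sets_F_subset[of t] by (auto simp: null_sets_def)

lemma sets_Fb: "sets (Fb t) = sigma_sets (space M) (sets (F t) \<union> null_sets M)"
  using F_Pow[of t] by (simp add: augmentation_def)

lemma sets_Fb_subset: "sets (Fb t) \<subseteq> sets M"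
  unfolding sets_Fb using sets_F_subset[of t] by (intro sets.sigma_sets_subset) auto

lemma sets_Fb_mono: "s \<le> t \<Longrightarrow> sets (Fb s) \<subseteq> sets (Fb t)"
  unfolding sets_Fb using sets_F_mono[of s t] by (intro sigma_sets_mono') auto

lemma Fb_measurable_M: "f \<in> measurable (Fb t) N \<Longrightarrow> f \<in> measurable M N"
  using sets_Fb_subset[of t] by (auto simp: measurable_def)

lemma Fb_measurable_mono: "f \<in> measurable (Fb s) N \<Longrightarrow> s \<le> t \<Longrightarrow> f \<in> measurable (Fb t) N"
  using sets_Fb_mono[of s t] by (auto simp: measurable_def)

lemma F_measurable_Fb: "f \<in> measurable (F t) N \<Longrightarrow> f \<in> measurable (Fb t) N"
  using space_F[of t] by (auto simp: measurable_def sets_Fb)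

lemma W_measurable_Fb [measurable (raw)]: "0 \<le> t \<Longrightarrow> W t \<in> borel_measurable (Fb t)"
  by (intro F_measurable_Fb adapted)

lemma W_measurable [measurable (raw)]: "0 \<le> t \<Longrightarrow> W t \<in> borel_measurable M"
  by (rule Fb_measurable_M[OF W_measurable_Fb])

text \<open>Events that agree almost everywhere with an event of \<open>F s\<close> form a
  sigma-algebra containing the generators of the augmentation. Independence, assumed for
  \<open>F s\<close>, can thus be carried over.\<close>

lemma Fb_ae_eq_F:
  assumes "E \<in> sets (Fb s)"
  shows "\<exists>E'\<in>sets (F s). AE \<omega> in M. \<omega> \<in> E \<longleftrightarrow> \<omega> \<in> E'"
  using assms unfolding sets_Fb
proof (induction rule: sigma_sets.induct)
  case (Basic a)
  show ?case
  proof (cases "a \<in> sets (F s)")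
    case False
    then have "AE \<omega> in M. \<omega> \<notin> a" using Basic by (auto intro: AE_not_in)
    then show ?thesis by (intro bexI[of _ "{}"]) auto
  qed auto
next
  case Empty
  then show ?case by (intro bexI[of _ "{}"]) auto
next
  case (Compl a)
  then obtain E' where "E' \<in> sets (F s)" and E': "AE \<omega> in M. \<omega> \<in> a \<longleftrightarrow> \<omega> \<in> E'" by blast
  then have "space M - E' \<in> sets (F s)"
    using sets.compl_sets[of E' "F s"] by (simp add: space_F)
  then show ?case
    by (rule rev_bexI) (use E' in \<open>auto elim!: eventually_mono\<close>)
next
  case (Union a)
  then obtain E' where "\<And>i. E' i \<in> sets (F s)" and E': "\<And>i. AE \<omega> in M. \<omega> \<in> a i \<longleftrightarrow> \<omega> \<in> E' i"
    by metis
  then have "(\<Union>i. E' i) \<in> sets (F s)" by auto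
  moreover have "AE \<omega> in M. \<forall>i. \<omega> \<in> a i \<longleftrightarrow> \<omega> \<in> E' i"
    using E' by (simp add: AE_all_countable)
  then have "AE \<omega> in M. \<omega> \<in> (\<Union>i. a i) \<longleftrightarrow> \<omega> \<in> (\<Union>i. E' i)" by eventually_elim auto
  ultimately show ?case by blast
qed

text \<open>The function \<open>g\<close> is left open so as to cover both a component of the
  increment and a product of two components.\<close>

lemma increment_indep_Fb:
  assumes st: "0 \<le> s" "s < t"
    and Z: "Z \<in> borel_measurable (Fb s)" and g: "g \<in> borel_measurable borel"
  shows "indep_var borel (Z :: 'a \<Rightarrow> real) borel (\<lambda>\<omega>. g (W t \<omega> - W s \<omega>) :: real)"
proof -
  have [measurable]: "W t \<in> borel_measurable M" "W s \<in> borel_measurable M" "Z \<in> borel_measurable M"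
    using st Z by (auto intro: W_measurable Fb_measurable_M)
  have "indep_set {Z -` B \<inter> space M |B. B \<in> sets borel}
      {(\<lambda>\<omega>. g (W t \<omega> - W s \<omega>)) -` B \<inter> space M |B. B \<in> sets borel}"
    (is "indep_set ?ZZ ?WW")
  proof (rule indep_setI)
    show "?ZZ \<subseteq> events" "?WW \<subseteq> events" using g by auto
    fix a b assume "a \<in> ?ZZ" "b \<in> ?WW"
    then obtain B C where ab: "a = Z -` B \<inter> space M" "B \<in> sets borel"
      "b = (\<lambda>\<omega>. g (W t \<omega> - W s \<omega>)) -` C \<inter> space M" "C \<in> sets borel" by blast
    have b: "b = (\<lambda>\<omega>. W t \<omega> - W s \<omega>) -` (g -` C) \<inter> space M" "g -` C \<in> sets borel"
      using ab g measurable_sets[OF g, of C] by auto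
    have "a \<in> sets (Fb s)"
      using measurable_sets[OF Z ab(2)] by (simp add: ab)
    then obtain a' where a': "a' \<in> sets (F s)" "AE \<omega> in M. \<omega> \<in> a \<longleftrightarrow> \<omega> \<in> a'"
      using Fb_ae_eq_F by blast
    have ev: "a \<in> events" "a' \<in> events" "b \<in> events"
      using \<open>a \<in> sets (Fb s)\<close> a' sets_Fb_subset sets_F_subset ab g by auto
    \<comment> \<open>Passing from \<open>a\<close> to \<open>a'\<close> alters no probability, and
      independence is available for \<open>a'\<close>.\<close>
    have "prob (a \<inter> b) = prob (a' \<inter> b)"
      by (rule finite_measure_eq_AE) (use a' ev in auto)
    also have "\<dots> = prob a' * prob b"
      by (rule indep_setD[OF increment_indep_past[OF st]]) (use a' b in auto)
    also have "prob a' = prob a"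
      by (rule finite_measure_eq_AE) (use a' ev in auto)
    finally show "prob (a \<inter> b) = prob a * prob b" .
  qed
  \<comment> \<open>Independence of the preimage systems extends to the generated sigma-algebras
    because the systems are stable under intersection.\<close>
  moreover have "Int_stable {f -` B \<inter> space M |B. B \<in> sets borel}" for f :: "'a \<Rightarrow> real"
  proof (rule Int_stableI)
    fix a b assume "a \<in> {f -` B \<inter> space M |B. B \<in> sets borel}" "b \<in> {f -` B \<inter> space M |B. B \<in> sets borel}"
    then obtain A B where "a = f -` A \<inter> space M" "b = f -` B \<inter> space M" "A \<in> sets borel" "B \<in> sets borel"
      by blast
    then show "a \<inter> b \<in> {f -` B \<inter> space M |B. B \<in> sets borel}"
      by (intro CollectI exI[of _ "A \<inter> B"]) auto
  qed
  ultimately show ?thesis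
    unfolding indep_var_eq using g
    by (intro conjI indep_set_sigma_sets) (simp_all add: measurable_compose[OF _ g])
qed

lemma increment_times_past:
  fixes Z :: "'a \<Rightarrow> real" and g :: "real^'m \<Rightarrow> real"
  assumes st: "0 \<le> s" "s < t"
    and Z: "Z \<in> borel_measurable (Fb s)" "integrable M Z"
    and g: "g \<in> borel_measurable borel" "integrable M (\<lambda>\<omega>. g (W t \<omega> - W s \<omega>))"
  shows "integrable M (\<lambda>\<omega>. Z \<omega> * g (W t \<omega> - W s \<omega>))"
    and "expectation (\<lambda>\<omega>. Z \<omega> * g (W t \<omega> - W s \<omega>)) = expectation Z * expectation (\<lambda>\<omega>. g (W t \<omega> - W s \<omega>))"
  using indep_var_integrable[OF increment_indep_Fb[OF st Z(1) g(1)] Z(2) g(2)]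
    indep_var_lebesgue_integral[OF increment_indep_Fb[OF st Z(1) g(1)] Z(2) g(2)]
  by auto

lemma increment_moments:
  assumes st: "0 \<le> s" "s < t"
  shows "integrable M (\<lambda>\<omega>. W t \<omega> $ k - W s \<omega> $ k)"
    and "expectation (\<lambda>\<omega>. W t \<omega> $ k - W s \<omega> $ k) = 0"
    and "integrable M (\<lambda>\<omega>. (W t \<omega> $ k - W s \<omega> $ k) * (W t \<omega> $ l - W s \<omega> $ l))"
    and "expectation (\<lambda>\<omega>. (W t \<omega> $ k - W s \<omega> $ k) * (W t \<omega> $ l - W s \<omega> $ l)) = (if k = l then t - s else 0)"
proof -
  define d where "d k \<omega> = W t \<omega> $ k - W s \<omega> $ k" for k \<omega>
  have d: "distributed M lborel (d k) (normal_density 0 (sqrt (t - s)))" for k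
    unfolding d_def by (rule increment_normal[OF st])
  have pos: "0 < sqrt (t - s)" using st by simp
  have 1: "integrable M (d k)" for k
    using distributed_integrable[OF d, of "\<lambda>x. x" k] integrable_normal_moment_nz_1[OF pos, of 0] by simp
  have 2: "expectation (d k) = 0" for k
    using distributed_integral[OF d, of "\<lambda>x. x" k] integral_normal_moment_nz_1[OF pos, of 0] by simp
  have 3: "integrable M (\<lambda>\<omega>. d k \<omega> * d k \<omega>)" for k
    using distributed_integrable[OF d, of "\<lambda>x. x * x" k] integrable_normal_moment[OF pos, of 0 2]
    by (simp add: power2_eq_square)
  have 4: "expectation (\<lambda>\<omega>. d k \<omega> * d k \<omega>) = t - s" for k
    using distributed_integral[OF d, of "\<lambda>x. x * x" k] integral_normal_moment_even[OF pos, of 0 1] st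
    by (simp add: power2_eq_square fact_numeral)
  have indep: "indep_vars (\<lambda>_. borel) d {k, l}"
    using indep_vars_subset[OF increment_components_indep[OF st], of "{k, l}"] by (simp add: d_def[abs_def])
  have 5: "integrable M (\<lambda>\<omega>. d k \<omega> * d l \<omega>)" "expectation (\<lambda>\<omega>. d k \<omega> * d l \<omega>) = 0" if "k \<noteq> l"
    using indep_vars_integrable[OF _ indep 1] indep_vars_lebesgue_integral[OF _ indep 1] that
    by (simp_all add: 2)
  show "integrable M (\<lambda>\<omega>. W t \<omega> $ k - W s \<omega> $ k)" "expectation (\<lambda>\<omega>. W t \<omega> $ k - W s \<omega> $ k) = 0"
    using 1 2 by (simp_all add: d_def[abs_def])
  show "integrable M (\<lambda>\<omega>. (W t \<omega> $ k - W s \<omega> $ k) * (W t \<omega> $ l - W s \<omega> $ l))"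
    "expectation (\<lambda>\<omega>. (W t \<omega> $ k - W s \<omega> $ k) * (W t \<omega> $ l - W s \<omega> $ l)) = (if k = l then t - s else 0)"
    using 3 4 5 by (cases "k = l"; simp add: d_def)+
qed

lemma component_increment_times_past:
  assumes st: "0 \<le> s" "s \<le> t" and Z: "Z \<in> borel_measurable (Fb s)" "integrable M Z"
  shows "integrable M (\<lambda>\<omega>. Z \<omega> * (W t \<omega> $ k - W s \<omega> $ k))"
    and "expectation (\<lambda>\<omega>. Z \<omega> * (W t \<omega> $ k - W s \<omega> $ k)) = 0"
proof -
  have g: "(\<lambda>x :: real^'m. x $ k) \<in> borel_measurable borel" by simp
  have "integrable M (\<lambda>\<omega>. Z \<omega> * (W t \<omega> $ k - W s \<omega> $ k)) \<and> expectation (\<lambda>\<omega>. Z \<omega> * (W t \<omega> $ k - W s \<omega> $ k)) = 0"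
  \<comment> \<open>The axioms cover \<open>s < t\<close>; for \<open>s = t\<close> the increment is
    zero.\<close>
  proof (cases "s = t")
    case False
    then have "s < t" using st by simp
    note * = increment_times_past[OF st(1) this Z g] increment_moments(1,2)[OF st(1) this, of k]
    show ?thesis using * by simp
  qed auto
  then show "integrable M (\<lambda>\<omega>. Z \<omega> * (W t \<omega> $ k - W s \<omega> $ k))"
    and "expectation (\<lambda>\<omega>. Z \<omega> * (W t \<omega> $ k - W s \<omega> $ k)) = 0" by auto
qed

lemma component_increments_times_past:
  assumes st: "0 \<le> s" "s \<le> t" and Z: "Z \<in> borel_measurable (Fb s)" "integrable M Z"
  shows "integrable M (\<lambda>\<omega>. Z \<omega> * ((W t \<omega> $ k - W s \<omega> $ k) * (W t \<omega> $ l - W s \<omega> $ l)))"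
    and "expectation (\<lambda>\<omega>. Z \<omega> * ((W t \<omega> $ k - W s \<omega> $ k) * (W t \<omega> $ l - W s \<omega> $ l)))
      = (if k = l then (t - s) * expectation Z else 0)"
proof -
  have g: "(\<lambda>x :: real^'m. x $ k * x $ l) \<in> borel_measurable borel" by simp
  have "integrable M (\<lambda>\<omega>. Z \<omega> * ((W t \<omega> $ k - W s \<omega> $ k) * (W t \<omega> $ l - W s \<omega> $ l))) \<and>
    expectation (\<lambda>\<omega>. Z \<omega> * ((W t \<omega> $ k - W s \<omega> $ k) * (W t \<omega> $ l - W s \<omega> $ l)))
      = (if k = l then (t - s) * expectation Z else 0)"
  proof (cases "s = t")
    case False
    then have "s < t" using st by simp
    note * = increment_times_past[OF st(1) this Z g] increment_moments(3,4)[OF st(1) this, of k l]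
    show ?thesis using * by simp
  qed auto
  then show "integrable M (\<lambda>\<omega>. Z \<omega> * ((W t \<omega> $ k - W s \<omega> $ k) * (W t \<omega> $ l - W s \<omega> $ l)))"
    and "expectation (\<lambda>\<omega>. Z \<omega> * ((W t \<omega> $ k - W s \<omega> $ k) * (W t \<omega> $ l - W s \<omega> $ l)))
      = (if k = l then (t - s) * expectation Z else 0)" by blast+
qed

definition adapted_steps :: "nat \<Rightarrow> (nat \<Rightarrow> real) \<Rightarrow> (nat \<Rightarrow> 'a \<Rightarrow> real) \<Rightarrow> bool" where
  "adapted_steps n p \<xi> \<longleftrightarrow> 0 \<le> p 0 \<and>
     (\<forall>i<n. p i \<le> p (Suc i) \<and> \<xi> i \<in> borel_measurable (Fb (p i)) \<and> (\<exists>K. \<forall>\<omega>\<in>space M. \<bar>\<xi> i \<omega>\<bar> \<le> K))"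

definition step_sum :: "'m \<Rightarrow> nat \<Rightarrow> (nat \<Rightarrow> real) \<Rightarrow> (nat \<Rightarrow> 'a \<Rightarrow> real) \<Rightarrow> 'a \<Rightarrow> real" where
  "step_sum k n p \<xi> \<omega> = (\<Sum>i<n. (W (p (Suc i)) \<omega> $ k - W (p i) \<omega> $ k) * \<xi> i \<omega>)"

lemma adapted_steps_mono:
  assumes "adapted_steps n p \<xi>" "i \<le> j" "j \<le> n"
  shows "p i \<le> p j"
  using assms(2,3)
proof (induction j rule: dec_induct)
  case (step m)
  have "p m \<le> p (Suc m)" using assms(1) step.hyps assms(3) step.prems by (auto simp: adapted_steps_def)
  with step show ?case by simp
qed simp

lemma adapted_steps_nonneg: "adapted_steps n p \<xi> \<Longrightarrow> i \<le> n \<Longrightarrow> 0 \<le> p i"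
  using adapted_steps_mono[of n p \<xi> 0 i] by (simp add: adapted_steps_def)

lemma integrable_bounded_mult:
  assumes "integrable M f" "g \<in> borel_measurable M" "\<And>\<omega>. \<omega> \<in> space M \<Longrightarrow> \<bar>g \<omega>\<bar> \<le> K"
  shows "integrable M (\<lambda>\<omega>. f \<omega> * g \<omega> :: real)"
proof (rule Bochner_Integration.integrable_bound)
  show "integrable M (\<lambda>\<omega>. K * f \<omega>)" using assms by simp
  show "AE \<omega> in M. norm (f \<omega> * g \<omega>) \<le> norm (K * f \<omega>)"
    by (rule AE_I2) (simp add: abs_mult mult.commute[of K] mult_left_mono order_trans[OF assms(3) abs_ge_self])
qed (use assms in auto)

lemma integrable_const_bounded:
  assumes "g \<in> borel_measurable M" "\<And>\<omega>. \<omega> \<in> space M \<Longrightarrow> \<bar>g \<omega>\<bar> \<le> K"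
  shows "integrable M (g :: 'a \<Rightarrow> real)"
  using integrable_bounded_mult[OF _ assms, of "\<lambda>_. 1"] by simp

text \<open>In an off-diagonal term the later increment is independent of all other factors and has
  mean zero. On the diagonal, distinct components are uncorrelated and equal ones contribute the
  cell length.\<close>

lemma step_sum_product:
  assumes \<xi>: "adapted_steps n p \<xi>" and \<eta>: "adapted_steps n p \<eta>"
  shows "integrable M (\<lambda>\<omega>. step_sum k n p \<xi> \<omega> * step_sum l n p \<eta> \<omega>)"
    and "expectation (\<lambda>\<omega>. step_sum k n p \<xi> \<omega> * step_sum l n p \<eta> \<omega>)
      = (if k = l then \<Sum>i<n. (p (Suc i) - p i) * expectation (\<lambda>\<omega>. \<xi> i \<omega> * \<eta> i \<omega>) else 0)"
proof -
  define d where "d k i \<omega> = W (p (Suc i)) \<omega> $ k - W (p i) \<omega> $ k" for k i \<omega>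
  have le: "p i \<le> p j" if "i \<le> j" "j \<le> n" for i j
    using adapted_steps_mono[OF \<xi> that] .
  have nn: "0 \<le> p i" if "i \<le> n" for i using adapted_steps_nonneg[OF \<xi> that] .
  have W_meas: "(\<lambda>\<omega>. W (p i) \<omega> $ k) \<in> borel_measurable (Fb (p j))" if "i \<le> j" "j \<le> n" for i j k
    using Fb_measurable_mono[OF W_measurable_Fb le[OF that]] nn that
    by (intro measurable_compose[OF _ borel_measurable_vec_nth]) auto
  have d_meas: "d k i \<in> borel_measurable (Fb (p j))" if "i < j" "j \<le> n" for i j k
    unfolding d_def[abs_def] using that by (intro borel_measurable_diff W_meas) auto
  \<comment> \<open>The bracket is known at time \<open>p j\<close>, so the increment starting there
    averages out. Components and coefficients are arbitrary because both orders of the two cells are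
    reduced to this one.\<close>
  have off: "integrable M (\<lambda>\<omega>. (d k i \<omega> * \<alpha> i \<omega> * \<beta> j \<omega>) * d l j \<omega>)"
    "expectation (\<lambda>\<omega>. (d k i \<omega> * \<alpha> i \<omega> * \<beta> j \<omega>) * d l j \<omega>) = 0"
    if ij: "i < j" "j < n" and \<alpha>: "adapted_steps n p \<alpha>" and \<beta>: "adapted_steps n p \<beta>" for i j k l \<alpha> \<beta>
  proof -
    have \<alpha>i: "\<alpha> i \<in> borel_measurable (Fb (p i))" and \<beta>j: "\<beta> j \<in> borel_measurable (Fb (p j))"
      using \<alpha> \<beta> ij by (auto simp: adapted_steps_def)
    obtain K L where K: "\<And>\<omega>. \<omega> \<in> space M \<Longrightarrow> \<bar>\<alpha> i \<omega>\<bar> \<le> K" and L: "\<And>\<omega>. \<omega> \<in> space M \<Longrightarrow> \<bar>\<beta> j \<omega>\<bar> \<le> L"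
      using \<alpha> \<beta> ij unfolding adapted_steps_def by (meson less_trans)
    have "integrable M (\<lambda>\<omega>. \<alpha> i \<omega> * d k i \<omega>)"
      unfolding d_def using ij nn le \<alpha>i Fb_measurable_M[OF \<alpha>i] K
      by (intro component_increment_times_past integrable_const_bounded) auto
    then have int: "integrable M (\<lambda>\<omega>. d k i \<omega> * \<alpha> i \<omega> * \<beta> j \<omega>)"
      by (intro integrable_bounded_mult[OF _ Fb_measurable_M[OF \<beta>j] L]) (simp_all add: mult.commute)
    have meas: "(\<lambda>\<omega>. d k i \<omega> * \<alpha> i \<omega> * \<beta> j \<omega>) \<in> borel_measurable (Fb (p j))"
      using d_meas[of i j k] Fb_measurable_mono[OF \<alpha>i, of "p j"] \<beta>j ij le
      by (intro borel_measurable_times) auto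
    show "integrable M (\<lambda>\<omega>. (d k i \<omega> * \<alpha> i \<omega> * \<beta> j \<omega>) * d l j \<omega>)"
      "expectation (\<lambda>\<omega>. (d k i \<omega> * \<alpha> i \<omega> * \<beta> j \<omega>) * d l j \<omega>) = 0"
      using component_increment_times_past[OF nn[of j] le[of j "Suc j"] meas int, of l] ij
      by (auto simp: d_def)
  qed
  have summand: "integrable M (\<lambda>\<omega>. (d k i \<omega> * \<xi> i \<omega>) * (d l j \<omega> * \<eta> j \<omega>)) \<and>
    expectation (\<lambda>\<omega>. (d k i \<omega> * \<xi> i \<omega>) * (d l j \<omega> * \<eta> j \<omega>))
      = (if j = i then if k = l then (p (Suc i) - p i) * expectation (\<lambda>\<omega>. \<xi> i \<omega> * \<eta> i \<omega>) else 0 else 0)"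
    if ij: "i < n" "j < n" for i j
  proof (cases i j rule: linorder_cases)
    case less
    show ?thesis using off[OF less ij(2) \<xi> \<eta>, of k l] less by (simp add: ac_simps)
  next
    case greater
    show ?thesis using off[OF greater ij(1) \<eta> \<xi>, of l k] greater by (simp add: ac_simps)
  next
    case equal
    have \<xi>i: "\<xi> i \<in> borel_measurable (Fb (p i))" and \<eta>i: "\<eta> i \<in> borel_measurable (Fb (p i))"
      using \<xi> \<eta> ij by (auto simp: adapted_steps_def)
    obtain K L where K: "\<And>\<omega>. \<omega> \<in> space M \<Longrightarrow> \<bar>\<xi> i \<omega>\<bar> \<le> K" and L: "\<And>\<omega>. \<omega> \<in> space M \<Longrightarrow> \<bar>\<eta> i \<omega>\<bar> \<le> L"
      using \<xi> \<eta> ij unfolding adapted_steps_def by meson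
    have "integrable M (\<lambda>\<omega>. \<xi> i \<omega> * \<eta> i \<omega>)"
      by (intro integrable_bounded_mult[OF integrable_const_bounded[OF _ K] _ L] Fb_measurable_M[OF \<xi>i]
          Fb_measurable_M[OF \<eta>i])
    then show ?thesis
      using component_increments_times_past[OF nn[of i] le[of i "Suc i"] borel_measurable_times[OF \<xi>i \<eta>i], of k l]
        ij equal by (simp add: d_def ac_simps)
  qed
  have eq: "step_sum k n p \<xi> \<omega> * step_sum l n p \<eta> \<omega> = (\<Sum>i<n. \<Sum>j<n. (d k i \<omega> * \<xi> i \<omega>) * (d l j \<omega> * \<eta> j \<omega>))" for \<omega>
    by (simp add: step_sum_def sum_product d_def)
  show "integrable M (\<lambda>\<omega>. step_sum k n p \<xi> \<omega> * step_sum l n p \<eta> \<omega>)"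
    unfolding eq using summand by (intro Bochner_Integration.integrable_sum) auto
  have "expectation (\<lambda>\<omega>. step_sum k n p \<xi> \<omega> * step_sum l n p \<eta> \<omega>)
     = (\<Sum>i<n. \<Sum>j<n. expectation (\<lambda>\<omega>. (d k i \<omega> * \<xi> i \<omega>) * (d l j \<omega> * \<eta> j \<omega>)))"
    unfolding eq using summand
    by (subst Bochner_Integration.integral_sum)
       (auto intro!: Bochner_Integration.integrable_sum sum.cong Bochner_Integration.integral_sum)
  also have "\<dots> = (\<Sum>i<n. \<Sum>j<n. if j = i then
      if k = l then (p (Suc i) - p i) * expectation (\<lambda>\<omega>. \<xi> i \<omega> * \<eta> i \<omega>) else 0 else 0)"
    using summand by (intro sum.cong refl) blast
  also have "\<dots> = (\<Sum>i<n. if k = l then (p (Suc i) - p i) * expectation (\<lambda>\<omega>. \<xi> i \<omega> * \<eta> i \<omega>) else 0)"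
    by (intro sum.cong refl) (subst sum.delta, auto)
  finally show "expectation (\<lambda>\<omega>. step_sum k n p \<xi> \<omega> * step_sum l n p \<eta> \<omega>)
      = (if k = l then \<Sum>i<n. (p (Suc i) - p i) * expectation (\<lambda>\<omega>. \<xi> i \<omega> * \<eta> i \<omega>) else 0)"
    by simp
qed

text \<open>The martingale property without conditional expectations: no increment starts before the
  time at which \<open>Z\<close> is known.\<close>

lemma step_sum_past:
  assumes \<xi>: "adapted_steps n p \<xi>" and Z: "Z \<in> borel_measurable (Fb (p 0))" "integrable M Z"
  shows "integrable M (\<lambda>\<omega>. Z \<omega> * step_sum k n p \<xi> \<omega>)"
    and "expectation (\<lambda>\<omega>. Z \<omega> * step_sum k n p \<xi> \<omega>) = 0"
proof -
  have *: "integrable M (\<lambda>\<omega>. Z \<omega> * ((W (p (Suc i)) \<omega> $ k - W (p i) \<omega> $ k) * \<xi> i \<omega>)) \<and>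
      expectation (\<lambda>\<omega>. Z \<omega> * ((W (p (Suc i)) \<omega> $ k - W (p i) \<omega> $ k) * \<xi> i \<omega>)) = 0" if i: "i < n" for i
  proof -
    have \<xi>i: "\<xi> i \<in> borel_measurable (Fb (p i))" using \<xi> i by (auto simp: adapted_steps_def)
    obtain K where K: "\<And>\<omega>. \<omega> \<in> space M \<Longrightarrow> \<bar>\<xi> i \<omega>\<bar> \<le> K"
      using \<xi> i unfolding adapted_steps_def by meson
    have Zm: "Z \<in> borel_measurable (Fb (p i))"
      using Fb_measurable_mono[OF Z(1)] adapted_steps_mono[OF \<xi>, of 0 i] i by simp
    show ?thesis
      using component_increment_times_past[OF _ _ borel_measurable_times[OF Zm \<xi>i]
          integrable_bounded_mult[OF Z(2) Fb_measurable_M[OF \<xi>i] K], of "p (Suc i)" k]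
        adapted_steps_nonneg[OF \<xi>, of i] adapted_steps_mono[OF \<xi>, of i "Suc i"] i
      by (simp add: ac_simps)
  qed
  show "integrable M (\<lambda>\<omega>. Z \<omega> * step_sum k n p \<xi> \<omega>)"
    unfolding step_sum_def sum_distrib_left using * by (intro Bochner_Integration.integrable_sum) auto
  show "expectation (\<lambda>\<omega>. Z \<omega> * step_sum k n p \<xi> \<omega>) = 0"
    unfolding step_sum_def sum_distrib_left using * by (subst Bochner_Integration.integral_sum) auto
qed

end

section \<open>Simple processes on a common partition\<close>

abbreviation energy :: "real \<Rightarrow> (real \<Rightarrow> 'a \<Rightarrow> 'b::real_normed_vector) \<Rightarrow> 'a \<Rightarrow> ennreal" where
  "energy T Y \<omega> \<equiv> \<integral>\<^sup>+s\<in>{0..T}. ennreal ((norm (Y s \<omega>))\<^sup>2) \<partial>lborel"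

text \<open>The set \<open>P\<close> of nodes is carried along with its enumeration, so that
  refining a given grid is expressed as membership of its nodes in \<open>P\<close>.\<close>

definition partition_of :: "real set \<Rightarrow> real \<Rightarrow> nat \<Rightarrow> (nat \<Rightarrow> real) \<Rightarrow> bool" where
  "partition_of P t n q \<longleftrightarrow> q 0 = 0 \<and> q n = t \<and> (\<forall>i<n. q i < q (Suc i)) \<and> P = q ` {..n}"

lemma ex_partition_of:
  assumes "finite P" "P \<subseteq> {0..t}" "0 \<in> P" "t \<in> P"
  shows "\<exists>n q. partition_of P t n q"
proof -
  define L where "L = sorted_list_of_set P"
  define n where "n = length L - 1"
  have L: "set L = P" "sorted_wrt (<) L"
    using assms(1) by (simp_all add: L_def strict_sorted_iff)
  then have len: "length L = Suc n"
    using assms(3) by (cases L) (auto simp: n_def)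
  have less: "L ! i < L ! j" if "i < j" "j \<le> n" for i j
    using sorted_wrt_nth_less[OF L(2)] that len by simp
  have img: "P = (\<lambda>i. L ! i) ` {..n}"
    using L(1) len by (auto simp: set_conv_nth less_Suc_eq_le)
  obtain i where i: "i \<le> n" "L ! i = 0" using assms(3) img by auto
  obtain j where j: "j \<le> n" "L ! j = t" using assms(4) img by auto
  have "L ! 0 \<in> {0..t}" "L ! n \<in> {0..t}" using assms(2) img by auto
  then have "L ! 0 = 0" "L ! n = t"
    using less[of 0 i] i less[of j n] j by (cases "i = 0"; cases "j = n"; force)+
  then show ?thesis
    using less img by (intro exI[of _ n] exI[of _ "\<lambda>i. L ! i"]) (auto simp: partition_of_def)
qed

lemma partition_of_less:
  assumes "partition_of P t n q" "i < j" "j \<le> n"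
  shows "q i < q j"
  using assms(2,3)
proof (induction j)
  case (Suc j)
  then show ?case using assms(1) by (cases "i = j") (auto simp: partition_of_def intro: less_trans)
qed simp

lemma partition_of_le:
  "partition_of P t n q \<Longrightarrow> i \<le> j \<Longrightarrow> j \<le> n \<Longrightarrow> q i \<le> q j"
  using partition_of_less[of P t n q i j] by (cases "i = j") auto

lemma partition_of_bounds:
  assumes "partition_of P t n q" "i \<le> n"
  shows "0 \<le> q i" "q i \<le> t"
  using partition_of_le[OF assms(1), of 0 i] partition_of_le[OF assms(1), of i n] assms
  by (auto simp: partition_of_def)

text \<open>The interior of a cell contains no node, so comparing \<open>x\<close> with a point of
  the cell has one answer throughout. The cut \<open>min t x\<close> accounts for times beyond
  \<open>t\<close>.\<close>

lemma partition_of_separates: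
  assumes q: "partition_of P t n q" and i: "i < n" and s: "q i < s" "s \<le> q (Suc i)"
    and x: "min t x \<in> P"
  shows "x < s \<longleftrightarrow> x < q (Suc i)"
proof
  assume "x < q (Suc i)"
  then have "x \<in> P" using x partition_of_bounds(2)[OF q, of "Suc i"] i by (auto simp: min_def split: if_splits)
  then obtain m where m: "m \<le> n" "x = q m" using q by (auto simp: partition_of_def)
  then have "m \<le> i"
    using partition_of_le[OF q, of "Suc i" m] \<open>x < q (Suc i)\<close> by (cases "m \<le> i") auto
  then show "x < s" using partition_of_le[OF q, of m i] m s i by simp
qed (use s in auto)

text \<open>Whether a cell lies in \<open>{x<..y}\<close> is decided by its right end, in accordance
  with left-open steps.\<close>

lemma partition_of_telescope:
  fixes b :: "real \<Rightarrow> real"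
  assumes q: "partition_of P t n q" and "x \<in> P" "y \<in> P" "x \<le> y"
  shows "b y - b x = (\<Sum>i<n. (b (q (Suc i)) - b (q i)) * indicator {x<..y} (q (Suc i)))"
proof -
  obtain k l where k: "k \<le> n" "x = q k" and l: "l \<le> n" "y = q l"
    using assms by (auto simp: partition_of_def)
  then have "k \<le> l"
    using partition_of_less[OF q, of l k] assms(4) by (cases "k \<le> l") auto
  have "indicator {x<..y} (q (Suc i)) = (indicator {k..<l} i :: real)" if "i < n" for i
  proof -
    have "q k < q (Suc i) \<longleftrightarrow> k \<le> i"
      using partition_of_less[OF q, of k "Suc i"] partition_of_le[OF q, of "Suc i" k] that k by force
    moreover have "q (Suc i) \<le> q l \<longleftrightarrow> i < l"
      using partition_of_less[OF q, of l "Suc i"] partition_of_le[OF q, of "Suc i" l] that l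
      by (cases "i < l") auto
    ultimately show ?thesis by (simp add: k l indicator_def)
  qed
  then have "(\<Sum>i<n. (b (q (Suc i)) - b (q i)) * indicator {x<..y} (q (Suc i)))
     = (\<Sum>i<n. (b (q (Suc i)) - b (q i)) * indicator {k..<l} i)"
    by simp
  also have "\<dots> = (\<Sum>i\<in>{k..<l}. b (q (Suc i)) - b (q i))"
    using l by (intro sum.mono_neutral_cong_right) (auto simp: indicator_def)
  also have "\<dots> = b (q l) - b (q k)"
    using sum_Suc_diff'[OF \<open>k \<le> l\<close>, of "\<lambda>i. b (q i)"] by simp
  finally show ?thesis by (simp add: k l)
qed

lemma nn_integral_step_function:
  fixes f :: "real \<Rightarrow> real"
  assumes q: "partition_of P t n q" and f: "\<And>i s. i < n \<Longrightarrow> q i < s \<Longrightarrow> s \<le> q (Suc i) \<Longrightarrow> f s = c i"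
    and "\<And>i. i < n \<Longrightarrow> 0 \<le> c i"
  shows "(\<integral>\<^sup>+s\<in>{0..t}. ennreal (f s) \<partial>lborel) = ennreal (\<Sum>i<n. (q (Suc i) - q i) * c i)"
proof -
  \<comment> \<open>The cells are open on the left, so the point 0 belongs to none; it is discarded
    as a null set.\<close>
  have "AE s in lborel. s \<noteq> (0::real)" by (rule AE_lborel_singleton)
  then have "AE s in lborel. ennreal (f s) * indicator {0..t} s = (\<Sum>i<n. ennreal (c i) * indicator {q i<..q (Suc i)} s)"
  proof eventually_elim
    case (elim s)
    have disj: "j = i" if "i < n" "j < n" "s \<in> {q i<..q (Suc i)}" "s \<in> {q j<..q (Suc j)}" for i j
      using that partition_of_le[OF q, of "Suc i" j] partition_of_le[OF q, of "Suc j" i]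
      by (cases i j rule: linorder_cases) auto
    show ?case
    proof (cases "s \<in> {0..t}")
      case True
      \<comment> \<open>The cell of \<open>s\<close> is the first one whose right end reaches
        \<open>s\<close>.\<close>
      define i where "i = (LEAST i. s \<le> q (Suc i))"
      have "0 < s" using True elim by auto
      have qn: "s \<le> q n" "q 0 = 0" using True q by (auto simp: partition_of_def)
      then have "n \<noteq> 0" using \<open>0 < s\<close> by (cases "n = 0") auto
      then have ex: "s \<le> q (Suc (n - 1))" using qn by simp
      have i: "s \<le> q (Suc i)" "i \<le> n - 1"
        unfolding i_def using LeastI[of "\<lambda>i. s \<le> q (Suc i)", OF ex] Least_le[of "\<lambda>i. s \<le> q (Suc i)", OF ex] by auto
      have "q i < s"
      proof (cases i)
        case (Suc j)
        then show ?thesis using not_less_Least[of j "\<lambda>i. s \<le> q (Suc i)"] by (simp add: i_def)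
      qed (use qn \<open>0 < s\<close> in simp)
      with i \<open>n \<noteq> 0\<close> have i': "i < n" "s \<in> {q i<..q (Suc i)}" by auto
      have "ennreal (c j) * indicator {q j<..q (Suc j)} s = (if j = i then ennreal (c i) else 0)" if "j < n" for j
      proof (cases "j = i")
        case False
        then have "s \<notin> {q j<..q (Suc j)}" using disj[OF i'(1) that i'(2)] by blast
        then show ?thesis using False by simp
      qed (use i' in simp)
      then have "(\<Sum>j<n. ennreal (c j) * indicator {q j<..q (Suc j)} s) = (\<Sum>j<n. if j = i then ennreal (c i) else 0)"
        by (intro sum.cong) simp_all
      then show ?thesis using True f[of i s] i' by simp
    next
      case False
      have "ennreal (c i) * indicator {q i<..q (Suc i)} s = 0" if "i < n" for i
        using False that partition_of_bounds[OF q, of i] partition_of_bounds[OF q, of "Suc i"]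
        by (auto simp: indicator_def)
      then have "(\<Sum>i<n. ennreal (c i) * indicator {q i<..q (Suc i)} s) = 0"
        by (intro sum.neutral) auto
      then show ?thesis using False by simp
    qed
  qed
  then have "(\<integral>\<^sup>+s\<in>{0..t}. ennreal (f s) \<partial>lborel)
      = (\<integral>\<^sup>+s. (\<Sum>i<n. ennreal (c i) * indicator {q i<..q (Suc i)} s) \<partial>lborel)"
    by (rule nn_integral_cong_AE)
  also have "\<dots> = (\<Sum>i<n. ennreal (c i) * emeasure lborel {q i<..q (Suc i)})"
    by (subst nn_integral_sum) (auto simp: nn_integral_cmult_indicator)
  also have "\<dots> = (\<Sum>i<n. ennreal ((q (Suc i) - q i) * c i))"
    using assms(3) partition_of_le[OF q, of i "Suc i" for i]
    by (intro sum.cong) (auto simp: ennreal_mult'[symmetric] mult.commute emeasure_lborel_Ioc)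
  also have "\<dots> = ennreal (\<Sum>i<n. (q (Suc i) - q i) * c i)"
    using assms(3) partition_of_le[OF q, of i "Suc i" for i] by (intro sum_ennreal) auto
  finally show ?thesis .
qed

lemma simple_process_mono:
  assumes "simple_process H n \<tau> \<xi>" "i \<le> j" "j \<le> n"
  shows "\<tau> i \<le> \<tau> j"
  using assms(2,3)
proof (induction j rule: dec_induct)
  case (step m)
  have "\<tau> m \<le> \<tau> (Suc m)" using assms(1) step.hyps assms(3) step.prems by (auto simp: simple_process_def)
  with step show ?case by simp
qed simp

text \<open>A simple process is constant on each cell of a refining partition; the right end
  represents the cell because steps are left-open.\<close>

lemma simple_value_partition:
  assumes q: "partition_of P t n q" and i: "i < n" and s: "q i < s" "s \<le> q (Suc i)"
    and x: "\<And>j. j \<le> m \<Longrightarrow> min t (\<tau> j) \<in> P"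
  shows "simple_value m \<tau> \<xi> s \<omega> = simple_value m \<tau> \<xi> (q (Suc i)) \<omega>"
proof -
  have "indicator {\<tau> j<..\<tau> (Suc j)} s = (indicator {\<tau> j<..\<tau> (Suc j)} (q (Suc i)) :: real)" if "j < m" for j
    using partition_of_separates[OF q i s x[of j]] partition_of_separates[OF q i s x[of "Suc j"]] that
    by (auto simp: indicator_def not_less[symmetric])
  then show ?thesis by (simp add: simple_value_def)
qed

lemma simple_integral_partition:
  assumes q: "partition_of P t n q" and S: "simple_process H m \<tau> (\<xi> :: nat \<Rightarrow> 'a \<Rightarrow> real)"
    and x: "\<And>j. j \<le> m \<Longrightarrow> min t (\<tau> j) \<in> P"
  shows "simple_integral B m \<tau> \<xi> t \<omega>
    = (\<Sum>i<n. (B (q (Suc i)) \<omega> - B (q i) \<omega>) * simple_value m \<tau> \<xi> (q (Suc i)) \<omega>)"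
proof -
  have "B (min t (\<tau> (Suc j))) \<omega> - B (min t (\<tau> j)) \<omega>
      = (\<Sum>i<n. (B (q (Suc i)) \<omega> - B (q i) \<omega>) * indicator {\<tau> j<..\<tau> (Suc j)} (q (Suc i)))" if "j < m" for j
  proof -
    have "min t (\<tau> j) \<le> min t (\<tau> (Suc j))"
      using simple_process_mono[OF S, of j "Suc j"] that by auto
    note partition_of_telescope[OF q x[of j] x[of "Suc j"] this, of "\<lambda>s. B s \<omega>"]
    \<comment> \<open>Right ends do not exceed \<open>t\<close>, so cutting the step at
      \<open>t\<close> does not change which of them it contains.\<close>
    moreover have "indicator {min t (\<tau> j)<..min t (\<tau> (Suc j))} (q (Suc i))
        = (indicator {\<tau> j<..\<tau> (Suc j)} (q (Suc i)) :: real)" if "i < n" for i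
      using partition_of_bounds(2)[OF q, of "Suc i"] that by (auto simp: indicator_def)
    ultimately show ?thesis using that by simp
  qed
  then have "simple_integral B m \<tau> \<xi> t \<omega>
     = (\<Sum>j<m. (\<Sum>i<n. (B (q (Suc i)) \<omega> - B (q i) \<omega>) * indicator {\<tau> j<..\<tau> (Suc j)} (q (Suc i))) * \<xi> j \<omega>)"
    by (simp add: simple_integral_def)
  also have "\<dots> = (\<Sum>j<m. \<Sum>i<n. (B (q (Suc i)) \<omega> - B (q i) \<omega>) * (indicator {\<tau> j<..\<tau> (Suc j)} (q (Suc i)) * \<xi> j \<omega>))"
    by (simp only: sum_distrib_right mult.assoc)
  also have "\<dots> = (\<Sum>i<n. \<Sum>j<m. (B (q (Suc i)) \<omega> - B (q i) \<omega>) * (indicator {\<tau> j<..\<tau> (Suc j)} (q (Suc i)) * \<xi> j \<omega>))"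
    by (rule sum.swap)
  finally show ?thesis by (simp only: simple_value_def sum_distrib_left real_scaleR_def)
qed

section \<open>Simple processes over the augmented filtration\<close>

context brownian_motion
begin

lemma simple_value_bounded:
  assumes "simple_process Fb n \<tau> (\<xi> :: nat \<Rightarrow> 'a \<Rightarrow> real)"
  shows "\<exists>K. \<forall>\<omega>\<in>space M. \<forall>s. \<bar>simple_value n \<tau> \<xi> s \<omega>\<bar> \<le> K"
proof -
  have "\<forall>i<n. \<exists>K. \<forall>\<omega>\<in>space M. \<bar>\<xi> i \<omega>\<bar> \<le> K"
    using assms by (auto simp: simple_process_def bounded_iff)
  then obtain K where K: "\<And>i \<omega>. i < n \<Longrightarrow> \<omega> \<in> space M \<Longrightarrow> \<bar>\<xi> i \<omega>\<bar> \<le> K i" by metis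
  have "\<bar>simple_value n \<tau> \<xi> s \<omega>\<bar> \<le> (\<Sum>i<n. K i)" if "\<omega> \<in> space M" for s \<omega>
    unfolding simple_value_def
    using K that by (intro order_trans[OF sum_abs] sum_mono) (force simp: indicator_def)
  then show ?thesis by blast
qed

text \<open>The value is read at the right end of a cell yet known at its left end: only steps with
  \<open>\<tau> j < q (Suc i)\<close> contribute, and since such a \<open>\<tau> j\<close> is a
  node, it is at most \<open>q i\<close>.\<close>

lemma simple_value_predictable:
  assumes q: "partition_of P t n q" and i: "i < n"
    and S: "simple_process Fb m \<tau> (\<xi> :: nat \<Rightarrow> 'a \<Rightarrow> real)"
    and x: "\<And>j. j \<le> m \<Longrightarrow> min t (\<tau> j) \<in> P"
  shows "simple_value m \<tau> \<xi> (q (Suc i)) \<in> borel_measurable (Fb (q i))"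
proof -
  have "(\<lambda>\<omega>. indicator {\<tau> j<..\<tau> (Suc j)} (q (Suc i)) *\<^sub>R \<xi> j \<omega>) \<in> borel_measurable (Fb (q i))" if j: "j < m" for j
  proof (cases "\<tau> j < q (Suc i)")
    case True
    have "\<tau> j \<in> P"
      using x[of j] j partition_of_bounds(2)[OF q, of "Suc i"] i True by (auto simp: min_def split: if_splits)
    then obtain l where l: "l \<le> n" "\<tau> j = q l" using q by (auto simp: partition_of_def)
    then have "l \<le> i"
      using partition_of_le[OF q, of "Suc i" l] True by (cases "l \<le> i") auto
    then have "\<tau> j \<le> q i" using partition_of_le[OF q, of l i] l i by simp
    moreover have "\<xi> j \<in> borel_measurable (Fb (\<tau> j))" using S j by (auto simp: simple_process_def)
    ultimately have "\<xi> j \<in> borel_measurable (Fb (q i))" by (rule Fb_measurable_mono[rotated])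
    then show ?thesis by simp
  qed simp
  then show ?thesis unfolding simple_value_def[abs_def] by (intro borel_measurable_sum) auto
qed

lemma simple_process_steps:
  assumes q: "partition_of P t n q" and S: "simple_process Fb m \<tau> (\<xi> :: nat \<Rightarrow> 'a \<Rightarrow> real)"
    and x: "\<And>j. j \<le> m \<Longrightarrow> min t (\<tau> j) \<in> P"
  shows "adapted_steps n q (\<lambda>i. simple_value m \<tau> \<xi> (q (Suc i)))"
proof -
  obtain K where "\<And>\<omega> s. \<omega> \<in> space M \<Longrightarrow> \<bar>simple_value m \<tau> \<xi> s \<omega>\<bar> \<le> K"
    using simple_value_bounded[OF S] by blast
  then show ?thesis
    unfolding adapted_steps_def
    using partition_of_bounds(1)[OF q, of 0] partition_of_le[OF q, of i "Suc i" for i]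
      simple_value_predictable[OF q _ S x]
    by auto
qed

abbreviation wiener_integral :: "'m \<Rightarrow> nat \<Rightarrow> (nat \<Rightarrow> real) \<Rightarrow> (nat \<Rightarrow> 'a \<Rightarrow> real) \<Rightarrow> real \<Rightarrow> 'a \<Rightarrow> real" where
  "wiener_integral k \<equiv> simple_integral (\<lambda>s \<omega>. W s \<omega> $ k)"

lemma simple_integral_steps:
  assumes q: "partition_of P t n q" and S: "simple_process Fb m \<tau> (\<xi> :: nat \<Rightarrow> 'a \<Rightarrow> real)"
    and x: "\<And>j. j \<le> m \<Longrightarrow> min t (\<tau> j) \<in> P"
  shows "wiener_integral k m \<tau> \<xi> t \<omega> = step_sum k n q (\<lambda>i. simple_value m \<tau> \<xi> (q (Suc i))) \<omega>"
  by (simp add: simple_integral_partition[OF q S x] step_sum_def)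

lemma adapted_steps_diff:
  assumes "adapted_steps n p \<zeta>" "adapted_steps n p \<eta>"
  shows "adapted_steps n p (\<lambda>i \<omega>. \<zeta> i \<omega> - \<eta> i \<omega>)"
  unfolding adapted_steps_def
proof (intro conjI allI impI)
  fix i assume i: "i < n"
  obtain K L where "\<And>\<omega>. \<omega> \<in> space M \<Longrightarrow> \<bar>\<zeta> i \<omega>\<bar> \<le> K" "\<And>\<omega>. \<omega> \<in> space M \<Longrightarrow> \<bar>\<eta> i \<omega>\<bar> \<le> L"
    using assms i unfolding adapted_steps_def by meson
  then show "\<exists>K. \<forall>\<omega>\<in>space M. \<bar>\<zeta> i \<omega> - \<eta> i \<omega>\<bar> \<le> K"
    by (intro exI[of _ "K + L"] ballI) (smt (verit))
qed (use assms in \<open>auto simp: adapted_steps_def intro!: borel_measurable_diff\<close>)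

lemma common_partition:
  assumes S1: "simple_process Fb n1 \<tau>1 (\<xi>1 :: nat \<Rightarrow> 'a \<Rightarrow> real)" and S2: "simple_process Fb n2 \<tau>2 (\<xi>2 :: nat \<Rightarrow> 'a \<Rightarrow> real)"
    and t: "0 \<le> t"
  obtains P n q where "partition_of P t n q" "\<And>j. j \<le> n1 \<Longrightarrow> min t (\<tau>1 j) \<in> P" "\<And>j. j \<le> n2 \<Longrightarrow> min t (\<tau>2 j) \<in> P"
proof -
  \<comment> \<open>Nodes beyond \<open>t\<close> are moved to \<open>t\<close>; 0 and
    \<open>t\<close> are added because a partition starts and ends there.\<close>
  define P where "P = {0, t} \<union> (\<lambda>j. min t (\<tau>1 j)) ` {..n1} \<union> (\<lambda>j. min t (\<tau>2 j)) ` {..n2}"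
  have "0 \<le> \<tau>1 j" if "j \<le> n1" for j
    using simple_process_mono[OF S1, of 0 j] S1 that by (simp add: simple_process_def)
  moreover have "0 \<le> \<tau>2 j" if "j \<le> n2" for j
    using simple_process_mono[OF S2, of 0 j] S2 that by (simp add: simple_process_def)
  ultimately have "P \<subseteq> {0..t}" using t by (auto simp: P_def)
  then obtain n q where "partition_of P t n q"
    using ex_partition_of[of P t] by (auto simp: P_def)
  then show ?thesis by (rule that) (auto simp: P_def)
qed

text \<open>Reduces the comparison of two simple integrals to a single step sum, with coefficients
  that do not depend on the component \<open>k\<close>.\<close>

lemma common_steps:
  assumes S1: "simple_process Fb n1 \<tau>1 (\<xi>1 :: nat \<Rightarrow> 'a \<Rightarrow> real)" and S2: "simple_process Fb n2 \<tau>2 (\<xi>2 :: nat \<Rightarrow> 'a \<Rightarrow> real)"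
    and t: "0 \<le> t"
  obtains n q \<zeta> where "adapted_steps n q \<zeta>"
    and "\<And>k \<omega>. wiener_integral k n1 \<tau>1 \<xi>1 t \<omega> - wiener_integral k n2 \<tau>2 \<xi>2 t \<omega>
      = step_sum k n q \<zeta> \<omega>"
    and "\<And>\<omega>. energy t (\<lambda>s \<omega>. simple_value n1 \<tau>1 \<xi>1 s \<omega> - simple_value n2 \<tau>2 \<xi>2 s \<omega>) \<omega>
      = ennreal (\<Sum>i<n. (q (Suc i) - q i) * (\<zeta> i \<omega>)\<^sup>2)"
proof -
  obtain P n q where q: "partition_of P t n q" and P1: "\<And>j. j \<le> n1 \<Longrightarrow> min t (\<tau>1 j) \<in> P"
    and P2: "\<And>j. j \<le> n2 \<Longrightarrow> min t (\<tau>2 j) \<in> P"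
    using common_partition[OF S1 S2 t] by metis
  define \<zeta> where "\<zeta> i \<omega> = simple_value n1 \<tau>1 \<xi>1 (q (Suc i)) \<omega> - simple_value n2 \<tau>2 \<xi>2 (q (Suc i)) \<omega>" for i \<omega>
  have "adapted_steps n q \<zeta>"
    using adapted_steps_diff[OF simple_process_steps[OF q S1 P1] simple_process_steps[OF q S2 P2]]
    by (simp add: \<zeta>_def[abs_def])
  moreover have "wiener_integral k n1 \<tau>1 \<xi>1 t \<omega> - wiener_integral k n2 \<tau>2 \<xi>2 t \<omega>
      = step_sum k n q \<zeta> \<omega>" for k \<omega>
    by (simp add: simple_integral_partition[OF q S1 P1] simple_integral_partition[OF q S2 P2] step_sum_def
        \<zeta>_def right_diff_distrib sum_subtractf)
  moreover have "energy t (\<lambda>s \<omega>. simple_value n1 \<tau>1 \<xi>1 s \<omega> - simple_value n2 \<tau>2 \<xi>2 s \<omega>) \<omega>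
      = ennreal (\<Sum>i<n. (q (Suc i) - q i) * (\<zeta> i \<omega>)\<^sup>2)" for \<omega>
  proof (rule nn_integral_step_function[OF q])
    fix i s assume i: "i < n" "q i < s" "s \<le> q (Suc i)"
    show "(norm (simple_value n1 \<tau>1 \<xi>1 s \<omega> - simple_value n2 \<tau>2 \<xi>2 s \<omega>))\<^sup>2 = (\<zeta> i \<omega>)\<^sup>2"
      using simple_value_partition[OF q i P1, where \<xi> = \<xi>1 and \<omega> = \<omega>]
        simple_value_partition[OF q i P2, where \<xi> = \<xi>2 and \<omega> = \<omega>] by (simp add: \<zeta>_def)
  qed simp
  ultimately show ?thesis using that by blast
qed


section \<open>Isometry and tail bound for step sums\<close>

lemma adapted_steps_square_integrable:
  assumes "adapted_steps n p \<zeta>" "i < n"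
  shows "integrable M (\<lambda>\<omega>. (\<zeta> i \<omega>)\<^sup>2)"
proof -
  obtain K where K: "\<And>\<omega>. \<omega> \<in> space M \<Longrightarrow> \<bar>\<zeta> i \<omega>\<bar> \<le> K"
    using assms unfolding adapted_steps_def by meson
  have \<zeta>: "\<zeta> i \<in> borel_measurable M"
    using assms unfolding adapted_steps_def by (meson Fb_measurable_M)
  show ?thesis
    unfolding power2_eq_square by (intro integrable_bounded_mult[OF integrable_const_bounded[OF \<zeta> K] \<zeta> K])
qed

lemma step_sum_measurable:
  assumes "adapted_steps n p \<zeta>"
  shows "step_sum k n p \<zeta> \<in> borel_measurable M"
proof -
  have "\<zeta> i \<in> borel_measurable M" if "i < n" for i
    using assms that unfolding adapted_steps_def by (meson Fb_measurable_M)
  moreover have "W (p i) \<in> borel_measurable M" if "i \<le> n" for i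
    using adapted_steps_nonneg[OF assms that] by (rule W_measurable)
  ultimately show ?thesis
    unfolding step_sum_def[abs_def]
    by (intro borel_measurable_sum borel_measurable_times borel_measurable_diff borel_measurable_vec_nth) auto
qed

lemma step_sum_isometry:
  assumes \<zeta>: "adapted_steps n p \<zeta>"
  shows "integrable M (\<lambda>\<omega>. (step_sum k n p \<zeta> \<omega>)\<^sup>2)"
    and "expectation (\<lambda>\<omega>. (step_sum k n p \<zeta> \<omega>)\<^sup>2) = expectation (\<lambda>\<omega>. \<Sum>i<n. (p (Suc i) - p i) * (\<zeta> i \<omega>)\<^sup>2)"
    and "integrable M (\<lambda>\<omega>. \<Sum>i<n. (p (Suc i) - p i) * (\<zeta> i \<omega>)\<^sup>2)"
  using step_sum_product[OF \<zeta> \<zeta>, of k k] adapted_steps_square_integrable[OF \<zeta>]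
  by (auto simp: power2_eq_square)

text \<open>The form in which the isometry meets energies and Fatou's lemma later.\<close>

lemma step_sum_isometry_nn:
  assumes \<zeta>: "adapted_steps n p \<zeta>"
  shows "(\<integral>\<^sup>+\<omega>. ennreal ((step_sum k n p \<zeta> \<omega>)\<^sup>2) \<partial>M)
    = (\<integral>\<^sup>+\<omega>. ennreal (\<Sum>i<n. (p (Suc i) - p i) * (\<zeta> i \<omega>)\<^sup>2) \<partial>M)"
proof -
  have "0 \<le> (\<Sum>i<n. (p (Suc i) - p i) * (\<zeta> i \<omega>)\<^sup>2)" for \<omega>
    using \<zeta> by (intro sum_nonneg) (auto simp: adapted_steps_def)
  then show ?thesis
    by (subst (1 2) nn_integral_eq_integral) (simp_all add: step_sum_isometry[OF \<zeta>])
qed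

text \<open>Stopping the coefficients as soon as the accumulated energy exceeds \<open>\<delta>\<close> keeps them adapted,
  and changes nothing where the total energy is at most \<open>\<delta>\<close>.\<close>

lemma step_sum_tail_bound:
  assumes \<zeta>: "adapted_steps n p \<zeta>" and pos: "0 < \<epsilon>" "0 \<le> \<delta>"
  shows "prob {\<omega>\<in>space M. \<bar>step_sum k n p \<zeta> \<omega>\<bar> \<ge> \<epsilon>}
    \<le> prob {\<omega>\<in>space M. (\<Sum>i<n. (p (Suc i) - p i) * (\<zeta> i \<omega>)\<^sup>2) > \<delta>} + \<delta> / \<epsilon>\<^sup>2"
proof -
  define V where "V j \<omega> = (\<Sum>i<j. (p (Suc i) - p i) * (\<zeta> i \<omega>)\<^sup>2)" for j \<omega>
  \<comment> \<open>The test uses \<open>V (Suc i)\<close>, which includes the current term: as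
    \<open>\<zeta> i\<close> is known at \<open>p i\<close>, this stays adapted, and the energy
    cannot overshoot \<open>\<delta>\<close>.\<close>
  define \<zeta>' where "\<zeta>' i \<omega> = (if V (Suc i) \<omega> \<le> \<delta> then \<zeta> i \<omega> else 0)" for i \<omega>
  have mono: "p i \<le> p (Suc i)" if "i < n" for i using \<zeta> that by (auto simp: adapted_steps_def)
  have V_mono: "V i \<omega> \<le> V j \<omega>" if "i \<le> j" "j \<le> n" for i j \<omega>
    unfolding V_def using that mono by (intro sum_mono2) auto
  have meas: "\<zeta> i \<in> borel_measurable (Fb (p j))" if "i \<le> j" "j < n" for i j
  proof (rule Fb_measurable_mono)
    show "\<zeta> i \<in> borel_measurable (Fb (p i))" using \<zeta> that by (simp add: adapted_steps_def)
    show "p i \<le> p j" using adapted_steps_mono[OF \<zeta>, of i j] that by simp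
  qed
  have \<zeta>': "adapted_steps n p \<zeta>'"
    unfolding adapted_steps_def
  proof (intro conjI allI impI)
    show "0 \<le> p 0" using \<zeta> by (simp add: adapted_steps_def)
    fix i assume i: "i < n"
    then show "p i \<le> p (Suc i)" by (rule mono)
    have "V (Suc i) \<in> borel_measurable (Fb (p i))"
      unfolding V_def[abs_def] using meas i by (intro borel_measurable_sum borel_measurable_times borel_measurable_power) auto
    then show "\<zeta>' i \<in> borel_measurable (Fb (p i))"
      unfolding \<zeta>'_def[abs_def] using meas[OF order_refl i] by measurable
    obtain K where "\<forall>\<omega>\<in>space M. \<bar>\<zeta> i \<omega>\<bar> \<le> K"
      using \<zeta> i unfolding adapted_steps_def by meson
    then show "\<exists>K. \<forall>\<omega>\<in>space M. \<bar>\<zeta>' i \<omega>\<bar> \<le> K"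
      by (intro exI[of _ "max K 0"]) (auto simp: \<zeta>'_def)
  qed
  have energy: "(\<Sum>i<j. (p (Suc i) - p i) * (\<zeta>' i \<omega>)\<^sup>2) \<le> \<delta>" if "j \<le> n" for j \<omega>
    using that
  proof (induction j)
    case (Suc j)
    show ?case
    proof (cases "V (Suc j) \<omega> \<le> \<delta>")
      case True
      have "(\<Sum>i<Suc j. (p (Suc i) - p i) * (\<zeta>' i \<omega>)\<^sup>2) \<le> V (Suc j) \<omega>"
        unfolding V_def using mono Suc.prems by (intro sum_mono mult_left_mono) (auto simp: \<zeta>'_def)
      then show ?thesis using True by simp
    next
      case False
      then show ?thesis using Suc by (simp add: \<zeta>'_def)
    qed
  qed (use pos in simp)
  have eq: "step_sum k n p \<zeta> \<omega> = step_sum k n p \<zeta>' \<omega>" if "V n \<omega> \<le> \<delta>" for \<omega>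
  proof -
    have "\<zeta> i \<omega> = \<zeta>' i \<omega>" if "i < n" for i
      using V_mono[of "Suc i" n \<omega>] that \<open>V n \<omega> \<le> \<delta>\<close> by (simp add: \<zeta>'_def)
    then show ?thesis by (simp add: step_sum_def)
  qed
  have [measurable]: "step_sum k n p \<zeta>' \<in> borel_measurable M" "step_sum k n p \<zeta> \<in> borel_measurable M"
    by (rule step_sum_measurable[OF \<zeta>'] step_sum_measurable[OF \<zeta>])+
  have [measurable]: "V n \<in> borel_measurable M"
    unfolding V_def[abs_def] using Fb_measurable_M[OF meas[OF order_refl]]
    by (intro borel_measurable_sum borel_measurable_times borel_measurable_power) auto
  have "prob {\<omega>\<in>space M. \<bar>step_sum k n p \<zeta> \<omega>\<bar> \<ge> \<epsilon>}
      \<le> prob ({\<omega>\<in>space M. V n \<omega> > \<delta>} \<union> {\<omega>\<in>space M. (step_sum k n p \<zeta>' \<omega>)\<^sup>2 \<ge> \<epsilon>\<^sup>2})"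
  proof (intro finite_measure_mono subsetI)
    fix \<omega> assume \<omega>: "\<omega> \<in> {\<omega>\<in>space M. \<bar>step_sum k n p \<zeta> \<omega>\<bar> \<ge> \<epsilon>}"
    then have "\<epsilon>\<^sup>2 \<le> (step_sum k n p \<zeta> \<omega>)\<^sup>2"
      using pos power_mono[of \<epsilon> "\<bar>step_sum k n p \<zeta> \<omega>\<bar>" 2] by simp
    then show "\<omega> \<in> {\<omega>\<in>space M. V n \<omega> > \<delta>} \<union> {\<omega>\<in>space M. (step_sum k n p \<zeta>' \<omega>)\<^sup>2 \<ge> \<epsilon>\<^sup>2}"
      using eq[of \<omega>] \<omega> by (cases "V n \<omega> \<le> \<delta>") auto
  qed measurable
  also have "\<dots> \<le> prob {\<omega>\<in>space M. V n \<omega> > \<delta>} + prob {\<omega>\<in>space M. (step_sum k n p \<zeta>' \<omega>)\<^sup>2 \<ge> \<epsilon>\<^sup>2}"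
    by (rule measure_Un_le) auto
  \<comment> \<open>Chebyshev for the stopped sum, whose second moment is at most
    \<open>\<delta>\<close> by the isometry.\<close>
  also have "prob {\<omega>\<in>space M. (step_sum k n p \<zeta>' \<omega>)\<^sup>2 \<ge> \<epsilon>\<^sup>2} \<le> expectation (\<lambda>\<omega>. (step_sum k n p \<zeta>' \<omega>)\<^sup>2) / \<epsilon>\<^sup>2"
    using step_sum_isometry(1)[OF \<zeta>', of k] pos by (intro integral_Markov_inequality_measure[where A = "{}"]) auto
  also have "expectation (\<lambda>\<omega>. (step_sum k n p \<zeta>' \<omega>)\<^sup>2) \<le> \<delta>"
    unfolding step_sum_isometry(2)[OF \<zeta>'] using energy[of n] step_sum_isometry(3)[OF \<zeta>']
    by (intro integral_le_const) auto
  finally show ?thesis using pos by (simp add: V_def divide_right_mono)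
qed

end

section \<open>Ito integrals as limits in probability\<close>

text \<open>A finite measure for every \<open>t\<close>, zero for negative \<open>t\<close>; as a
  measure of its own it can be a factor of a product measure.\<close>

abbreviation horizon :: "real \<Rightarrow> real measure" where
  "horizon t \<equiv> restrict_space lborel {0..t}"

lemma finite_measure_horizon: "finite_measure (horizon t)"
  by (rule finite_measureI) (cases "0 \<le> t"; simp add: space_restrict_space emeasure_restrict_space)

lemma nn_integral_horizon:
  "(\<integral>\<^sup>+s\<in>{0..t}. f s \<partial>lborel) = (\<integral>\<^sup>+s. f s \<partial>horizon t)"
  by (simp add: nn_integral_restrict_space)

lemma ennreal_squeeze_0:
  fixes f g :: "nat \<Rightarrow> ennreal"
  assumes "\<And>j. f j \<le> g j" "g \<longlonglongrightarrow> 0"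
  shows "f \<longlonglongrightarrow> 0"
  by (rule tendsto_sandwich[OF _ _ tendsto_const assms(2)]) (simp_all add: assms(1))

text \<open>The values of simple processes vanish at time 0, so pointwise limits of Riemann sums are
  available at positive times only.\<close>

lemma AE_horizon_pos: "AE s in horizon T. 0 < s \<and> s \<le> T"
proof -
  have "AE s in lborel. s \<noteq> (0::real)" by (rule AE_lborel_singleton)
  then show ?thesis
    by (subst AE_restrict_space_iff) (auto elim!: eventually_mono)
qed

lemma emeasure_horizon: "emeasure (horizon T) (space (horizon T)) = ennreal (max 0 T)"
  by (cases "0 \<le> T") (simp_all add: space_restrict_space emeasure_restrict_space)

lemma energy_le:
  assumes "\<And>s. s \<in> {0..T} \<Longrightarrow> norm (Y s \<omega>) \<le> norm (Z s \<omega>)"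
  shows "energy T Y \<omega> \<le> energy T Z \<omega>"
  using assms by (intro nn_integral_mono) (auto simp: indicator_def intro!: ennreal_leI power_mono)

lemma energy_mono: "t \<le> T \<Longrightarrow> energy t Y \<omega> \<le> energy T Y \<omega>"
  by (intro nn_integral_mono) (auto simp: indicator_def)

lemma energy_bounded:
  assumes "\<And>s. s \<in> {0..T} \<Longrightarrow> norm (Y s \<omega>) \<le> b"
  shows "energy T Y \<omega> \<le> ennreal (b\<^sup>2 * max 0 T)"
proof -
  have "energy T Y \<omega> \<le> (\<integral>\<^sup>+s. ennreal (b\<^sup>2) \<partial>horizon T)"
    unfolding nn_integral_horizon
    using assms by (intro nn_integral_mono) (auto simp: space_restrict_space intro!: ennreal_leI power_mono)
  also have "\<dots> = ennreal (b\<^sup>2 * max 0 T)"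
    unfolding nn_integral_const emeasure_horizon by (simp add: ennreal_mult'')
  finally show ?thesis .
qed

lemma power2_diff_le: "(x - y)\<^sup>2 \<le> 2 * x\<^sup>2 + 2 * y\<^sup>2" for x y :: real
  using zero_le_power2[of "x + y"] unfolding power2_sum power2_diff by linarith

section \<open>Consequences of convergence in probability\<close>

context prob_space
begin

text \<open>Capping the distance at 1 turns convergence in probability into convergence in mean,
  from which an almost surely convergent subsequence can be drawn.\<close>

lemma tendsto_in_probability_AE_subseq:
  assumes "tendsto_in_probability M Z L"
  shows "\<exists>r. strict_mono (r :: nat \<Rightarrow> nat) \<and> (AE \<omega> in M. (\<lambda>j. Z (r j) \<omega> :: real) \<longlonglongrightarrow> L \<omega>)"
proof -
  have [measurable]: "Z n \<in> borel_measurable M" "L \<in> borel_measurable M" for n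
    using assms by (auto simp: tendsto_in_probability_def)
  define d where "d n \<omega> = min 1 \<bar>Z n \<omega> - L \<omega>\<bar>" for n \<omega>
  have int: "integrable M (d n)" for n
    unfolding d_def[abs_def] by (rule integrable_const_bound[where B = 1]) auto
  have "(\<lambda>n. expectation (\<lambda>\<omega>. norm (d n \<omega>))) \<longlonglongrightarrow> 0"
  proof (rule LIMSEQ_I)
    fix \<epsilon> :: real assume \<epsilon>: "0 < \<epsilon>"
    then have "(\<lambda>n. prob {\<omega> \<in> space M. dist (Z n \<omega>) (L \<omega>) > \<epsilon> / 2}) \<longlonglongrightarrow> 0"
      using assms[unfolded tendsto_in_probability_def, THEN conjunct2, THEN conjunct2, rule_format, of "\<epsilon> / 2"] by simp
    then obtain n0 where n0: "\<And>n. n \<ge> n0 \<Longrightarrow> prob {\<omega> \<in> space M. dist (Z n \<omega>) (L \<omega>) > \<epsilon> / 2} < \<epsilon> / 2"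
      using order_tendstoD(2)[of _ 0 sequentially "\<epsilon> / 2"] \<epsilon> unfolding eventually_sequentially by (meson half_gt_zero)
    have "norm (expectation (\<lambda>\<omega>. norm (d n \<omega>)) - 0) < \<epsilon>" if "n \<ge> n0" for n
    proof -
      define A where "A = {\<omega> \<in> space M. dist (Z n \<omega>) (L \<omega>) > \<epsilon> / 2}"
      have [measurable]: "A \<in> events" unfolding A_def by measurable
      have "expectation (\<lambda>\<omega>. norm (d n \<omega>)) \<le> expectation (\<lambda>\<omega>. \<epsilon> / 2 + indicator A \<omega>)"
      proof (rule integral_mono)
        show "integrable M (\<lambda>\<omega>. norm (d n \<omega>))" using int[of n] by (rule integrable_norm)
        show "norm (d n \<omega>) \<le> \<epsilon> / 2 + indicator A \<omega>" if "\<omega> \<in> space M" for \<omega>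
          using that \<epsilon> by (auto simp: A_def d_def dist_real_def indicator_def min_def)
        show "integrable M (\<lambda>\<omega>. \<epsilon> / 2 + indicator A \<omega>)"
          by (rule integrable_const_bound[where B = "\<epsilon> / 2 + 1"]) (use \<epsilon> in \<open>auto simp: indicator_def\<close>)
      qed
      also have "\<dots> = \<epsilon> / 2 + prob A"
      proof -
        have "integrable M (indicat_real A)"
          by (rule integrable_const_bound[where B = 1]) (auto simp: indicator_def)
        then show ?thesis by (subst Bochner_Integration.integral_add) (auto simp: prob_space)
      qed
      also have "\<dots> < \<epsilon>" using n0[OF that] unfolding A_def by linarith
      finally show ?thesis by (simp add: d_def)
    qed
    then show "\<exists>n0. \<forall>n\<ge>n0. norm (expectation (\<lambda>\<omega>. norm (d n \<omega>)) - 0) < \<epsilon>" by blast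
  qed
  from tendsto_L1_AE_subseq[OF int this] obtain r where r: "strict_mono r" "AE \<omega> in M. (\<lambda>n. d (r n) \<omega>) \<longlonglongrightarrow> 0"
    by blast
  from r(2) have "AE \<omega> in M. (\<lambda>j. Z (r j) \<omega>) \<longlonglongrightarrow> L \<omega>"
  proof eventually_elim
    case (elim \<omega>)
    \<comment> \<open>Below 1 the cap is inactive, so the uncapped distance tends to zero as
      well.\<close>
    have "eventually (\<lambda>n. d (r n) \<omega> < 1) sequentially"
      using order_tendstoD(2)[OF elim] by simp
    then have "eventually (\<lambda>n. d (r n) \<omega> = \<bar>Z (r n) \<omega> - L \<omega>\<bar>) sequentially"
      by eventually_elim (auto simp: d_def)
    with elim have "(\<lambda>n. \<bar>Z (r n) \<omega> - L \<omega>\<bar>) \<longlonglongrightarrow> 0"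
      by (rule Lim_transform_eventually)
    then show ?case
      by (simp add: tendsto_rabs_zero_iff LIM_zero_iff)
  qed
  with r(1) show ?thesis by blast
qed

text \<open>Used with the indicator of an event as \<open>h\<close> and \<open>U = 0\<close> to
  bound an integral on that event, and with \<open>h = 1\<close> and \<open>U\<close> a member of
  the sequence to turn a Cauchy estimate into convergence.\<close>

lemma fatou_in_probability:
  fixes Z :: "nat \<Rightarrow> 'a \<Rightarrow> real"
  assumes Z: "tendsto_in_probability M Z L"
    and [measurable]: "h \<in> borel_measurable M" "U \<in> borel_measurable M"
    and le: "eventually (\<lambda>j. (\<integral>\<^sup>+\<omega>. ennreal (h \<omega> * (Z j \<omega> - U \<omega>)\<^sup>2) \<partial>M) \<le> a j) sequentially"
    and a: "a \<longlonglongrightarrow> b"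
  shows "(\<integral>\<^sup>+\<omega>. ennreal (h \<omega> * (L \<omega> - U \<omega>)\<^sup>2) \<partial>M) \<le> b"
proof -
  have [measurable]: "Z n \<in> borel_measurable M" "L \<in> borel_measurable M" for n
    using Z by (auto simp: tendsto_in_probability_def)
  obtain r where r: "strict_mono r" and lim: "AE \<omega> in M. (\<lambda>j. Z (r j) \<omega>) \<longlonglongrightarrow> L \<omega>"
    using tendsto_in_probability_AE_subseq[OF Z] by blast
  have "(\<integral>\<^sup>+\<omega>. ennreal (h \<omega> * (L \<omega> - U \<omega>)\<^sup>2) \<partial>M)
      = (\<integral>\<^sup>+\<omega>. liminf (\<lambda>j. ennreal (h \<omega> * (Z (r j) \<omega> - U \<omega>)\<^sup>2)) \<partial>M)"
  proof (rule nn_integral_cong_AE)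
    show "AE \<omega> in M. ennreal (h \<omega> * (L \<omega> - U \<omega>)\<^sup>2) = liminf (\<lambda>j. ennreal (h \<omega> * (Z (r j) \<omega> - U \<omega>)\<^sup>2))"
      using lim
    proof eventually_elim
      case (elim \<omega>)
      then have "(\<lambda>j. ennreal (h \<omega> * (Z (r j) \<omega> - U \<omega>)\<^sup>2)) \<longlonglongrightarrow> ennreal (h \<omega> * (L \<omega> - U \<omega>)\<^sup>2)"
        by (intro tendsto_ennrealI tendsto_intros)
      then show ?case by (intro lim_imp_Liminf[symmetric]) auto
    qed
  qed
  also have "\<dots> \<le> liminf (\<lambda>j. \<integral>\<^sup>+\<omega>. ennreal (h \<omega> * (Z (r j) \<omega> - U \<omega>)\<^sup>2) \<partial>M)"
    by (rule nn_integral_liminf) measurable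
  also have "\<dots> \<le> liminf (\<lambda>j. a (r j))"
    using eventually_subseq[OF r le] by (intro Liminf_mono) auto
  also have "\<dots> = b"
    using LIMSEQ_subseq_LIMSEQ[OF a r] by (intro lim_imp_Liminf) (auto simp: comp_def)
  finally show ?thesis .
qed

text \<open>The sample point comes first, so that the inner integral over the second factor is an
  integral over time.\<close>

abbreviation jointly_measurable :: "real \<Rightarrow> (real \<Rightarrow> 'a \<Rightarrow> 'b::topological_space) \<Rightarrow> bool" where
  "jointly_measurable t Y \<equiv> (\<lambda>(\<omega>, s). Y s \<omega>) \<in> borel_measurable (M \<Otimes>\<^sub>M horizon t)"

lemma section_measurable:
  "jointly_measurable t Y \<Longrightarrow> \<omega> \<in> space M \<Longrightarrow> (\<lambda>s. Y s \<omega>) \<in> borel_measurable (horizon t)"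
  by (drule measurable_Pair2) auto

lemma diff_joint:
  "jointly_measurable T (Y :: real \<Rightarrow> 'a \<Rightarrow> 'b::{second_countable_topology, real_normed_vector}) \<Longrightarrow> jointly_measurable T Z \<Longrightarrow>
    jointly_measurable T (\<lambda>s \<omega>. Y s \<omega> - Z s \<omega>)"
  unfolding split_beta' by (rule borel_measurable_diff)

lemma energy_measurable:
  assumes "jointly_measurable t (Y :: real \<Rightarrow> 'a \<Rightarrow> 'b::real_normed_vector)"
  shows "(\<lambda>\<omega>. \<integral>\<^sup>+s\<in>{0..t}. ennreal ((norm (Y s \<omega>))\<^sup>2) \<partial>lborel) \<in> borel_measurable M"
proof -
  interpret finite_measure "horizon t" by (rule finite_measure_horizon)
  have "(\<lambda>(\<omega>, s). ennreal ((norm (Y s \<omega>))\<^sup>2)) = (\<lambda>x. ennreal ((norm (case x of (\<omega>, s) \<Rightarrow> Y s \<omega>))\<^sup>2))"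
    by (auto simp: fun_eq_iff)
  also have "\<dots> \<in> borel_measurable (M \<Otimes>\<^sub>M horizon t)"
    using assms by measurable
  finally show ?thesis
    unfolding nn_integral_horizon by (rule borel_measurable_nn_integral)
qed

section \<open>Energy estimates and their convergence\<close>

abbreviation mean_energy :: "real \<Rightarrow> (real \<Rightarrow> 'a \<Rightarrow> 'b::real_normed_vector) \<Rightarrow> ennreal" where
  "mean_energy T Y \<equiv> \<integral>\<^sup>+\<omega>. energy T Y \<omega> \<partial>M"

abbreviation exceeds :: "('a \<Rightarrow> ennreal) \<Rightarrow> real \<Rightarrow> 'a set" where
  "exceeds e \<epsilon> \<equiv> {\<omega> \<in> space M. e \<omega> > ennreal \<epsilon>}"

lemma energy_scaled:
  assumes Y: "jointly_measurable T (Y :: real \<Rightarrow> 'a \<Rightarrow> 'b::real_normed_vector)" and \<omega>: "\<omega> \<in> space M"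
    and le: "\<And>s. s \<in> {0..T} \<Longrightarrow> norm (Z s \<omega>) \<le> c * norm (Y s \<omega>)" and c: "0 \<le> c"
  shows "energy T Z \<omega> \<le> ennreal (c\<^sup>2) * energy T Y \<omega>"
proof -
  have [measurable]: "(\<lambda>s. norm (Y s \<omega>)) \<in> borel_measurable (horizon T)"
    using section_measurable[OF Y \<omega>] by measurable
  have "energy T Z \<omega> \<le> (\<integral>\<^sup>+s. ennreal (c\<^sup>2) * ennreal ((norm (Y s \<omega>))\<^sup>2) \<partial>horizon T)"
    unfolding nn_integral_horizon
    using le c
    by (intro nn_integral_mono)
       (auto simp: space_restrict_space ennreal_mult'[symmetric] power_mult_distrib[symmetric] intro!: ennreal_leI power_mono)
  also have "\<dots> = ennreal (c\<^sup>2) * energy T Y \<omega>"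
    unfolding nn_integral_horizon by (rule nn_integral_cmult) measurable
  finally show ?thesis .
qed

lemma energy_add_le:
  assumes Y: "jointly_measurable T (Y :: real \<Rightarrow> 'a \<Rightarrow> 'b::real_normed_vector)"
    and Z: "jointly_measurable T (Z :: real \<Rightarrow> 'a \<Rightarrow> 'b)" and \<omega>: "\<omega> \<in> space M"
    and V: "\<And>s. s \<in> {0..T} \<Longrightarrow> norm (V s \<omega>) \<le> norm (Y s \<omega>) + norm (Z s \<omega>)"
  shows "energy T V \<omega> \<le> 2 * energy T Y \<omega> + 2 * energy T Z \<omega>"
proof -
  have [measurable]: "(\<lambda>s. norm (Y s \<omega>)) \<in> borel_measurable (horizon T)" "(\<lambda>s. norm (Z s \<omega>)) \<in> borel_measurable (horizon T)"
    using section_measurable[OF Y \<omega>] section_measurable[OF Z \<omega>] by measurable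
  have "energy T V \<omega> \<le> (\<integral>\<^sup>+s. 2 * ennreal ((norm (Y s \<omega>))\<^sup>2) + 2 * ennreal ((norm (Z s \<omega>))\<^sup>2) \<partial>horizon T)"
    unfolding nn_integral_horizon
  proof (rule nn_integral_mono)
    fix s assume "s \<in> space (horizon T)"
    then have "norm (V s \<omega>) \<le> norm (Y s \<omega>) + norm (Z s \<omega>)" using V by (simp add: space_restrict_space)
    then have "(norm (V s \<omega>))\<^sup>2 \<le> (norm (Y s \<omega>) - - norm (Z s \<omega>))\<^sup>2" by (intro power_mono) auto
    also have "\<dots> \<le> 2 * (norm (Y s \<omega>))\<^sup>2 + 2 * (norm (Z s \<omega>))\<^sup>2"
      using power2_diff_le[of "norm (Y s \<omega>)" "- norm (Z s \<omega>)"] by simp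
    finally have "ennreal ((norm (V s \<omega>))\<^sup>2) \<le> ennreal (2 * (norm (Y s \<omega>))\<^sup>2 + 2 * (norm (Z s \<omega>))\<^sup>2)"
      by (rule ennreal_leI)
    then show "ennreal ((norm (V s \<omega>))\<^sup>2) \<le> 2 * ennreal ((norm (Y s \<omega>))\<^sup>2) + 2 * ennreal ((norm (Z s \<omega>))\<^sup>2)"
      by (simp add: ennreal_plus ennreal_mult)
  qed
  also have "\<dots> = 2 * energy T Y \<omega> + 2 * energy T Z \<omega>"
    unfolding nn_integral_horizon by (simp add: nn_integral_add nn_integral_cmult)
  finally show ?thesis .
qed

lemma energy_tendsto:
  fixes Y :: "nat \<Rightarrow> real \<Rightarrow> 'a \<Rightarrow> 'b::{real_normed_vector, second_countable_topology}"
  assumes Y: "\<And>m. jointly_measurable T (Y m)" "jointly_measurable T Y'" and \<omega>: "\<omega> \<in> space M"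
    and b: "\<And>m s. s \<in> {0..T} \<Longrightarrow> norm (Y m s \<omega>) \<le> b"
    and lim: "\<And>s. 0 < s \<Longrightarrow> s \<le> T \<Longrightarrow> (\<lambda>m. Y m s \<omega>) \<longlonglongrightarrow> Y' s \<omega>"
  shows "(\<lambda>m. energy T (Y m) \<omega>) \<longlonglongrightarrow> energy T Y' \<omega>"
  unfolding nn_integral_horizon
proof (rule nn_integral_dominated_convergence)
  note [measurable] = section_measurable[OF Y(1) \<omega>] section_measurable[OF Y(2) \<omega>]
  show "(\<lambda>s. ennreal ((norm (Y m s \<omega>))\<^sup>2)) \<in> borel_measurable (horizon T)" for m by measurable
  show "(\<lambda>s. ennreal ((norm (Y' s \<omega>))\<^sup>2)) \<in> borel_measurable (horizon T)" by measurable
  show "(\<lambda>s. ennreal (b\<^sup>2)) \<in> borel_measurable (horizon T)" by simp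
  show "AE s in horizon T. ennreal ((norm (Y m s \<omega>))\<^sup>2) \<le> ennreal (b\<^sup>2)" for m
    using b by (intro AE_I2) (auto simp: space_restrict_space intro!: ennreal_leI power_mono)
  show "(\<integral>\<^sup>+s. ennreal (b\<^sup>2) \<partial>horizon T) < \<infinity>"
    unfolding nn_integral_const emeasure_horizon by (simp add: ennreal_mult_less_top)
  show "AE s in horizon T. (\<lambda>m. ennreal ((norm (Y m s \<omega>))\<^sup>2)) \<longlonglongrightarrow> ennreal ((norm (Y' s \<omega>))\<^sup>2)"
    using AE_horizon_pos by eventually_elim (intro tendsto_ennrealI tendsto_intros lim, auto)
qed

lemma expected_energy_tendsto:
  fixes Y :: "nat \<Rightarrow> real \<Rightarrow> 'a \<Rightarrow> 'b::{real_normed_vector, second_countable_topology}"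
  assumes Y: "\<And>m. jointly_measurable T (Y m)" "jointly_measurable T Y'"
    and b: "\<And>m s \<omega>. \<omega> \<in> space M \<Longrightarrow> s \<in> {0..T} \<Longrightarrow> norm (Y m s \<omega>) \<le> b"
    and lim: "\<And>s \<omega>. \<omega> \<in> space M \<Longrightarrow> 0 < s \<Longrightarrow> s \<le> T \<Longrightarrow> (\<lambda>m. Y m s \<omega>) \<longlonglongrightarrow> Y' s \<omega>"
  shows "(\<lambda>m. \<integral>\<^sup>+\<omega>. energy T (Y m) \<omega> \<partial>M) \<longlonglongrightarrow> (\<integral>\<^sup>+\<omega>. energy T Y' \<omega> \<partial>M)"
proof (rule nn_integral_dominated_convergence)
  show "(\<lambda>\<omega>. ennreal (b\<^sup>2 * max 0 T)) \<in> borel_measurable M" by simp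
  show "AE \<omega> in M. energy T (Y m) \<omega> \<le> ennreal (b\<^sup>2 * max 0 T)" for m
    using b by (intro AE_I2 energy_bounded) auto
  show "AE \<omega> in M. (\<lambda>m. energy T (Y m) \<omega>) \<longlonglongrightarrow> energy T Y' \<omega>"
    using b lim by (intro AE_I2 energy_tendsto Y) auto
qed (use energy_measurable[OF Y(1)] energy_measurable[OF Y(2)] in \<open>auto simp: emeasure_space_1\<close>)

lemma prob_exceeds_tendsto_0:
  fixes e :: "nat \<Rightarrow> 'a \<Rightarrow> ennreal"
  assumes [measurable]: "\<And>m. e m \<in> borel_measurable M" and lim: "\<And>\<omega>. \<omega> \<in> space M \<Longrightarrow> (\<lambda>m. e m \<omega>) \<longlonglongrightarrow> 0"
    and \<epsilon>: "0 < \<epsilon>"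
  shows "(\<lambda>m. prob {\<omega>\<in>space M. e m \<omega> > ennreal \<epsilon>}) \<longlonglongrightarrow> 0"
proof -
  have "(\<lambda>m. expectation (indicat_real {\<omega>\<in>space M. e m \<omega> > ennreal \<epsilon>})) \<longlonglongrightarrow> expectation (\<lambda>_. 0)"
  proof (rule integral_dominated_convergence[where w = "\<lambda>_. 1"])
    show "AE \<omega> in M. (\<lambda>m. indicat_real {\<omega>\<in>space M. e m \<omega> > ennreal \<epsilon>} \<omega>) \<longlonglongrightarrow> 0"
    proof (rule AE_I2)
      fix \<omega> assume "\<omega> \<in> space M"
      then have "eventually (\<lambda>m. e m \<omega> < ennreal \<epsilon>) sequentially"
        using order_tendstoD(2)[OF lim] \<epsilon> by (metis ennreal_0 ennreal_less_iff order_refl)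
      then have "eventually (\<lambda>m. indicat_real {\<omega>\<in>space M. e m \<omega> > ennreal \<epsilon>} \<omega> = 0) sequentially"
        by eventually_elim (auto simp: indicator_def)
      then show "(\<lambda>m. indicat_real {\<omega>\<in>space M. e m \<omega> > ennreal \<epsilon>} \<omega>) \<longlonglongrightarrow> 0"
        by (rule tendsto_eventually)
    qed
  qed (auto simp: indicator_def)
  then show ?thesis by simp
qed

lemma prob_exceeds_tendsto_0_L1:
  fixes e :: "nat \<Rightarrow> 'a \<Rightarrow> ennreal"
  assumes [measurable]: "\<And>m. e m \<in> borel_measurable M" and lim: "(\<lambda>m. \<integral>\<^sup>+\<omega>. e m \<omega> \<partial>M) \<longlonglongrightarrow> 0"
    and \<epsilon>: "0 < \<epsilon>"
  shows "(\<lambda>m. prob {\<omega>\<in>space M. e m \<omega> > ennreal \<epsilon>}) \<longlonglongrightarrow> 0"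
proof -
  have le: "ennreal (prob {\<omega>\<in>space M. e m \<omega> > ennreal \<epsilon>}) \<le> ennreal (1 / \<epsilon>) * (\<integral>\<^sup>+\<omega>. e m \<omega> \<partial>M)" for m
  proof -
    have "emeasure M {\<omega>\<in>space M. e m \<omega> > ennreal \<epsilon>} \<le> emeasure M ({\<omega>\<in>space M. 1 \<le> ennreal (1 / \<epsilon>) * e m \<omega>})"
    proof (intro emeasure_mono subsetI)
      fix \<omega> assume \<omega>: "\<omega> \<in> {\<omega>\<in>space M. e m \<omega> > ennreal \<epsilon>}"
      then have "ennreal (1 / \<epsilon>) * ennreal \<epsilon> \<le> ennreal (1 / \<epsilon>) * e m \<omega>" by (intro mult_left_mono) auto
      moreover have "ennreal (1 / \<epsilon>) * ennreal \<epsilon> = 1" using \<epsilon> by (simp add: ennreal_mult'[symmetric])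
      ultimately show "\<omega> \<in> {\<omega>\<in>space M. 1 \<le> ennreal (1 / \<epsilon>) * e m \<omega>}" using \<omega> by simp
    qed measurable
    also have "\<dots> \<le> ennreal (1 / \<epsilon>) * (\<integral>\<^sup>+\<omega>. e m \<omega> * indicator (space M) \<omega> \<partial>M)"
      by (rule nn_integral_Markov_inequality) auto
    also have "(\<integral>\<^sup>+\<omega>. e m \<omega> * indicator (space M) \<omega> \<partial>M) = (\<integral>\<^sup>+\<omega>. e m \<omega> \<partial>M)"
      by (intro nn_integral_cong) auto
    finally show ?thesis by (simp add: emeasure_eq_measure)
  qed
  have bound_lim: "(\<lambda>m. ennreal (1 / \<epsilon>) * (\<integral>\<^sup>+\<omega>. e m \<omega> \<partial>M)) \<longlonglongrightarrow> ennreal (1 / \<epsilon>) * 0"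
    using lim by (intro ennreal_tendsto_cmult) auto
  have "(\<lambda>m. ennreal (prob {\<omega>\<in>space M. e m \<omega> > ennreal \<epsilon>})) \<longlonglongrightarrow> 0"
    by (rule ennreal_squeeze_0[OF le]) (use bound_lim in simp)
  then show ?thesis by (simp add: ennreal_tendsto_0_iff)
qed

lemma prob_exceeds_cmult:
  assumes e: "\<And>j. e j \<in> borel_measurable M" and c: "0 < c"
    and le: "\<And>j \<omega>. \<omega> \<in> space M \<Longrightarrow> e' j \<omega> \<le> ennreal c * e j \<omega>"
    and lim: "\<And>\<epsilon>. 0 < \<epsilon> \<Longrightarrow> (\<lambda>j. prob (exceeds (e j) \<epsilon>)) \<longlonglongrightarrow> 0" and \<epsilon>: "0 < \<epsilon>"
  shows "(\<lambda>j. prob (exceeds (e' j) \<epsilon>)) \<longlonglongrightarrow> 0"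
proof (rule Lim_null_comparison[OF always_eventually[OF allI] lim[of "\<epsilon> / c"]])
  fix j
  have "prob (exceeds (e' j) \<epsilon>) \<le> prob (exceeds (e j) (\<epsilon> / c))"
  proof (intro finite_measure_mono subsetI)
    fix \<omega> assume \<omega>: "\<omega> \<in> exceeds (e' j) \<epsilon>"
    have "ennreal \<epsilon> = ennreal c * ennreal (\<epsilon> / c)"
      using c \<epsilon> by (simp add: ennreal_mult'[symmetric])
    moreover have "ennreal \<epsilon> < ennreal c * e j \<omega>" using \<omega> le[of \<omega> j] by (auto intro: less_le_trans)
    ultimately have "\<not> e j \<omega> \<le> ennreal (\<epsilon> / c)" by (metis leD mult_left_mono zero_le)
    then show "\<omega> \<in> exceeds (e j) (\<epsilon> / c)" using \<omega> by (simp add: not_le)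
  qed (use e in measurable)
  then show "norm (prob (exceeds (e' j) \<epsilon>)) \<le> prob (exceeds (e j) (\<epsilon> / c))" by simp
qed (use \<epsilon> c in simp)

lemma prob_exceeds_add:
  assumes [measurable]: "e1 \<in> borel_measurable M" "e2 \<in> borel_measurable M"
    and le: "\<And>\<omega>. \<omega> \<in> space M \<Longrightarrow> e \<omega> \<le> 2 * e1 \<omega> + 2 * e2 \<omega>" and \<delta>: "0 < \<delta>"
  shows "prob (exceeds e \<delta>) \<le> prob (exceeds e1 (\<delta> / 4)) + prob (exceeds e2 (\<delta> / 4))"
proof -
  \<comment> \<open>Each threshold \<open>\<delta> / 4\<close> is doubled in \<open>le\<close>, and
    the two halves add up to \<open>\<delta>\<close>.\<close>
  have half: "ennreal \<delta> = 2 * ennreal (\<delta> / 4) + 2 * ennreal (\<delta> / 4)"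
    using \<delta> ennreal_mult'[of 2 "\<delta> / 4"] ennreal_plus[of "\<delta> / 2" "\<delta> / 2"] by simp
  have "prob (exceeds e \<delta>) \<le> prob (exceeds e1 (\<delta> / 4) \<union> exceeds e2 (\<delta> / 4))"
  proof (intro finite_measure_mono subsetI)
    fix \<omega> assume \<omega>: "\<omega> \<in> exceeds e \<delta>"
    show "\<omega> \<in> exceeds e1 (\<delta> / 4) \<union> exceeds e2 (\<delta> / 4)"
    proof (rule ccontr)
      assume "\<not> ?thesis"
      then have "2 * e1 \<omega> + 2 * e2 \<omega> \<le> ennreal \<delta>"
        unfolding half using \<omega> by (intro add_mono mult_left_mono) (auto simp: not_less)
      then show False using \<omega> le[of \<omega>] by auto
    qed
  qed measurable
  also have "\<dots> \<le> prob (exceeds e1 (\<delta> / 4)) + prob (exceeds e2 (\<delta> / 4))"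
    by (rule measure_Un_le) auto
  finally show ?thesis .
qed

lemma tendsto_in_probability_inner:
  fixes Z :: "nat \<Rightarrow> 'a \<Rightarrow> 'b::euclidean_space"
  assumes "tendsto_in_probability M Z L"
  shows "tendsto_in_probability M (\<lambda>j \<omega>. e \<bullet> Z j \<omega>) (\<lambda>\<omega>. e \<bullet> L \<omega>)"
  unfolding tendsto_in_probability_def
proof (intro conjI allI impI)
  have [measurable]: "Z j \<in> borel_measurable M" "L \<in> borel_measurable M" for j
    using assms by (auto simp: tendsto_in_probability_def)
  show "(\<lambda>\<omega>. e \<bullet> Z j \<omega>) \<in> borel_measurable M" "(\<lambda>\<omega>. e \<bullet> L \<omega>) \<in> borel_measurable M" for j
    by measurable
  fix \<epsilon> :: real assume \<epsilon>: "0 < \<epsilon>"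
  \<comment> \<open>The added 1 keeps the divisor positive when \<open>e = 0\<close>.\<close>
  define \<kappa> where "\<kappa> = \<epsilon> / (norm e + 1)"
  have "0 < \<kappa>" using \<epsilon> by (simp add: \<kappa>_def add_nonneg_pos)
  then have lim: "(\<lambda>j. prob {\<omega>\<in>space M. dist (Z j \<omega>) (L \<omega>) > \<kappa>}) \<longlonglongrightarrow> 0"
    using assms by (simp add: tendsto_in_probability_def)
  have "prob {\<omega>\<in>space M. dist (e \<bullet> Z j \<omega>) (e \<bullet> L \<omega>) > \<epsilon>} \<le> prob {\<omega>\<in>space M. dist (Z j \<omega>) (L \<omega>) > \<kappa>}" for j
  proof (intro finite_measure_mono subsetI)
    fix \<omega> assume *: "\<omega> \<in> {\<omega>\<in>space M. dist (e \<bullet> Z j \<omega>) (e \<bullet> L \<omega>) > \<epsilon>}"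
    then have "\<epsilon> < \<bar>e \<bullet> (Z j \<omega> - L \<omega>)\<bar>" by (simp add: dist_real_def inner_diff_right)
    also have "\<dots> \<le> norm e * norm (Z j \<omega> - L \<omega>)" by (rule Cauchy_Schwarz_ineq2)
    also have "\<dots> \<le> (norm e + 1) * norm (Z j \<omega> - L \<omega>)" by (simp add: mult_right_mono)
    finally have "\<kappa> < norm (Z j \<omega> - L \<omega>)" by (simp add: \<kappa>_def pos_divide_less_eq add_nonneg_pos mult.commute)
    then show "\<omega> \<in> {\<omega>\<in>space M. dist (Z j \<omega>) (L \<omega>) > \<kappa>}" using * by (simp add: dist_norm)
  qed measurable
  then show "(\<lambda>j. prob {\<omega>\<in>space M. dist (e \<bullet> Z j \<omega>) (e \<bullet> L \<omega>) > \<epsilon>}) \<longlonglongrightarrow> 0"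
    by (intro Lim_null_comparison[OF always_eventually lim]) simp
qed

end

section \<open>Simple integrals and the freedom of approximation\<close>

context brownian_motion
begin

lemma progressively_measurable_joint:
  assumes "progressively_measurable Fb Y" "0 \<le> t"
  shows "jointly_measurable t Y"
proof -
  have Y: "(\<lambda>(s, \<omega>). Y s \<omega>) \<in> borel_measurable (restrict_space borel {0..t} \<Otimes>\<^sub>M Fb t)"
    using assms by (auto simp: progressively_measurable_def)
  have id: "(\<lambda>\<omega>. \<omega>) \<in> measurable M (Fb t)"
    using sets_Fb_subset[of t] by (intro measurableI) (auto dest: sets.sets_into_space)
  have hid: "(\<lambda>s. s) \<in> measurable (horizon t) (restrict_space borel {0..t})"
    by (simp add: measurable_def sets_restrict_space space_restrict_space) auto
  have "(\<lambda>(\<omega>, s). (s, \<omega>)) \<in> measurable (M \<Otimes>\<^sub>M horizon t) (restrict_space borel {0..t} \<Otimes>\<^sub>M Fb t)"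
    unfolding split_beta'
    by (intro measurable_Pair measurable_compose[OF measurable_snd hid] measurable_compose[OF measurable_fst id])
  from measurable_compose[OF this Y] show ?thesis by (simp add: split_beta')
qed

lemma simple_value_joint:
  assumes S: "simple_process Fb n \<tau> (\<xi> :: nat \<Rightarrow> 'a \<Rightarrow> 'b::{second_countable_topology, real_normed_vector})"
  shows "jointly_measurable t (simple_value n \<tau> \<xi>)"
proof -
  have \<xi>: "\<xi> i \<in> borel_measurable M" if "i < n" for i
    using S that by (auto simp: simple_process_def intro: Fb_measurable_M)
  have "(\<lambda>x. indicator {\<tau> i<..\<tau> (Suc i)} (snd x) *\<^sub>R \<xi> i (fst x)) \<in> borel_measurable (M \<Otimes>\<^sub>M horizon t)"
    if "i < n" for i
  proof -
    have [measurable]: "\<xi> i \<in> borel_measurable M" by (rule \<xi>[OF that])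
    have [measurable]: "(\<lambda>s. indicator {\<tau> i<..\<tau> (Suc i)} s :: real) \<in> borel_measurable (horizon t)"
      by (rule measurable_restrict_space1) simp
    show ?thesis by measurable
  qed
  then show ?thesis
    unfolding simple_value_def split_beta' by (intro borel_measurable_sum) auto
qed

text \<open>Comparison with the empty process specializes statements about differences to a single
  process.\<close>

lemma simple_process_zero: "simple_process Fb 0 (\<lambda>_. 0) \<xi>"
  by (simp add: simple_process_def)

lemma simple_integral_diff_isometry:
  assumes "simple_process Fb n1 \<tau>1 \<xi>1" "simple_process Fb n2 \<tau>2 \<xi>2" "0 \<le> t"
  shows "(\<integral>\<^sup>+\<omega>. ennreal ((wiener_integral k n1 \<tau>1 \<xi>1 t \<omega> - wiener_integral k n2 \<tau>2 \<xi>2 t \<omega>)\<^sup>2) \<partial>M)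
     = mean_energy t (\<lambda>s \<omega>. simple_value n1 \<tau>1 \<xi>1 s \<omega> - simple_value n2 \<tau>2 \<xi>2 s \<omega>)"
proof (rule common_steps[OF assms])
  fix n q \<zeta> assume "adapted_steps n q \<zeta>"
    and eq: "\<And>k \<omega>. wiener_integral k n1 \<tau>1 \<xi>1 t \<omega> - wiener_integral k n2 \<tau>2 \<xi>2 t \<omega> = step_sum k n q \<zeta> \<omega>"
      "\<And>\<omega>. energy t (\<lambda>s \<omega>. simple_value n1 \<tau>1 \<xi>1 s \<omega> - simple_value n2 \<tau>2 \<xi>2 s \<omega>) \<omega>
        = ennreal (\<Sum>i<n. (q (Suc i) - q i) * (\<zeta> i \<omega>)\<^sup>2)"
  then show ?thesis by (simp only: eq step_sum_isometry_nn)
qed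

lemma simple_integral_isometry:
  assumes "simple_process Fb n \<tau> \<xi>" "0 \<le> t"
  shows "(\<integral>\<^sup>+\<omega>. ennreal ((wiener_integral k n \<tau> \<xi> t \<omega>)\<^sup>2) \<partial>M) = mean_energy t (simple_value n \<tau> \<xi>)"
  using simple_integral_diff_isometry[OF assms(1) simple_process_zero assms(2)]
  by (simp add: simple_integral_def simple_value_def)

lemma ex_steps:
  assumes "simple_process Fb n \<tau> (\<xi> :: nat \<Rightarrow> 'a \<Rightarrow> real)" "0 \<le> t"
  shows "\<exists>m q \<zeta>. adapted_steps m q \<zeta> \<and> wiener_integral k n \<tau> \<xi> t = step_sum k m q \<zeta>"
  by (rule common_steps[OF assms(1) simple_process_zero assms(2)])
     (auto simp: simple_integral_def fun_eq_iff)

lemma simple_integral_measurable: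
  "simple_process Fb n \<tau> \<xi> \<Longrightarrow> 0 \<le> t \<Longrightarrow> wiener_integral k n \<tau> \<xi> t \<in> borel_measurable M"
  using ex_steps[of n \<tau> \<xi> t k] step_sum_measurable by auto

lemma simple_integral_diff_tail_bound:
  assumes "simple_process Fb n1 \<tau>1 \<xi>1" "simple_process Fb n2 \<tau>2 \<xi>2" "0 \<le> t" and pos: "0 < \<epsilon>" "0 \<le> \<delta>"
  shows "prob {\<omega>\<in>space M. \<bar>wiener_integral k n1 \<tau>1 \<xi>1 t \<omega> - wiener_integral k n2 \<tau>2 \<xi>2 t \<omega>\<bar> \<ge> \<epsilon>}
     \<le> prob (exceeds (energy t (\<lambda>s \<omega>. simple_value n1 \<tau>1 \<xi>1 s \<omega> - simple_value n2 \<tau>2 \<xi>2 s \<omega>)) \<delta>) + \<delta> / \<epsilon>\<^sup>2"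
proof (rule common_steps[OF assms(1-3)])
  fix n q \<zeta> assume "adapted_steps n q \<zeta>"
    and eq: "\<And>k \<omega>. wiener_integral k n1 \<tau>1 \<xi>1 t \<omega> - wiener_integral k n2 \<tau>2 \<xi>2 t \<omega> = step_sum k n q \<zeta> \<omega>"
      "\<And>\<omega>. energy t (\<lambda>s \<omega>. simple_value n1 \<tau>1 \<xi>1 s \<omega> - simple_value n2 \<tau>2 \<xi>2 s \<omega>) \<omega>
        = ennreal (\<Sum>i<n. (q (Suc i) - q i) * (\<zeta> i \<omega>)\<^sup>2)"
  then show ?thesis
    unfolding eq using step_sum_tail_bound[of n q \<zeta> \<epsilon> \<delta> k] pos by (simp add: ennreal_less_iff)
qed

text \<open>\<open>has_ito_integral\<close> supplies one approximating sequence of unknown shape.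
  Any other one is compared with it through the tail bound: the energy of their difference is
  controlled by the two errors against \<open>Y\<close>.\<close>

lemma ito_integral_simple_limit:
  assumes ito: "has_ito_integral M Fb (\<lambda>s \<omega>. W s \<omega> $ k) (Y :: real \<Rightarrow> 'a \<Rightarrow> real) t I" and t: "0 \<le> t"
    and R: "\<And>j. simple_process Fb (n j) (\<tau> j) (\<xi> j)"
    and conv: "\<And>\<epsilon>. 0 < \<epsilon> \<Longrightarrow>
      (\<lambda>j. prob (exceeds (energy t (\<lambda>s \<omega>. simple_value (n j) (\<tau> j) (\<xi> j) s \<omega> - Y s \<omega>)) \<epsilon>)) \<longlonglongrightarrow> 0"
  shows "tendsto_in_probability M (\<lambda>j. wiener_integral k (n j) (\<tau> j) (\<xi> j) t) I"
proof -
  define er where "er m \<rho> \<phi> = energy t (\<lambda>s \<omega>. simple_value m \<rho> \<phi> s \<omega> - Y s \<omega>)" for m \<rho> \<phi>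
  obtain N \<sigma> \<eta> where S: "\<And>j. simple_process Fb (N j) (\<sigma> j) (\<eta> j)"
    and S_conv: "\<And>\<epsilon>. 0 < \<epsilon> \<Longrightarrow> (\<lambda>j. prob (exceeds (er (N j) (\<sigma> j) (\<eta> j)) \<epsilon>)) \<longlonglongrightarrow> 0"
    and S_lim: "tendsto_in_probability M (\<lambda>j. wiener_integral k (N j) (\<sigma> j) (\<eta> j) t) I"
    using ito unfolding has_ito_integral_def er_def by auto
  have Y: "jointly_measurable t Y"
    using ito t by (intro progressively_measurable_joint) (auto simp: has_ito_integral_def)
  have joint: "jointly_measurable t (\<lambda>s \<omega>. simple_value m \<rho> \<phi> s \<omega> - Y s \<omega>)" if "simple_process Fb m \<rho> \<phi>" for m \<rho> \<phi>
    by (intro diff_joint simple_value_joint that Y)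
  have er_meas: "er m \<rho> \<phi> \<in> borel_measurable M" if "simple_process Fb m \<rho> \<phi>" for m \<rho> \<phi>
    unfolding er_def by (rule energy_measurable[OF joint[OF that]])
  let ?J = "\<lambda>j. wiener_integral k (n j) (\<tau> j) (\<xi> j) t"
  let ?K = "\<lambda>j. wiener_integral k (N j) (\<sigma> j) (\<eta> j) t"
  have [measurable]: "?J j \<in> borel_measurable M" "?K j \<in> borel_measurable M" "I \<in> borel_measurable M" for j
    using simple_integral_measurable[OF R t] simple_integral_measurable[OF S t] S_lim
    by (auto simp: tendsto_in_probability_def)
  have bound: "prob {\<omega>\<in>space M. dist (?J j \<omega>) (I \<omega>) > \<epsilon>} \<le>
      prob (exceeds (er (n j) (\<tau> j) (\<xi> j)) (\<delta> / 4)) + prob (exceeds (er (N j) (\<sigma> j) (\<eta> j)) (\<delta> / 4))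
      + \<delta> / (\<epsilon> / 2)\<^sup>2 + prob {\<omega>\<in>space M. dist (?K j \<omega>) (I \<omega>) > \<epsilon> / 2}"
    if pos: "0 < \<epsilon>" "0 < \<delta>" for \<epsilon> \<delta> j
  proof -
    let ?D = "\<lambda>s \<omega>. simple_value (n j) (\<tau> j) (\<xi> j) s \<omega> - simple_value (N j) (\<sigma> j) (\<eta> j) s \<omega>"
    let ?A = "{\<omega>\<in>space M. \<bar>?J j \<omega> - ?K j \<omega>\<bar> \<ge> \<epsilon> / 2}" and ?B = "{\<omega>\<in>space M. dist (?K j \<omega>) (I \<omega>) > \<epsilon> / 2}"
    have "prob {\<omega>\<in>space M. dist (?J j \<omega>) (I \<omega>) > \<epsilon>} \<le> prob (?A \<union> ?B)"
    proof (intro finite_measure_mono subsetI)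
      fix \<omega> assume *: "\<omega> \<in> {\<omega>\<in>space M. dist (?J j \<omega>) (I \<omega>) > \<epsilon>}"
      then have "\<bar>?J j \<omega> - ?K j \<omega>\<bar> \<ge> \<epsilon> / 2 \<or> dist (?K j \<omega>) (I \<omega>) > \<epsilon> / 2"
        unfolding mem_Collect_eq dist_real_def by arith
      then show "\<omega> \<in> ?A \<union> ?B" using * by auto
    qed measurable
    also have "\<dots> \<le> prob ?A + prob ?B" by (rule measure_Un_le) auto
    also have "prob ?A \<le> prob (exceeds (energy t ?D) \<delta>) + \<delta> / (\<epsilon> / 2)\<^sup>2"
      using pos by (intro simple_integral_diff_tail_bound R S t) auto
    also have "prob (exceeds (energy t ?D) \<delta>)
        \<le> prob (exceeds (er (n j) (\<tau> j) (\<xi> j)) (\<delta> / 4)) + prob (exceeds (er (N j) (\<sigma> j) (\<eta> j)) (\<delta> / 4))"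
    proof (rule prob_exceeds_add[OF er_meas[OF R] er_meas[OF S] _ pos(2)])
      fix \<omega> assume "\<omega> \<in> space M"
      then show "energy t ?D \<omega> \<le> 2 * er (n j) (\<tau> j) (\<xi> j) \<omega> + 2 * er (N j) (\<sigma> j) (\<eta> j) \<omega>"
        unfolding er_def by (intro energy_add_le joint R S) auto
    qed
    finally show ?thesis by simp
  qed
  show ?thesis
    unfolding tendsto_in_probability_def
  proof (intro conjI allI impI)
    fix \<epsilon> :: real assume \<epsilon>: "0 < \<epsilon>"
    show "(\<lambda>j. prob {\<omega>\<in>space M. dist (?J j \<omega>) (I \<omega>) > \<epsilon>}) \<longlonglongrightarrow> 0"
    proof (rule LIMSEQ_I)
      fix \<kappa> :: real assume \<kappa>: "0 < \<kappa>"
      \<comment> \<open>Makes the Chebyshev term of \<open>bound\<close> equal to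
        \<open>\<kappa> / 4\<close>; the other three terms are eventually below
        \<open>\<kappa> / 4\<close> each.\<close>
      define \<delta> where "\<delta> = \<kappa> / 4 * (\<epsilon> / 2)\<^sup>2"
      have \<delta>: "0 < \<delta>" "\<delta> / (\<epsilon> / 2)\<^sup>2 = \<kappa> / 4" using \<kappa> \<epsilon> by (auto simp: \<delta>_def)
      have lims: "(\<lambda>j. prob (exceeds (er (n j) (\<tau> j) (\<xi> j)) (\<delta> / 4))) \<longlonglongrightarrow> 0"
        "(\<lambda>j. prob (exceeds (er (N j) (\<sigma> j) (\<eta> j)) (\<delta> / 4))) \<longlonglongrightarrow> 0"
        "(\<lambda>j. prob {\<omega>\<in>space M. dist (?K j \<omega>) (I \<omega>) > \<epsilon> / 2}) \<longlonglongrightarrow> 0"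
        using conv[of "\<delta> / 4"] S_conv[of "\<delta> / 4"] \<delta> \<epsilon>
          S_lim[unfolded tendsto_in_probability_def, THEN conjunct2, THEN conjunct2, rule_format, of "\<epsilon> / 2"]
        unfolding er_def by simp_all
      have "0 < \<kappa> / 4" using \<kappa> by simp
      note order_tendstoD(2)[OF lims(1) this] order_tendstoD(2)[OF lims(2) this] order_tendstoD(2)[OF lims(3) this]
      then have "eventually (\<lambda>j. norm (prob {\<omega>\<in>space M. dist (?J j \<omega>) (I \<omega>) > \<epsilon>} - 0) < \<kappa>) sequentially"
      proof eventually_elim
        case (elim j)
        then show ?case using bound[OF \<epsilon> \<delta>(1), of j] \<delta>(2) by simp
      qed
      then show "\<exists>n0. \<forall>j\<ge>n0. norm (prob {\<omega>\<in>space M. dist (?J j \<omega>) (I \<omega>) > \<epsilon>} - 0) < \<kappa>"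
        by (simp add: eventually_sequentially)
    qed
  qed measurable
qed

text \<open>Vector-valued integrals are handled through their functionals; the approximating simple
  processes are projected along \<open>e\<close>.\<close>

lemma has_ito_integral_inner:
  fixes Y :: "real \<Rightarrow> 'a \<Rightarrow> 'b::euclidean_space"
  assumes ito: "has_ito_integral M Fb B Y t I" and t: "0 \<le> t"
  shows "has_ito_integral M Fb B (\<lambda>s \<omega>. e \<bullet> Y s \<omega>) t (\<lambda>\<omega>. e \<bullet> I \<omega>)"
proof -
  define c where "c = (norm e + 1)\<^sup>2"
  have c: "0 < c" by (simp add: c_def add_nonneg_eq_0_iff)
  have scaled: "energy t (\<lambda>s \<omega>. e \<bullet> V s \<omega>) \<omega> \<le> ennreal c * energy t V \<omega>"
    if "jointly_measurable t V" "\<omega> \<in> space M" for V :: "real \<Rightarrow> 'a \<Rightarrow> 'b" and \<omega>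
    unfolding c_def
  proof (rule energy_scaled[OF that])
    fix s show "norm (e \<bullet> V s \<omega>) \<le> (norm e + 1) * norm (V s \<omega>)"
      using Cauchy_Schwarz_ineq2[of e "V s \<omega>"] norm_ge_zero[of "V s \<omega>"]
      unfolding distrib_right mult_1 real_norm_def by linarith
  qed simp
  obtain N \<tau> \<xi> where S: "\<And>j. simple_process Fb (N j) (\<tau> j) (\<xi> j)"
    and S_conv: "\<And>\<epsilon>. 0 < \<epsilon> \<Longrightarrow>
      (\<lambda>j. prob (exceeds (energy t (\<lambda>s \<omega>. simple_value (N j) (\<tau> j) (\<xi> j) s \<omega> - Y s \<omega>)) \<epsilon>)) \<longlonglongrightarrow> 0"
    and S_lim: "tendsto_in_probability M (\<lambda>j. simple_integral B (N j) (\<tau> j) (\<xi> j) t) I"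
    and Yp: "progressively_measurable Fb Y"
    and Y_fin: "AE \<omega> in M. energy t Y \<omega> < \<infinity>"
    using ito unfolding has_ito_integral_def by auto
  have Y: "jointly_measurable t Y" by (rule progressively_measurable_joint[OF Yp t])
  define \<xi>' where "\<xi>' j i \<omega> = e \<bullet> \<xi> j i \<omega>" for j i \<omega>
  have val: "simple_value (N j) (\<tau> j) (\<xi>' j) s \<omega> = e \<bullet> simple_value (N j) (\<tau> j) (\<xi> j) s \<omega>" for j s \<omega>
    by (simp add: simple_value_def \<xi>'_def inner_sum_right)
  have int: "simple_integral B (N j) (\<tau> j) (\<xi>' j) t = (\<lambda>\<omega>. e \<bullet> simple_integral B (N j) (\<tau> j) (\<xi> j) t \<omega>)" for j
    by (simp add: fun_eq_iff simple_integral_def \<xi>'_def inner_sum_right)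
  have joint: "jointly_measurable t (\<lambda>s \<omega>. simple_value (N j) (\<tau> j) (\<xi> j) s \<omega> - Y s \<omega>)" for j
    by (intro diff_joint simple_value_joint S Y)
  show ?thesis
    unfolding has_ito_integral_def
  proof (intro conjI exI[of _ N] exI[of _ \<tau>] exI[of _ \<xi>'] allI impI)
    show "progressively_measurable Fb (\<lambda>s \<omega>. e \<bullet> Y s \<omega>)"
      using Yp unfolding progressively_measurable_def by (auto simp: split_beta')
    show "AE \<omega> in M. energy t (\<lambda>s \<omega>. e \<bullet> Y s \<omega>) \<omega> < \<infinity>"
      using Y_fin AE_space
    proof eventually_elim
      case (elim \<omega>)
      then have "ennreal c * energy t Y \<omega> < \<infinity>" by (simp add: ennreal_mult_less_top)
      with scaled[OF Y elim(2)] show ?case by (rule le_less_trans)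
    qed
    show "simple_process Fb (N j) (\<tau> j) (\<xi>' j)" for j
      unfolding simple_process_def
    proof (intro conjI allI impI)
      fix i assume i: "i < N j"
      have "bounded (\<xi> j i ` space M)" using S[of j] i by (auto simp: simple_process_def)
      then have "bounded ((\<lambda>x. e \<bullet> x) ` (\<xi> j i ` space M))"
        by (rule bounded_linear_image) (rule bounded_linear_inner_right)
      then show "bounded (\<xi>' j i ` space (Fb (\<tau> j i)))" by (simp add: \<xi>'_def image_comp comp_def)
      have "\<xi> j i \<in> borel_measurable (Fb (\<tau> j i))" using S[of j] i by (auto simp: simple_process_def)
      then show "\<xi>' j i \<in> borel_measurable (Fb (\<tau> j i))" by (simp add: \<xi>'_def[abs_def])
    qed (use S[of j] in \<open>auto simp: simple_process_def\<close>)
    show "tendsto_in_probability M (\<lambda>j. simple_integral B (N j) (\<tau> j) (\<xi>' j) t) (\<lambda>\<omega>. e \<bullet> I \<omega>)"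
      unfolding int by (rule tendsto_in_probability_inner[OF S_lim])
    show "(\<lambda>j. prob (exceeds (energy t (\<lambda>s \<omega>. simple_value (N j) (\<tau> j) (\<xi>' j) s \<omega> - e \<bullet> Y s \<omega>)) \<epsilon>)) \<longlonglongrightarrow> 0"
      if "0 < \<epsilon>" for \<epsilon>
      using that unfolding val inner_diff_right[symmetric]
      by (intro prob_exceeds_cmult[OF energy_measurable[OF joint] c scaled[OF joint] S_conv]) auto
  qed
qed

lemma simple_integral_martingale:
  assumes S: "simple_process Fb n \<tau> (\<xi> :: nat \<Rightarrow> 'a \<Rightarrow> real)" and st: "0 \<le> s" "s \<le> t"
    and Z: "Z \<in> borel_measurable (Fb s)" "integrable M Z"
  shows "integrable M (\<lambda>\<omega>. Z \<omega> * (wiener_integral k n \<tau> \<xi> t \<omega> - wiener_integral k n \<tau> \<xi> s \<omega>))"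
    and "expectation (\<lambda>\<omega>. Z \<omega> * (wiener_integral k n \<tau> \<xi> t \<omega> - wiener_integral k n \<tau> \<xi> s \<omega>)) = 0"
proof -
  \<comment> \<open>Times are clamped to \<open>{s..t}\<close>, so that only increments between
    \<open>s\<close> and \<open>t\<close> survive.\<close>
  define p where "p i = max s (min t (\<tau> i))" for i
  \<comment> \<open>A collapsed cell may come from \<open>\<tau> i > t\<close>, where
    \<open>\<xi> i\<close> need not be known at \<open>p i\<close>; its increment is zero, so the
    coefficient may be set to 0.\<close>
  define \<zeta> where "\<zeta> i \<omega> = (if p i < p (Suc i) then \<xi> i \<omega> else 0)" for i \<omega>
  have \<zeta>: "adapted_steps n p \<zeta>"
    unfolding adapted_steps_def
  proof (intro conjI allI impI)
    show "0 \<le> p 0" using st by (simp add: p_def)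
    fix i assume i: "i < n"
    show "p i \<le> p (Suc i)" using simple_process_mono[OF S, of i "Suc i"] i by (auto simp: p_def)
    have \<xi>: "\<xi> i \<in> borel_measurable (Fb (\<tau> i))" using S i by (simp add: simple_process_def)
    show "\<zeta> i \<in> borel_measurable (Fb (p i))"
    proof (cases "p i < p (Suc i)")
      case True
      then have "\<tau> i \<le> p i" by (auto simp: p_def)
      then show ?thesis using Fb_measurable_mono[OF \<xi>] True by (simp add: \<zeta>_def[abs_def])
    qed (simp add: \<zeta>_def[abs_def])
    have "bounded (\<xi> i ` space M)" using S i by (simp add: simple_process_def)
    then obtain K where "\<And>\<omega>. \<omega> \<in> space M \<Longrightarrow> \<bar>\<xi> i \<omega>\<bar> \<le> K" by (auto simp: bounded_iff)
    then show "\<exists>K. \<forall>\<omega>\<in>space M. \<bar>\<zeta> i \<omega>\<bar> \<le> K"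
      by (intro exI[of _ "max K 0"]) (auto simp: \<zeta>_def le_max_iff_disj)
  qed
  have split: "b (min t x) - b (min s x) = b (max s (min t x)) - b s" for b :: "real \<Rightarrow> real" and x
    using st by (auto simp: max_def min_def)
  have eq: "wiener_integral k n \<tau> \<xi> t \<omega> - wiener_integral k n \<tau> \<xi> s \<omega> = step_sum k n p \<zeta> \<omega>" for \<omega>
    unfolding simple_integral_def step_sum_def sum_subtractf[symmetric]
  proof (rule sum.cong)
    fix i assume i: "i \<in> {..<n}"
    have "p i \<le> p (Suc i)" using simple_process_mono[OF S, of i "Suc i"] i by (auto simp: p_def)
    then have *: "(W (p (Suc i)) \<omega> $ k - W (p i) \<omega> $ k) * \<zeta> i \<omega> = (W (p (Suc i)) \<omega> $ k - W (p i) \<omega> $ k) * \<xi> i \<omega>"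
      by (cases "p i = p (Suc i)") (auto simp: \<zeta>_def)
    show "(W (min t (\<tau> (Suc i))) \<omega> $ k - W (min t (\<tau> i)) \<omega> $ k) *\<^sub>R \<xi> i \<omega>
        - (W (min s (\<tau> (Suc i))) \<omega> $ k - W (min s (\<tau> i)) \<omega> $ k) *\<^sub>R \<xi> i \<omega>
      = (W (p (Suc i)) \<omega> $ k - W (p i) \<omega> $ k) * \<zeta> i \<omega>"
    proof -
      have "W (min t (\<tau> (Suc i))) \<omega> $ k - W (min t (\<tau> i)) \<omega> $ k - (W (min s (\<tau> (Suc i))) \<omega> $ k - W (min s (\<tau> i)) \<omega> $ k)
          = W (p (Suc i)) \<omega> $ k - W (p i) \<omega> $ k"
        using split[of "\<lambda>s. W s \<omega> $ k" "\<tau> i"] split[of "\<lambda>s. W s \<omega> $ k" "\<tau> (Suc i)"]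
        unfolding p_def by linarith
      then show ?thesis unfolding * by (simp add: left_diff_distrib[symmetric])
    qed
  qed simp
  have "Z \<in> borel_measurable (Fb (p 0))" by (rule Fb_measurable_mono[OF Z(1)]) (simp add: p_def)
  from step_sum_past[OF \<zeta> this Z(2), of k]
  show "integrable M (\<lambda>\<omega>. Z \<omega> * (wiener_integral k n \<tau> \<xi> t \<omega> - wiener_integral k n \<tau> \<xi> s \<omega>))"
    and "expectation (\<lambda>\<omega>. Z \<omega> * (wiener_integral k n \<tau> \<xi> t \<omega> - wiener_integral k n \<tau> \<xi> s \<omega>)) = 0"
    unfolding eq by auto
qed

text \<open>On a common partition this is the case of distinct components in
  \<open>step_sum_product\<close>.\<close>

lemma simple_integral_orthogonal:
  assumes S1: "simple_process Fb n1 \<tau>1 (\<xi>1 :: nat \<Rightarrow> 'a \<Rightarrow> real)" and S2: "simple_process Fb n2 \<tau>2 (\<xi>2 :: nat \<Rightarrow> 'a \<Rightarrow> real)"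
    and t: "0 \<le> t" and "k \<noteq> l"
  shows "expectation (\<lambda>\<omega>. wiener_integral k n1 \<tau>1 \<xi>1 t \<omega> * wiener_integral l n2 \<tau>2 \<xi>2 t \<omega>) = 0"
proof -
  obtain P n q where q: "partition_of P t n q" and P1: "\<And>j. j \<le> n1 \<Longrightarrow> min t (\<tau>1 j) \<in> P"
    and P2: "\<And>j. j \<le> n2 \<Longrightarrow> min t (\<tau>2 j) \<in> P"
    using common_partition[OF S1 S2 t] by metis
  have "wiener_integral k n1 \<tau>1 \<xi>1 t = step_sum k n q (\<lambda>i. simple_value n1 \<tau>1 \<xi>1 (q (Suc i)))"
    "wiener_integral l n2 \<tau>2 \<xi>2 t = step_sum l n q (\<lambda>i. simple_value n2 \<tau>2 \<xi>2 (q (Suc i)))"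
    using simple_integral_steps[OF q S1 P1] simple_integral_steps[OF q S2 P2] by blast+
  then show ?thesis
    using step_sum_product(2)[OF simple_process_steps[OF q S1 P1] simple_process_steps[OF q S2 P2], of k l] \<open>k \<noteq> l\<close>
    by simp
qed

end

section \<open>Truncated Riemann sums\<close>

text \<open>\<open>Suc m\<close> equal cells, which avoids an empty grid at
  \<open>m = 0\<close>.\<close>

definition grid :: "real \<Rightarrow> nat \<Rightarrow> nat \<Rightarrow> real" where
  "grid T m i = T * real i / real (Suc m)"

lemma grid_0 [simp]: "grid T m 0 = 0"
  by (simp add: grid_def)

lemma grid_mono: "0 \<le> T \<Longrightarrow> i \<le> j \<Longrightarrow> grid T m i \<le> grid T m j"
  unfolding grid_def by (intro divide_right_mono mult_left_mono) auto

lemma grid_nonneg: "0 \<le> T \<Longrightarrow> 0 \<le> grid T m i"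
  by (simp add: grid_def)

lemma grid_Suc: "grid T m (Suc i) = grid T m i + T / real (Suc m)"
  by (simp add: grid_def add_divide_distrib distrib_left)

lemma ex_grid_cell:
  assumes "0 < s" "s \<le> T"
  shows "\<exists>i<Suc m. grid T m i < s \<and> s \<le> grid T m (Suc i)"
proof -
  define i where "i = (LEAST i. s \<le> grid T m (Suc i))"
  have "s \<le> grid T m (Suc m)" using assms by (simp add: grid_def)
  then have i: "s \<le> grid T m (Suc i)" "i \<le> m"
    unfolding i_def by (rule LeastI[where P = "\<lambda>i. s \<le> grid T m (Suc i)"], intro Least_le)
  have "grid T m i < s"
  proof (cases i)
    case (Suc j)
    then show ?thesis using not_less_Least[of j "\<lambda>i. s \<le> grid T m (Suc i)"] by (simp add: i_def)
  qed (use assms in simp)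
  with i show ?thesis by (intro exI[of _ i]) auto
qed

lemma simple_value_grid:
  assumes T: "0 \<le> T" and i: "i < Suc m" "grid T m i < s" "s \<le> grid T m (Suc i)"
  shows "simple_value (Suc m) (grid T m) \<xi> s \<omega> = \<xi> i \<omega>"
proof -
  have "indicator {grid T m j<..grid T m (Suc j)} s *\<^sub>R \<xi> j \<omega> = (if j = i then \<xi> i \<omega> else 0)" for j
  proof (cases i j rule: linorder_cases)
    case less
    then have "grid T m (Suc i) \<le> grid T m j" using T by (intro grid_mono) auto
    then show ?thesis using less i by simp
  next
    case greater
    then have "grid T m (Suc j) \<le> grid T m i" using T by (intro grid_mono) auto
    then show ?thesis using greater i by simp
  qed (use i in simp)
  then show ?thesis using i by (simp add: simple_value_def)
qed

text \<open>Applied to left ends of grid cells, which lie strictly below \<open>s\<close> and within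
  one mesh width of it.\<close>

lemma tendsto_from_below:
  assumes "\<And>m. s - T / real (Suc m) \<le> r m" "\<And>m. r m < s"
  shows "r \<longlonglongrightarrow> s"
proof (rule tendsto_sandwich)
  have "(\<lambda>m. s - T / real (Suc m)) \<longlonglongrightarrow> s - 0"
    by (intro tendsto_diff tendsto_const LIMSEQ_Suc[OF lim_const_over_n])
  then show "(\<lambda>m. s - T / real (Suc m)) \<longlonglongrightarrow> s" by simp
  show "(\<lambda>_. s) \<longlonglongrightarrow> s" by simp
qed (use assms in \<open>auto intro!: always_eventually less_imp_le\<close>)

section \<open>Cutoff by the running maximum\<close>

locale continuous_adapted_process = brownian_motion M F W
  for M :: "'a measure" and F and W :: "real \<Rightarrow> 'a \<Rightarrow> real^'m" +
  fixes X :: "real \<Rightarrow> 'a \<Rightarrow> real^'d"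
  assumes X_adapted: "0 \<le> t \<Longrightarrow> X t \<in> borel_measurable (Fb t)"
    and X_continuous: "\<omega> \<in> space M \<Longrightarrow> continuous_on {0..} (\<lambda>t. X t \<omega>)"
begin

lemma X_measurable: "0 \<le> t \<Longrightarrow> X t \<in> borel_measurable M"
  by (rule Fb_measurable_M[OF X_adapted])

lemma X_tendsto:
  assumes "\<omega> \<in> space M" "\<And>m. 0 \<le> r m" "r \<longlonglongrightarrow> s"
  shows "(\<lambda>m. X (r m) \<omega>) \<longlonglongrightarrow> X s \<omega>"
proof -
  have "0 \<le> s" using assms(2,3) by (intro LIMSEQ_le_const[OF assms(3)]) auto
  then show ?thesis
    using continuous_on_tendsto_compose[OF X_continuous[OF assms(1)] assms(3)] assms(2) by simp
qed

text \<open>The whole path up to \<open>t\<close> is tested, not \<open>X t\<close> alone: the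
  condition then passes to all earlier times, as for a stopping time.\<close>

definition held :: "nat \<Rightarrow> real \<Rightarrow> 'a \<Rightarrow> bool" where
  "held n t \<omega> \<longleftrightarrow> (\<forall>u\<in>{0..t}. norm (X u \<omega>) \<le> real n)"

definition truncated :: "nat \<Rightarrow> real \<Rightarrow> 'a \<Rightarrow> real^'d" where
  "truncated n t \<omega> = (if held n t \<omega> then X t \<omega> else 0)"

abbreviation riemann :: "nat \<Rightarrow> real \<Rightarrow> nat \<Rightarrow> real \<Rightarrow> 'a \<Rightarrow> real^'d" where
  "riemann n T m \<equiv> simple_value (Suc m) (grid T m) (\<lambda>i. truncated n (grid T m i))"

lemma held_antimono: "held n t \<omega> \<Longrightarrow> s \<le> t \<Longrightarrow> held n s \<omega>"
  by (auto simp: held_def)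

lemma held_mono: "held n t \<omega> \<Longrightarrow> n \<le> n' \<Longrightarrow> held n' t \<omega>"
  unfolding held_def by (meson of_nat_mono order_trans)

lemma norm_truncated_le: "0 \<le> t \<Longrightarrow> norm (truncated n t \<omega>) \<le> real n"
  by (auto simp: truncated_def held_def)

lemma norm_truncated_le_X: "norm (truncated n t \<omega>) \<le> norm (X t \<omega>)"
  by (simp add: truncated_def)

lemma ex_held:
  assumes "\<omega> \<in> space M"
  shows "\<exists>n. held n t \<omega>"
proof -
  have "compact ((\<lambda>t. X t \<omega>) ` {0..t})"
    by (intro compact_continuous_image continuous_on_subset[OF X_continuous[OF assms]]) auto
  then have "bounded ((\<lambda>t. X t \<omega>) ` {0..t})" by (rule compact_imp_bounded)
  then obtain b where "\<forall>u\<in>{0..t}. norm (X u \<omega>) \<le> b"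
    by (auto simp: bounded_iff)
  then have b: "norm (X u \<omega>) \<le> b" if "u \<in> {0..t}" for u using that by blast
  obtain n :: nat where "b \<le> real n" using real_arch_simple by blast
  then show ?thesis unfolding held_def using b by (meson order_trans)
qed

text \<open>By continuity of paths countably many grid points decide a condition on an interval,
  which makes it measurable at time \<open>t\<close>.\<close>

lemma held_iff_grid:
  assumes \<omega>: "\<omega> \<in> space M" and t: "0 \<le> t"
  shows "held n t \<omega> \<longleftrightarrow> (\<forall>m. \<forall>i\<in>{..m}. norm (X (grid t m i) \<omega>) \<le> real n)"
proof
  assume "held n t \<omega>"
  moreover have "grid t m i \<in> {0..t}" if "i \<in> {..m}" for m i
    using grid_mono[OF t, of i "Suc m" m] that grid_nonneg[OF t, of m i] by (simp add: grid_def)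
  ultimately show "\<forall>m. \<forall>i\<in>{..m}. norm (X (grid t m i) \<omega>) \<le> real n" by (auto simp: held_def)
next
  assume *: "\<forall>m. \<forall>i\<in>{..m}. norm (X (grid t m i) \<omega>) \<le> real n"
  have "norm (X u \<omega>) \<le> real n" if u: "u \<in> {0..t}" for u
  \<comment> \<open>Time 0 lies in no left-open cell but is itself a node; a positive
    \<open>u\<close> is approached by left ends of cells.\<close>
  proof (cases "u = 0")
    case True
    then show ?thesis using spec[OF *, of 0] by simp
  next
    case False
    then have "\<exists>i<Suc m. grid t m i < u \<and> u \<le> grid t m (Suc i)" for m
      using u by (intro ex_grid_cell) auto
    then obtain i where i: "\<And>m. i m < Suc m" "\<And>m. grid t m (i m) < u" "\<And>m. u \<le> grid t m (Suc (i m))"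
      by metis
    have "(\<lambda>m. grid t m (i m)) \<longlonglongrightarrow> u"
      using i(2,3) by (intro tendsto_from_below[where T = t]) (auto simp: grid_Suc algebra_simps)
    then have "(\<lambda>m. norm (X (grid t m (i m)) \<omega>)) \<longlonglongrightarrow> norm (X u \<omega>)"
      using grid_nonneg[OF t] by (intro tendsto_norm X_tendsto[OF \<omega>]) auto
    then show ?thesis
      by (rule LIMSEQ_le_const2) (use * i(1) in \<open>auto simp: less_Suc_eq_le\<close>)
  qed
  then show "held n t \<omega>" by (simp add: held_def)
qed

lemma held_measurable:
  assumes t: "0 \<le> t"
  shows "Measurable.pred (Fb t) (held n t)"
proof -
  have "Measurable.pred (Fb t) (\<lambda>\<omega>. \<forall>m. \<forall>i\<in>{..m}. norm (X (grid t m i) \<omega>) \<le> real n)"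
  proof (intro pred_intros_countable(1) pred_intros_finite(3) finite_atMost)
    fix m i :: nat assume "i \<in> {..m}"
    then have "grid t m i \<le> t"
      using grid_mono[OF t, of i "Suc m" m] by (simp add: grid_def)
    then have [measurable]: "X (grid t m i) \<in> borel_measurable (Fb t)"
      using Fb_measurable_mono[OF X_adapted[OF grid_nonneg[OF t]]] by blast
    show "Measurable.pred (Fb t) (\<lambda>\<omega>. norm (X (grid t m i) \<omega>) \<le> real n)" by measurable
  qed
  then show ?thesis
    by (subst measurable_cong[OF held_iff_grid]) (use t in auto)
qed

lemma held_measurable_M: "0 \<le> t \<Longrightarrow> Measurable.pred M (held n t)"
  by (rule Fb_measurable_M[OF held_measurable])

lemma truncated_adapted: "0 \<le> t \<Longrightarrow> truncated n t \<in> borel_measurable (Fb t)"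
  unfolding truncated_def[abs_def] using held_measurable[of t n] X_adapted[of t] by measurable

lemma truncated_measurable: "0 \<le> t \<Longrightarrow> truncated n t \<in> borel_measurable M"
  by (rule Fb_measurable_M[OF truncated_adapted])

lemma riemann_simple_process:
  assumes T: "0 \<le> T"
  shows "simple_process Fb (Suc m) (grid T m) (\<lambda>i. truncated n (grid T m i))"
  unfolding simple_process_def
proof (intro conjI allI impI)
  fix i
  show "grid T m i \<le> grid T m (Suc i)" by (rule grid_mono[OF T]) simp
  show "truncated n (grid T m i) \<in> borel_measurable (Fb (grid T m i))"
    by (rule truncated_adapted[OF grid_nonneg[OF T]])
  show "bounded (truncated n (grid T m i) ` space (Fb (grid T m i)))"
    unfolding bounded_iff using norm_truncated_le[OF grid_nonneg[OF T]] by (intro exI[of _ "real n"]) auto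
qed simp

text \<open>The sampling time depends neither on the level nor on the path, so its convergence can
  be treated apart from both.\<close>

lemma ex_riemann_point:
  assumes "0 < s" "s \<le> T"
  obtains r where "0 \<le> r" "r < s" "s - T / real (Suc m) \<le> r" "\<And>n \<omega>. riemann n T m s \<omega> = truncated n r \<omega>"
proof -
  obtain i where i: "i < Suc m" "grid T m i < s" "s \<le> grid T m (Suc i)"
    using ex_grid_cell[OF assms] by blast
  show ?thesis
    by (rule that[of "grid T m i"])
       (use i simple_value_grid[OF _ i] assms in \<open>auto simp: grid_nonneg grid_Suc algebra_simps\<close>)
qed

lemma riemann_points:
  assumes "0 < s" "s \<le> T"
  obtains r where "\<And>m. 0 \<le> r m" "\<And>m. r m < s" "r \<longlonglongrightarrow> s" "\<And>m n \<omega>. riemann n T m s \<omega> = truncated n (r m) \<omega>"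
proof -
  have "\<exists>r\<ge>0. r < s \<and> s - T / real (Suc m) \<le> r \<and> (\<forall>n \<omega>. riemann n T m s \<omega> = truncated n r \<omega>)" for m
    using ex_riemann_point[OF assms, of m] by metis
  then obtain r where r: "\<And>m. 0 \<le> r m" "\<And>m. r m < s" "\<And>m. s - T / real (Suc m) \<le> r m"
    "\<And>m n \<omega>. riemann n T m s \<omega> = truncated n (r m) \<omega>"
    by metis
  show ?thesis by (rule that[OF r(1,2) tendsto_from_below[OF r(3,2)] r(4)])
qed

text \<open>The truncated process drops to 0 once the level is exceeded, yet it is left-continuous:
  if the bound holds up to \<open>s\<close>, no sampled value is cut off; otherwise an exceedance at
  or before \<open>s\<close> is eventually seen by the left ends.\<close>

lemma riemann_tendsto_truncated:
  assumes \<omega>: "\<omega> \<in> space M" and s: "0 < s" "s \<le> T"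
  shows "(\<lambda>m. riemann n T m s \<omega>) \<longlonglongrightarrow> truncated n s \<omega>"
proof -
  obtain r where r: "\<And>m. 0 \<le> r m" "\<And>m. r m < s" "r \<longlonglongrightarrow> s" "\<And>m n \<omega>. riemann n T m s \<omega> = truncated n (r m) \<omega>"
    using riemann_points[OF s] by blast
  have lim: "(\<lambda>m. X (r m) \<omega>) \<longlonglongrightarrow> X s \<omega>" by (rule X_tendsto[OF \<omega> r(1,3)])
  show ?thesis
  proof (cases "held n s \<omega>")
    case True
    then have "truncated n (r m) \<omega> = X (r m) \<omega>" for m
      using held_antimono[OF True less_imp_le[OF r(2)]] by (simp add: truncated_def)
    then show ?thesis using lim True by (simp add: r(4)) (simp add: truncated_def)
  next
    case False
    then obtain u where u: "0 \<le> u" "u \<le> s" "norm (X u \<omega>) > real n"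
      by (auto simp: held_def not_le)
    have "eventually (\<lambda>m. \<not> held n (r m) \<omega>) sequentially"
    \<comment> \<open>An exceedance at \<open>s\<close> itself is seen through continuity, as it is
      an open condition on \<open>X\<close>; an earlier one is seen as soon as \<open>r m\<close>
      has passed it.\<close>
    proof (cases "u = s")
      case True
      then have "eventually (\<lambda>m. norm (X (r m) \<omega>) > real n) sequentially"
        using order_tendstoD(1)[OF tendsto_norm[OF lim]] u by simp
      then show ?thesis by eventually_elim (use r(1) in \<open>auto simp: held_def not_le\<close>)
    next
      case False
      then have "eventually (\<lambda>m. u < r m) sequentially"
        using order_tendstoD(1)[OF r(3), of u] u by simp
      then show ?thesis by eventually_elim (use u in \<open>auto simp: held_def not_le intro!: bexI[of _ u]\<close>)
    qed
    then have "eventually (\<lambda>m. riemann n T m s \<omega> = 0) sequentially"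
      by eventually_elim (simp add: r(4) truncated_def)
    then show ?thesis using False by (simp add: tendsto_eventually truncated_def)
  qed
qed

text \<open>Level and number of cells grow together. For a fixed path the level eventually exceeds
  its maximum, and then only continuity matters.\<close>

lemma riemann_diagonal_tendsto:
  assumes \<omega>: "\<omega> \<in> space M" and s: "0 < s" "s \<le> T"
  shows "(\<lambda>m. riemann m T m s \<omega>) \<longlonglongrightarrow> X s \<omega>"
proof -
  obtain r where r: "\<And>m. 0 \<le> r m" "\<And>m. r m < s" "r \<longlonglongrightarrow> s" "\<And>m n \<omega>. riemann n T m s \<omega> = truncated n (r m) \<omega>"
    using riemann_points[OF s] by blast
  obtain n where n: "held n s \<omega>" using ex_held[OF \<omega>] by blast
  have "eventually (\<lambda>m. X (r m) \<omega> = riemann m T m s \<omega>) sequentially"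
    using eventually_ge_at_top[of n]
  proof eventually_elim
    case (elim m)
    then have "held m (r m) \<omega>"
      using held_mono[OF held_antimono[OF n less_imp_le[OF r(2)]]] by blast
    then show ?case by (simp add: r(4) truncated_def)
  qed
  then show ?thesis by (rule Lim_transform_eventually[OF X_tendsto[OF \<omega> r(1,3)]])
qed

lemma norm_riemann_le:
  assumes "s \<le> T"
  shows "norm (riemann n T m s \<omega>) \<le> real n"
proof (cases "0 < s")
  case True
  then show ?thesis
    using ex_riemann_point[OF True assms, of m] norm_truncated_le by metis
next
  \<comment> \<open>At a nonpositive time no step contains \<open>s\<close>: for
    \<open>T \<ge> 0\<close> the nodes are nonnegative, and for \<open>T < 0\<close> the grid
    decreases and all steps are empty.\<close>
  case False
  have "riemann n T m s \<omega> = 0" if "0 \<le> T"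
    using False grid_nonneg[OF that] unfolding simple_value_def
    by (intro sum.neutral) (auto simp: indicator_def not_less intro: order_trans)
  moreover have "riemann n T m s \<omega> = 0" if "T < 0"
    unfolding simple_value_def
  proof (intro sum.neutral ballI)
    fix i
    have "grid T m (Suc i) < grid T m i" using that by (simp add: grid_Suc divide_neg_pos)
    then show "indicat_real {grid T m i<..grid T m (Suc i)} s *\<^sub>R truncated n (grid T m i) \<omega> = 0" by simp
  qed
  ultimately show ?thesis by (cases "0 \<le> T") auto
qed

text \<open>The bound may depend on the path but not on level or mesh, as required for dominated
  convergence in time along one path.\<close>

lemma norm_riemann_diagonal_bounded:
  assumes \<omega>: "\<omega> \<in> space M"
  shows "\<exists>b\<ge>0. \<forall>n m s. s \<in> {0..T} \<longrightarrow> norm (riemann n T m s \<omega>) \<le> b \<and> norm (X s \<omega>) \<le> b"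
proof -
  obtain n0 where n0: "held n0 T \<omega>" using ex_held[OF \<omega>] by blast
  have b: "norm (X s \<omega>) \<le> real n0" if "s \<in> {0..T}" for s using n0 that by (simp add: held_def)
  have "norm (riemann n T m s \<omega>) \<le> real n0" if s: "s \<in> {0..T}" for n m s
  proof (cases "s = 0")
    case False
    then obtain r where "0 \<le> r" "r < s" "riemann n T m s \<omega> = truncated n r \<omega>"
      using ex_riemann_point[of s T m] s by (metis atLeastAtMost_iff order_less_le)
    then show ?thesis using norm_truncated_le_X[of n r \<omega>] b[of r] s by auto
  next
    case True
    have "riemann n T m s \<omega> = 0"
      using True s grid_nonneg[of T m] unfolding simple_value_def
      by (intro sum.neutral) (auto simp: indicator_def not_less)
    then show ?thesis by simp
  qed
  with b show ?thesis by (intro exI[of _ "real n0"]) auto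
qed

text \<open>Joint measurability is inherited from step functions; at time 0, where all of them
  vanish, the value of \<open>Y\<close> is inserted by hand.\<close>

lemma joint_from_limit:
  fixes Y :: "real \<Rightarrow> 'a \<Rightarrow> real^'d"
  assumes T: "0 \<le> T" and Y0: "Y 0 \<in> borel_measurable M"
    and lim: "\<And>\<omega> s. \<omega> \<in> space M \<Longrightarrow> 0 < s \<Longrightarrow> s \<le> T \<Longrightarrow> (\<lambda>m. riemann (\<nu> m) T m s \<omega>) \<longlonglongrightarrow> Y s \<omega>"
  shows "jointly_measurable T Y"
proof (rule borel_measurable_LIMSEQ_metric)
  have z: "(\<lambda>s. s) \<in> borel_measurable (horizon T)"
    by (rule measurable_restrict_space1) simp
  show "(\<lambda>(\<omega>, s). if s = 0 then Y 0 \<omega> else riemann (\<nu> m) T m s \<omega>) \<in> borel_measurable (M \<Otimes>\<^sub>M horizon T)" for m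
  proof -
    note [measurable] = simple_value_joint[OF riemann_simple_process[OF T, of m "\<nu> m"], of T, unfolded split_beta'] Y0 z
    show ?thesis unfolding split_beta' by measurable
  qed
  show "(\<lambda>m. case x of (\<omega>, s) \<Rightarrow> if s = 0 then Y 0 \<omega> else riemann (\<nu> m) T m s \<omega>) \<longlonglongrightarrow> (case x of (\<omega>, s) \<Rightarrow> Y s \<omega>)"
    if "x \<in> space (M \<Otimes>\<^sub>M horizon T)" for x
  proof -
    obtain \<omega> s where x: "x = (\<omega>, s)" by (cases x)
    then have "\<omega> \<in> space M" "0 \<le> s" "s \<le> T"
      using that by (auto simp: space_pair_measure space_restrict_space)
    then show ?thesis using lim[of \<omega> s] by (cases "s = 0") (auto simp: x)
  qed
qed

lemma X_joint: "0 \<le> T \<Longrightarrow> jointly_measurable T X"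
  using riemann_diagonal_tendsto by (intro joint_from_limit[where \<nu> = "\<lambda>m. m"] X_measurable) auto

lemma truncated_joint: "0 \<le> T \<Longrightarrow> jointly_measurable T (truncated n)"
  using riemann_tendsto_truncated by (intro joint_from_limit[where \<nu> = "\<lambda>m. n"] truncated_measurable) auto

end

section \<open>Integrals of truncated Riemann sums\<close>

context continuous_adapted_process
begin

abbreviation riemann_integral :: "'m \<Rightarrow> real^'d \<Rightarrow> nat \<Rightarrow> real \<Rightarrow> nat \<Rightarrow> real \<Rightarrow> 'a \<Rightarrow> real" where
  "riemann_integral k c n T m \<equiv> wiener_integral k (Suc m) (grid T m) (\<lambda>i \<omega>. c \<bullet> truncated n (grid T m i) \<omega>)"

lemma inner_riemann:
  "simple_value (Suc m) (grid T m) (\<lambda>i \<omega>. c \<bullet> truncated n (grid T m i) \<omega>) s \<omega> = c \<bullet> riemann n T m s \<omega>"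
  by (simp add: simple_value_def inner_sum_right del: sum.lessThan_Suc)

lemma inner_riemann_simple_process:
  assumes T: "0 \<le> T"
  shows "simple_process Fb (Suc m) (grid T m) (\<lambda>i \<omega>. c \<bullet> truncated n (grid T m i) \<omega>)"
  unfolding simple_process_def
proof (intro conjI allI impI)
  fix i
  show "grid T m i \<le> grid T m (Suc i)" by (rule grid_mono[OF T]) simp
  show "(\<lambda>\<omega>. c \<bullet> truncated n (grid T m i) \<omega>) \<in> borel_measurable (Fb (grid T m i))"
    by (intro borel_measurable_inner borel_measurable_const truncated_adapted[OF grid_nonneg[OF T]])
  have "\<bar>c \<bullet> truncated n (grid T m i) \<omega>\<bar> \<le> norm c * real n" for \<omega>
    using Cauchy_Schwarz_ineq2[of c "truncated n (grid T m i) \<omega>"] norm_truncated_le[OF grid_nonneg[OF T], of n m i \<omega>]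
    by (meson mult_left_mono norm_ge_zero order_trans)
  then show "bounded ((\<lambda>\<omega>. c \<bullet> truncated n (grid T m i) \<omega>) ` space (Fb (grid T m i)))"
    unfolding bounded_iff by (intro exI[of _ "norm c * real n"]) auto
qed simp

lemma inner_joint:
  "jointly_measurable T (Y :: real \<Rightarrow> 'a \<Rightarrow> real^'d) \<Longrightarrow> jointly_measurable T (\<lambda>s \<omega>. c \<bullet> Y s \<omega>)"
  unfolding split_beta' by (intro borel_measurable_inner borel_measurable_const)

lemma riemann_joint: "0 \<le> T \<Longrightarrow> jointly_measurable t (riemann n T m)"
  by (rule simple_value_joint[OF riemann_simple_process])

text \<open>On \<open>held n t\<close> the Riemann sums truncated at growing levels, which converge to \<open>I\<close>, agree with those
  truncated at the fixed level \<open>n\<close>, to which the isometry applies.\<close>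

lemma ito_truncated_bound:
  assumes ito: "has_ito_integral M Fb (\<lambda>s \<omega>. W s \<omega> $ k) (\<lambda>s \<omega>. c \<bullet> X s \<omega>) t I" and t: "0 \<le> t"
  shows "(\<integral>\<^sup>+\<omega>. ennreal (of_bool (held n t \<omega>) * (I \<omega>)\<^sup>2) \<partial>M) \<le> mean_energy t (\<lambda>s \<omega>. c \<bullet> truncated n s \<omega>)"
proof -
  note S = inner_riemann_simple_process[OF t]
  have "tendsto_in_probability M (\<lambda>m. riemann_integral k c m t m t) I"
  \<comment> \<open>The diagonal sums approximate \<open>X\<close> along every path, hence in energy
    in probability, without any information on moments.\<close>
  proof (rule ito_integral_simple_limit[OF ito t S], unfold inner_riemann)
    have J: "jointly_measurable t (\<lambda>s \<omega>. c \<bullet> riemann m t m s \<omega> - c \<bullet> X s \<omega>)" for m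
      by (intro diff_joint inner_joint riemann_joint X_joint t)
    have lim: "(\<lambda>m. energy t (\<lambda>s \<omega>. c \<bullet> riemann m t m s \<omega> - c \<bullet> X s \<omega>) \<omega>) \<longlonglongrightarrow> energy t (\<lambda>s \<omega>. 0 :: real) \<omega>"
      if \<omega>: "\<omega> \<in> space M" for \<omega>
    proof -
      obtain b where b: "0 \<le> b" "\<And>n m s. s \<in> {0..t} \<Longrightarrow> norm (riemann n t m s \<omega>) \<le> b \<and> norm (X s \<omega>) \<le> b"
        using norm_riemann_diagonal_bounded[OF \<omega>] by blast
      show ?thesis
      proof (rule energy_tendsto[where b = "norm c * b + norm c * b", OF J _ \<omega>])
        fix m s assume "s \<in> {0..t}"
        note b(2)[OF this, of m m]
        then have "norm c * norm (riemann m t m s \<omega>) \<le> norm c * b" "norm c * norm (X s \<omega>) \<le> norm c * b"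
          by (auto intro: mult_left_mono)
        then show "norm (c \<bullet> riemann m t m s \<omega> - c \<bullet> X s \<omega>) \<le> norm c * b + norm c * b"
          using Cauchy_Schwarz_ineq2[of c "riemann m t m s \<omega>"] Cauchy_Schwarz_ineq2[of c "X s \<omega>"]
          unfolding real_norm_def by linarith
      next
        fix s assume "0 < s" "s \<le> t"
        then have "(\<lambda>m. c \<bullet> riemann m t m s \<omega> - c \<bullet> X s \<omega>) \<longlonglongrightarrow> c \<bullet> X s \<omega> - c \<bullet> X s \<omega>"
          by (intro tendsto_intros riemann_diagonal_tendsto[OF \<omega>])
        then show "(\<lambda>m. c \<bullet> riemann m t m s \<omega> - c \<bullet> X s \<omega>) \<longlonglongrightarrow> 0" by simp
      qed simp
    qed
    fix \<epsilon> :: real assume "0 < \<epsilon>"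
    from prob_exceeds_tendsto_0[OF energy_measurable[OF J] _ this]
    show "(\<lambda>m. prob (exceeds (energy t (\<lambda>s \<omega>. c \<bullet> riemann m t m s \<omega> - c \<bullet> X s \<omega>)) \<epsilon>)) \<longlonglongrightarrow> 0"
      using lim by simp
  qed
  moreover have "(\<lambda>\<omega>. of_bool (held n t \<omega>) :: real) \<in> borel_measurable M"
    using held_measurable_M[OF t, of n] by (simp add: of_bool_def)
  moreover have "(\<lambda>_. 0 :: real) \<in> borel_measurable M" by simp
  moreover have "eventually (\<lambda>m. (\<integral>\<^sup>+\<omega>. ennreal (of_bool (held n t \<omega>) * (riemann_integral k c m t m t \<omega> - 0)\<^sup>2) \<partial>M)
      \<le> mean_energy t (\<lambda>s \<omega>. c \<bullet> riemann n t m s \<omega>)) sequentially"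
    using eventually_ge_at_top[of n]
  proof eventually_elim
    case (elim m)
    have "(\<integral>\<^sup>+\<omega>. ennreal (of_bool (held n t \<omega>) * (riemann_integral k c m t m t \<omega> - 0)\<^sup>2) \<partial>M)
        \<le> (\<integral>\<^sup>+\<omega>. ennreal ((riemann_integral k c n t m t \<omega>)\<^sup>2) \<partial>M)"
    proof (intro nn_integral_mono ennreal_leI)
      fix \<omega>
      have "riemann_integral k c m t m t \<omega> = riemann_integral k c n t m t \<omega>" if "held n t \<omega>"
        unfolding simple_integral_def
      proof (rule sum.cong)
        fix i assume "i \<in> {..<Suc m}"
        then have "grid t m i \<le> t" using grid_mono[OF t, of i "Suc m" m] by (simp add: grid_def)
        then have "held n (grid t m i) \<omega>" by (rule held_antimono[OF that])
        moreover from held_mono[OF this elim] have "held m (grid t m i) \<omega>" .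
        ultimately show "(W (min t (grid t m (Suc i))) \<omega> $ k - W (min t (grid t m i)) \<omega> $ k) *\<^sub>R (c \<bullet> truncated m (grid t m i) \<omega>) =
         (W (min t (grid t m (Suc i))) \<omega> $ k - W (min t (grid t m i)) \<omega> $ k) *\<^sub>R (c \<bullet> truncated n (grid t m i) \<omega>)"
          by (simp add: truncated_def)
      qed simp
      then show "of_bool (held n t \<omega>) * (riemann_integral k c m t m t \<omega> - 0)\<^sup>2 \<le> (riemann_integral k c n t m t \<omega>)\<^sup>2"
        by (cases "held n t \<omega>") auto
    qed
    also have "\<dots> = mean_energy t (\<lambda>s \<omega>. c \<bullet> riemann n t m s \<omega>)"
      unfolding simple_integral_isometry[OF S t] inner_riemann ..
    finally show ?case .
  qed
  moreover have "(\<lambda>m. mean_energy t (\<lambda>s \<omega>. c \<bullet> riemann n t m s \<omega>))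
      \<longlonglongrightarrow> mean_energy t (\<lambda>s \<omega>. c \<bullet> truncated n s \<omega>)"
  proof (rule expected_energy_tendsto[where b = "norm c * real n"])
    fix m s \<omega> assume "s \<in> {0..t}"
    then have "norm (riemann n t m s \<omega>) \<le> real n" by (intro norm_riemann_le) auto
    then show "norm (c \<bullet> riemann n t m s \<omega>) \<le> norm c * real n"
      using Cauchy_Schwarz_ineq2[of c "riemann n t m s \<omega>"]
      unfolding real_norm_def by (meson mult_left_mono norm_ge_zero order_trans)
  qed (intro inner_joint riemann_joint truncated_joint t tendsto_intros riemann_tendsto_truncated; assumption)+
  ultimately have "(\<integral>\<^sup>+\<omega>. ennreal (of_bool (held n t \<omega>) * (I \<omega> - 0)\<^sup>2) \<partial>M)
      \<le> mean_energy t (\<lambda>s \<omega>. c \<bullet> truncated n s \<omega>)"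
    by (rule fatou_in_probability)
  then show ?thesis by simp
qed


text \<open>At a fixed level \<open>n\<close> all norms involved are at most \<open>2 n\<close>, so
  bounded convergence applies.\<close>

lemma expected_energy_riemann_truncated:
  assumes T: "0 \<le> T"
  shows "(\<lambda>m. mean_energy T (\<lambda>s \<omega>. riemann n T m s \<omega> - truncated n s \<omega>)) \<longlonglongrightarrow> 0"
proof -
  have "(\<lambda>m. mean_energy T (\<lambda>s \<omega>. riemann n T m s \<omega> - truncated n s \<omega>))
     \<longlonglongrightarrow> mean_energy T (\<lambda>s \<omega>. 0 :: real^'d)"
  proof (rule expected_energy_tendsto[where b = "real n + real n"])
    show "jointly_measurable T (\<lambda>s \<omega>. riemann n T m s \<omega> - truncated n s \<omega>)" for m
      by (intro diff_joint riemann_joint truncated_joint T)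
    show "norm (riemann n T m s \<omega> - truncated n s \<omega>) \<le> real n + real n" if "s \<in> {0..T}" for m s \<omega>
      using that by (intro norm_triangle_le_diff add_mono norm_riemann_le norm_truncated_le) auto
    fix s \<omega> assume "\<omega> \<in> space M" "0 < s" "s \<le> T"
    then have "(\<lambda>m. riemann n T m s \<omega> - truncated n s \<omega>) \<longlonglongrightarrow> truncated n s \<omega> - truncated n s \<omega>"
      by (intro tendsto_intros riemann_tendsto_truncated)
    then show "(\<lambda>m. riemann n T m s \<omega> - truncated n s \<omega>) \<longlonglongrightarrow> 0" by simp
  qed simp
  then show ?thesis by simp
qed

text \<open>The error is dominated by \<open>X\<close> itself, and along each path the cutoff is
  eventually inactive on the whole interval.\<close>

lemma expected_energy_truncated:
  assumes T: "0 \<le> T" and fin: "mean_energy T X < \<infinity>"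
  shows "(\<lambda>n. mean_energy T (\<lambda>s \<omega>. truncated n s \<omega> - X s \<omega>)) \<longlonglongrightarrow> 0"
proof -
  have J: "jointly_measurable T (\<lambda>s \<omega>. truncated n s \<omega> - X s \<omega>)" for n
    by (intro diff_joint truncated_joint X_joint T)
  have le: "norm (truncated n s \<omega> - X s \<omega>) \<le> norm (X s \<omega>)" for n s \<omega>
    by (simp add: truncated_def)
  have "(\<lambda>n. mean_energy T (\<lambda>s \<omega>. truncated n s \<omega> - X s \<omega>)) \<longlonglongrightarrow> (\<integral>\<^sup>+\<omega>. 0 \<partial>M)"
  proof (rule nn_integral_dominated_convergence[OF energy_measurable[OF J] _ energy_measurable[OF X_joint[OF T]] _ fin])
    show "AE \<omega> in M. energy T (\<lambda>s \<omega>. truncated n s \<omega> - X s \<omega>) \<omega> \<le> energy T X \<omega>" for n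
      using le by (intro AE_I2 energy_le)
    show "AE \<omega> in M. (\<lambda>n. energy T (\<lambda>s \<omega>. truncated n s \<omega> - X s \<omega>) \<omega>) \<longlonglongrightarrow> 0"
    proof (rule AE_I2)
      fix \<omega> assume \<omega>: "\<omega> \<in> space M"
      obtain n0 where n0: "held n0 T \<omega>" using ex_held[OF \<omega>] by blast
      have "eventually (\<lambda>n. energy T (\<lambda>s \<omega>. truncated n s \<omega> - X s \<omega>) \<omega> = 0) sequentially"
        using eventually_ge_at_top[of n0]
      proof eventually_elim
        case (elim n)
        have "energy T (\<lambda>s \<omega>. truncated n s \<omega> - X s \<omega>) \<omega> \<le> energy T (\<lambda>s \<omega>. 0 :: real) \<omega>"
          using held_mono[OF held_antimono[OF n0] elim] by (intro energy_le) (simp add: truncated_def)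
        then show ?case by simp
      qed
      then show "(\<lambda>n. energy T (\<lambda>s \<omega>. truncated n s \<omega> - X s \<omega>) \<omega>) \<longlonglongrightarrow> 0" by (rule tendsto_eventually)
    qed
  qed simp
  then show ?thesis by simp
qed

lemma ex_riemann_approximation:
  assumes T: "0 \<le> T" and fin: "mean_energy T X < \<infinity>"
  shows "\<exists>\<nu> \<mu>. (\<lambda>j. mean_energy T (\<lambda>s \<omega>. riemann (\<nu> j) T (\<mu> j) s \<omega> - X s \<omega>)) \<longlonglongrightarrow> 0"
proof -
  define e where "e n m = mean_energy T (\<lambda>s \<omega>. riemann n T m s \<omega> - X s \<omega>)" for n m
  have "\<exists>n m. e n m \<le> ennreal (4 / real (Suc j))" for j
  proof -
    \<comment> \<open>The level is chosen first, then the mesh. Two errors below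
      \<open>\<epsilon>\<close>, each doubled by squaring a sum, give at most four times
      \<open>\<epsilon>\<close>.\<close>
    define \<epsilon> where "\<epsilon> = ennreal (1 / real (Suc j))"
    have \<epsilon>: "0 < \<epsilon>" by (simp add: \<epsilon>_def)
    obtain n where n: "mean_energy T (\<lambda>s \<omega>. truncated n s \<omega> - X s \<omega>) < \<epsilon>"
      using order_tendstoD(2)[OF expected_energy_truncated[OF T fin] \<epsilon>] by (auto simp: eventually_sequentially)
    let ?X = "truncated n"
    obtain m where m: "mean_energy T (\<lambda>s \<omega>. riemann n T m s \<omega> - ?X s \<omega>) < \<epsilon>"
      using order_tendstoD(2)[OF expected_energy_riemann_truncated[OF T] \<epsilon>] by (auto simp: eventually_sequentially)
    let ?R = "riemann n T m"
    have J: "jointly_measurable T (\<lambda>s \<omega>. ?R s \<omega> - ?X s \<omega>)" "jointly_measurable T (\<lambda>s \<omega>. ?X s \<omega> - X s \<omega>)"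
      by (intro diff_joint riemann_joint truncated_joint X_joint T)+
    have "e n m \<le> (\<integral>\<^sup>+\<omega>. 2 * energy T (\<lambda>s \<omega>. ?R s \<omega> - ?X s \<omega>) \<omega> + 2 * energy T (\<lambda>s \<omega>. ?X s \<omega> - X s \<omega>) \<omega> \<partial>M)"
      unfolding e_def
    proof (intro nn_integral_mono energy_add_le J)
      fix \<omega> s
      show "norm (?R s \<omega> - X s \<omega>) \<le> norm (?R s \<omega> - ?X s \<omega>) + norm (?X s \<omega> - X s \<omega>)"
        using norm_triangle_ineq[of "?R s \<omega> - ?X s \<omega>" "?X s \<omega> - X s \<omega>"] by simp
    qed
    also have "\<dots> = 2 * mean_energy T (\<lambda>s \<omega>. ?R s \<omega> - ?X s \<omega>) + 2 * mean_energy T (\<lambda>s \<omega>. ?X s \<omega> - X s \<omega>)"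
      using J[THEN energy_measurable] by (simp add: nn_integral_add nn_integral_cmult)
    also have "\<dots> \<le> 2 * \<epsilon> + 2 * \<epsilon>" using n m by (intro add_mono mult_left_mono) auto
    also have "\<dots> = ennreal (4 / real (Suc j))"
      using ennreal_mult'[of 2 "1 / real (Suc j)"] ennreal_plus[of "2 / real (Suc j)" "2 / real (Suc j)"]
      by (simp add: \<epsilon>_def)
    finally show ?thesis by blast
  qed
  then obtain \<nu> \<mu> where le: "\<And>j. e (\<nu> j) (\<mu> j) \<le> ennreal (4 / real (Suc j))"
    by metis
  have "(\<lambda>j. 4 / real (Suc j)) \<longlonglongrightarrow> 0" by (rule LIMSEQ_Suc[OF lim_const_over_n])
  then have lim: "(\<lambda>j. ennreal (4 / real (Suc j))) \<longlonglongrightarrow> 0" by (metis ennreal_0 tendsto_ennrealI)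
  have "(\<lambda>j. e (\<nu> j) (\<mu> j)) \<longlonglongrightarrow> 0" by (rule ennreal_squeeze_0[OF le lim])
  then show ?thesis unfolding e_def by blast
qed

lemma inner_le_norm_bound: "norm (c \<bullet> x) \<le> norm c * norm (x :: real^'d)"
  using Cauchy_Schwarz_ineq2[of c x] by simp

lemma inner_diff_energy_le:
  assumes "jointly_measurable T (\<lambda>s \<omega>. Y s \<omega> - Z s \<omega> :: real^'d)" "\<omega> \<in> space M" "t \<le> T"
  shows "energy t (\<lambda>s \<omega>. c \<bullet> Y s \<omega> - c \<bullet> Z s \<omega>) \<omega> \<le> ennreal ((norm c)\<^sup>2) * energy T (\<lambda>s \<omega>. Y s \<omega> - Z s \<omega>) \<omega>"
proof -
  have "energy t (\<lambda>s \<omega>. c \<bullet> Y s \<omega> - c \<bullet> Z s \<omega>) \<omega> \<le> energy T (\<lambda>s \<omega>. c \<bullet> Y s \<omega> - c \<bullet> Z s \<omega>) \<omega>"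
    by (rule energy_mono[OF assms(3)])
  also have "\<dots> \<le> ennreal ((norm c)\<^sup>2) * energy T (\<lambda>s \<omega>. Y s \<omega> - Z s \<omega>) \<omega>"
    using inner_le_norm_bound[of c] by (intro energy_scaled assms) (auto simp: inner_diff_right[symmetric])
  finally show ?thesis .
qed

text \<open>Convergence in probability identifies the limit as \<open>I\<close>, while the isometry
  makes the simple integrals Cauchy in mean square. One sequence serves all times up to
  \<open>T\<close>, all components and all functionals.\<close>

lemma ito_L2_limit:
  assumes T: "0 \<le> T" and approx: "(\<lambda>j. mean_energy T (\<lambda>s \<omega>. riemann (\<nu> j) T (\<mu> j) s \<omega> - X s \<omega>)) \<longlonglongrightarrow> 0"
    and t: "0 \<le> t" "t \<le> T" and ito: "has_ito_integral M Fb (\<lambda>s \<omega>. W s \<omega> $ k) (\<lambda>s \<omega>. c \<bullet> X s \<omega>) t I"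
  shows "(\<lambda>j. \<integral>\<^sup>+\<omega>. ennreal ((riemann_integral k c (\<nu> j) T (\<mu> j) t \<omega> - I \<omega>)\<^sup>2) \<partial>M) \<longlonglongrightarrow> 0"
proof -
  let ?R = "\<lambda>j. riemann (\<nu> j) T (\<mu> j)" and ?J = "\<lambda>j. riemann_integral k c (\<nu> j) T (\<mu> j) t"
  define C where "C = ennreal ((norm c)\<^sup>2)"
  have C: "C < \<top>" by (simp add: C_def)
  define a where "a j = mean_energy T (\<lambda>s \<omega>. ?R j s \<omega> - X s \<omega>)" for j
  have a: "a \<longlonglongrightarrow> 0" using approx by (simp add: a_def[abs_def])
  note S = inner_riemann_simple_process[OF T]
  have JX: "jointly_measurable t' (\<lambda>s \<omega>. ?R j s \<omega> - X s \<omega>)" if "0 \<le> t'" for t' j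
    using that by (intro diff_joint riemann_joint X_joint T)
  have scaled: "mean_energy t (\<lambda>s \<omega>. c \<bullet> ?R j s \<omega> - c \<bullet> X s \<omega>) \<le> C * a j" for j
  proof -
    have "mean_energy t (\<lambda>s \<omega>. c \<bullet> ?R j s \<omega> - c \<bullet> X s \<omega>) \<le> (\<integral>\<^sup>+\<omega>. C * energy T (\<lambda>s \<omega>. ?R j s \<omega> - X s \<omega>) \<omega> \<partial>M)"
      unfolding C_def by (intro nn_integral_mono inner_diff_energy_le JX T t)
    also have "\<dots> = C * a j"
      unfolding a_def by (rule nn_integral_cmult[OF energy_measurable[OF JX[OF T]]])
    finally show ?thesis .
  qed
  have lim: "tendsto_in_probability M ?J I"
  proof (rule ito_integral_simple_limit[OF ito t(1) S], unfold inner_riemann)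
    fix \<epsilon> :: real assume "0 < \<epsilon>"
    moreover have "(\<lambda>j. C * a j) \<longlonglongrightarrow> 0" using ennreal_tendsto_cmult[OF C a] by simp
    moreover have "jointly_measurable t (\<lambda>s \<omega>. c \<bullet> ?R j s \<omega> - c \<bullet> X s \<omega>)" for j
      by (intro diff_joint inner_joint riemann_joint X_joint T t)
    ultimately show "(\<lambda>j. prob (exceeds (energy t (\<lambda>s \<omega>. c \<bullet> ?R j s \<omega> - c \<bullet> X s \<omega>)) \<epsilon>)) \<longlonglongrightarrow> 0"
      by (intro prob_exceeds_tendsto_0_L1[OF energy_measurable ennreal_squeeze_0[OF scaled]])
  qed
  have cauchy: "(\<integral>\<^sup>+\<omega>. ennreal ((?J l \<omega> - ?J j \<omega>)\<^sup>2) \<partial>M) \<le> C * (2 * a l + 2 * a j)" for j l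
  proof -
    have "(\<integral>\<^sup>+\<omega>. ennreal ((?J l \<omega> - ?J j \<omega>)\<^sup>2) \<partial>M) = mean_energy t (\<lambda>s \<omega>. c \<bullet> ?R l s \<omega> - c \<bullet> ?R j s \<omega>)"
      unfolding simple_integral_diff_isometry[OF S S t(1)] inner_riemann ..
    also have "\<dots> \<le> (\<integral>\<^sup>+\<omega>. C * (2 * energy T (\<lambda>s \<omega>. ?R l s \<omega> - X s \<omega>) \<omega> + 2 * energy T (\<lambda>s \<omega>. ?R j s \<omega> - X s \<omega>) \<omega>) \<partial>M)"
    proof (rule nn_integral_mono)
      fix \<omega> assume \<omega>: "\<omega> \<in> space M"
      have "energy t (\<lambda>s \<omega>. c \<bullet> ?R l s \<omega> - c \<bullet> ?R j s \<omega>) \<omega> \<le> C * energy T (\<lambda>s \<omega>. ?R l s \<omega> - ?R j s \<omega>) \<omega>"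
        unfolding C_def by (intro inner_diff_energy_le diff_joint riemann_joint T t \<omega>)
      also have "\<dots> \<le> C * (2 * energy T (\<lambda>s \<omega>. ?R l s \<omega> - X s \<omega>) \<omega> + 2 * energy T (\<lambda>s \<omega>. ?R j s \<omega> - X s \<omega>) \<omega>)"
      proof (intro mult_left_mono energy_add_le JX T \<omega>)
        fix s show "norm (?R l s \<omega> - ?R j s \<omega>) \<le> norm (?R l s \<omega> - X s \<omega>) + norm (?R j s \<omega> - X s \<omega>)"
          using norm_triangle_ineq4[of "?R l s \<omega> - X s \<omega>" "?R j s \<omega> - X s \<omega>"] by simp
      qed simp
      finally show "energy t (\<lambda>s \<omega>. c \<bullet> ?R l s \<omega> - c \<bullet> ?R j s \<omega>) \<omega>
        \<le> C * (2 * energy T (\<lambda>s \<omega>. ?R l s \<omega> - X s \<omega>) \<omega> + 2 * energy T (\<lambda>s \<omega>. ?R j s \<omega> - X s \<omega>) \<omega>)" .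
    qed
    also have "\<dots> = C * (2 * a l + 2 * a j)"
      using energy_measurable[OF JX[OF T]] by (simp add: nn_integral_add nn_integral_cmult a_def)
    finally show ?thesis .
  qed
  \<comment> \<open>Fatou in the index \<open>l\<close>, with \<open>j\<close> held fixed.\<close>
  have main: "(\<integral>\<^sup>+\<omega>. ennreal (1 * (I \<omega> - ?J j \<omega>)\<^sup>2) \<partial>M) \<le> C * (2 * 0 + 2 * a j)" for j
  proof (rule fatou_in_probability[OF lim])
    show "?J j \<in> borel_measurable M" by (rule simple_integral_measurable[OF S t(1)])
    show "\<forall>\<^sub>F l in sequentially. (\<integral>\<^sup>+\<omega>. ennreal (1 * (?J l \<omega> - ?J j \<omega>)\<^sup>2) \<partial>M) \<le> C * (2 * a l + 2 * a j)"
      using cauchy by simp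
    show "(\<lambda>l. C * (2 * a l + 2 * a j)) \<longlonglongrightarrow> C * (2 * 0 + 2 * a j)"
      by (intro ennreal_tendsto_cmult[OF C] tendsto_add ennreal_tendsto_cmult a tendsto_const) simp
  qed simp
  have "(\<lambda>j. C * (2 * a j)) \<longlonglongrightarrow> C * (2 * 0)"
    by (intro ennreal_tendsto_cmult[OF C] ennreal_tendsto_cmult a) simp
  then have up: "(\<lambda>j. C * (2 * 0 + 2 * a j)) \<longlonglongrightarrow> 0" by simp
  show ?thesis
  proof (rule ennreal_squeeze_0[OF _ up])
    show "(\<integral>\<^sup>+\<omega>. ennreal ((?J j \<omega> - I \<omega>)\<^sup>2) \<partial>M) \<le> C * (2 * 0 + 2 * a j)" for j
      using main[of j] by (simp only: power2_commute[of "?J j _"] mult_1)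
  qed
qed

end

section \<open>Square-integrable integrands\<close>

definition square_integrable :: "'a measure \<Rightarrow> ('a \<Rightarrow> real) \<Rightarrow> bool" where
  "square_integrable M f \<longleftrightarrow> f \<in> borel_measurable M \<and> integrable M (\<lambda>x. (f x)\<^sup>2)"

lemma square_integrable_iff_nn:
  "square_integrable M f \<longleftrightarrow> f \<in> borel_measurable M \<and> (\<integral>\<^sup>+x. ennreal ((f x)\<^sup>2) \<partial>M) < \<infinity>"
  unfolding square_integrable_def integrable_iff_bounded by auto

lemma square_integrableD:
  assumes "square_integrable M f"
  shows "f \<in> borel_measurable M" "integrable M (\<lambda>x. (f x)\<^sup>2)"
  using assms by (auto simp: square_integrable_def)

lemma square_integrable_mult:
  assumes "square_integrable M f" "square_integrable M g"
  shows "integrable M (\<lambda>x. f x * g x)"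
proof (rule Bochner_Integration.integrable_bound)
  note [measurable] = square_integrableD(1)[OF assms(1)] square_integrableD(1)[OF assms(2)]
  show "integrable M (\<lambda>x. (f x)\<^sup>2 + (g x)\<^sup>2)"
    using assms by (simp add: square_integrable_def)
  show "(\<lambda>x. f x * g x) \<in> borel_measurable M" by measurable
  have "\<bar>a * b\<bar> \<le> a\<^sup>2 + b\<^sup>2" for a b :: real
  proof -
    have "2 * (\<bar>a\<bar> * \<bar>b\<bar>) \<le> a\<^sup>2 + b\<^sup>2"
      using sum_squares_bound[of "\<bar>a\<bar>" "\<bar>b\<bar>"] by simp
    moreover have "0 \<le> \<bar>a\<bar> * \<bar>b\<bar>" by simp
    ultimately show ?thesis unfolding abs_mult by linarith
  qed
  then show "AE x in M. norm (f x * g x) \<le> norm ((f x)\<^sup>2 + (g x)\<^sup>2)"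
    by (intro AE_I2) (auto intro: order_trans[OF _ abs_ge_self])
qed

lemma square_integrable_add:
  assumes "square_integrable M f" "square_integrable M g"
  shows "square_integrable M (\<lambda>x. f x + g x)"
  using assms square_integrable_mult[OF assms]
  by (auto simp: square_integrable_def power2_sum mult.assoc)

lemma square_integrable_cmult:
  assumes "square_integrable M f"
  shows "square_integrable M (\<lambda>x. c * f x)"
  using assms by (auto simp: square_integrable_def power_mult_distrib)

lemma square_integrable_diff:
  assumes "square_integrable M f" "square_integrable M g"
  shows "square_integrable M (\<lambda>x. f x - g x)"
  using square_integrable_add[OF assms(1) square_integrable_cmult[OF assms(2), of "-1"]] by simp

lemma square_integrable_zero: "square_integrable M (\<lambda>x. 0)"
  by (simp add: square_integrable_def)

lemma square_integrable_sum:
  assumes "\<And>i. i \<in> I \<Longrightarrow> square_integrable M (f i)"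
  shows "square_integrable M (\<lambda>x. \<Sum>i\<in>I. f i x)"
  using assms
  by (induction I rule: infinite_finite_induct) (auto simp: square_integrable_zero intro: square_integrable_add)

lemma (in finite_measure) square_integrable_const: "square_integrable M (\<lambda>x. c)"
  by (simp add: square_integrable_def)

lemma (in finite_measure) square_integrable_imp_integrable:
  "square_integrable M f \<Longrightarrow> integrable M f"
  using square_integrable_mult[OF _ square_integrable_const, of f 1] by simp

text \<open>Reduced to the inequality for nonnegative integrals, applied to absolute values.\<close>

lemma square_integrable_Cauchy_Schwarz:
  assumes f: "square_integrable M f" and g: "square_integrable M g"
  shows "\<bar>\<integral>x. f x * g x \<partial>M\<bar> \<le> sqrt (\<integral>x. (f x)\<^sup>2 \<partial>M) * sqrt (\<integral>x. (g x)\<^sup>2 \<partial>M)"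
proof -
  note [measurable] = square_integrableD(1)[OF f] square_integrableD(1)[OF g]
  note int = square_integrable_mult[OF f g]
  define c where "c = (\<integral>x. \<bar>f x * g x\<bar> \<partial>M)"
  have c: "0 \<le> c" unfolding c_def by (rule Bochner_Integration.integral_nonneg) simp
  have sq: "ennreal \<bar>a\<bar> ^ 2 = ennreal (a\<^sup>2)" for a :: real
    by (simp add: power2_eq_square ennreal_mult'[symmetric] abs_mult[symmetric])
  have "(\<integral>\<^sup>+x. ennreal \<bar>f x\<bar> * ennreal \<bar>g x\<bar> \<partial>M) = ennreal c"
    unfolding c_def using integrable_abs[OF int]
    by (subst nn_integral_eq_integral[symmetric]) (auto simp: ennreal_mult'[symmetric] abs_mult)
  then have "(ennreal c)\<^sup>2 \<le> (\<integral>\<^sup>+x. ennreal \<bar>f x\<bar> ^ 2 \<partial>M) * (\<integral>\<^sup>+x. ennreal \<bar>g x\<bar> ^ 2 \<partial>M)"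
    using Cauchy_Schwarz_nn_integral[of "\<lambda>x. ennreal \<bar>f x\<bar>" M "\<lambda>x. ennreal \<bar>g x\<bar>"] by simp
  also have "\<dots> = ennreal ((\<integral>x. (f x)\<^sup>2 \<partial>M) * (\<integral>x. (g x)\<^sup>2 \<partial>M))"
    unfolding sq using f g by (subst (1 2) nn_integral_eq_integral) (auto simp: square_integrable_def ennreal_mult)
  finally have "c\<^sup>2 \<le> (\<integral>x. (f x)\<^sup>2 \<partial>M) * (\<integral>x. (g x)\<^sup>2 \<partial>M)"
    using c by (simp add: ennreal_power ennreal_le_iff)
  then have "c \<le> sqrt ((\<integral>x. (f x)\<^sup>2 \<partial>M) * (\<integral>x. (g x)\<^sup>2 \<partial>M))"
    by (rule real_le_rsqrt)
  moreover have "\<bar>\<integral>x. f x * g x \<partial>M\<bar> \<le> c" unfolding c_def by (rule integral_abs_bound)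
  ultimately show ?thesis by (simp add: real_sqrt_mult)
qed

section \<open>Mean-square limits of real functions\<close>

definition L2_limit :: "'a measure \<Rightarrow> (nat \<Rightarrow> 'a \<Rightarrow> real) \<Rightarrow> ('a \<Rightarrow> real) \<Rightarrow> bool" where
  "L2_limit M f f' \<longleftrightarrow> (\<forall>j. square_integrable M (f j)) \<and> square_integrable M f' \<and>
     (\<lambda>j. \<integral>x. (f j x - f' x)\<^sup>2 \<partial>M) \<longlonglongrightarrow> 0"

lemma L2_limitI:
  assumes f: "\<And>j. square_integrable M (f j)" and [measurable]: "f' \<in> borel_measurable M"
    and lim: "(\<lambda>j. \<integral>\<^sup>+x. ennreal ((f j x - f' x)\<^sup>2) \<partial>M) \<longlonglongrightarrow> 0"
  shows "L2_limit M f f'"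
proof -
  note [measurable] = square_integrableD(1)[OF f]
  have "eventually (\<lambda>j. (\<integral>\<^sup>+x. ennreal ((f j x - f' x)\<^sup>2) \<partial>M) < 1) sequentially"
    using order_tendstoD(2)[OF lim] by simp
  then obtain j where "(\<integral>\<^sup>+x. ennreal ((f j x - f' x)\<^sup>2) \<partial>M) < 1"
    by (auto simp: eventually_sequentially)
  then have "square_integrable M (\<lambda>x. f j x - f' x)"
    unfolding square_integrable_iff_nn by (auto intro: less_trans)
  \<comment> \<open>A single difference with finite second moment already makes the limit square
    integrable, as \<open>f' = f j - (f j - f')\<close>.\<close>
  from square_integrable_diff[OF f[of j] this] have f': "square_integrable M f'" by simp
  have "(\<integral>\<^sup>+x. ennreal ((f j x - f' x)\<^sup>2) \<partial>M) = ennreal (\<integral>x. (f j x - f' x)\<^sup>2 \<partial>M)" for j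
    using square_integrable_diff[OF f f', of j] by (intro nn_integral_eq_integral) (auto simp: square_integrable_def)
  then have "(\<lambda>j. \<integral>x. (f j x - f' x)\<^sup>2 \<partial>M) \<longlonglongrightarrow> 0"
    using lim by (simp add: ennreal_tendsto_0_iff)
  with f f' show ?thesis by (simp add: L2_limit_def)
qed

lemma L2_limit_const: "square_integrable M f \<Longrightarrow> L2_limit M (\<lambda>j. f) f"
  by (simp add: L2_limit_def)

lemma L2_limit_mult:
  assumes f: "L2_limit M f f'" and g: "L2_limit M g g'"
  shows "(\<lambda>j. \<integral>x. f j x * g j x \<partial>M) \<longlonglongrightarrow> (\<integral>x. f' x * g' x \<partial>M)"
proof -
  have fj: "square_integrable M (f j)" and f': "square_integrable M f'" for j
    using f by (auto simp: L2_limit_def)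
  have gj: "square_integrable M (g j)" and g': "square_integrable M g'" for j
    using g by (auto simp: L2_limit_def)
  define a where "a j = sqrt (\<integral>x. (f j x - f' x)\<^sup>2 \<partial>M)" for j
  define b where "b j = sqrt (\<integral>x. (g j x - g' x)\<^sup>2 \<partial>M)" for j
  define u where "u = sqrt (\<integral>x. (f' x)\<^sup>2 \<partial>M)"
  define v where "v = sqrt (\<integral>x. (g' x)\<^sup>2 \<partial>M)"
  have lim: "a \<longlonglongrightarrow> 0" "b \<longlonglongrightarrow> 0"
    using f g tendsto_real_sqrt[of _ 0 sequentially] by (auto simp: L2_limit_def a_def[abs_def] b_def[abs_def])
  have df: "square_integrable M (\<lambda>x. f j x - f' x)" and dg: "square_integrable M (\<lambda>x. g j x - g' x)" for j
    by (intro square_integrable_diff fj f' gj g')+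
  have bound: "norm ((\<integral>x. f j x * g j x \<partial>M) - (\<integral>x. f' x * g' x \<partial>M)) \<le> a j * b j + u * b j + a j * v" for j
  proof -
    \<comment> \<open>Expansion around \<open>f'\<close> and \<open>g'\<close>: every term but the
      last contains a difference that tends to zero in mean square.\<close>
    have "(\<integral>x. f j x * g j x \<partial>M) = (\<integral>x. ((f j x - f' x) * (g j x - g' x) + f' x * (g j x - g' x) + (f j x - f' x) * g' x) + f' x * g' x \<partial>M)"
      by (intro Bochner_Integration.integral_cong) (auto simp: algebra_simps)
    also have "\<dots> = (\<integral>x. (f j x - f' x) * (g j x - g' x) \<partial>M) + (\<integral>x. f' x * (g j x - g' x) \<partial>M)
        + (\<integral>x. (f j x - f' x) * g' x \<partial>M) + (\<integral>x. f' x * g' x \<partial>M)"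
      using square_integrable_mult[OF df[of j] dg[of j]] square_integrable_mult[OF f' dg[of j]]
        square_integrable_mult[OF df[of j] g'] square_integrable_mult[OF f' g'] by simp
    finally have "(\<integral>x. f j x * g j x \<partial>M) - (\<integral>x. f' x * g' x \<partial>M) = (\<integral>x. (f j x - f' x) * (g j x - g' x) \<partial>M)
        + (\<integral>x. f' x * (g j x - g' x) \<partial>M) + (\<integral>x. (f j x - f' x) * g' x \<partial>M)" by simp
    then show ?thesis
      using square_integrable_Cauchy_Schwarz[OF df[of j] dg[of j]] square_integrable_Cauchy_Schwarz[OF f' dg[of j]]
        square_integrable_Cauchy_Schwarz[OF df[of j] g']
      unfolding a_def b_def u_def v_def real_norm_def by linarith
  qed
  have "(\<lambda>j. a j * b j + u * b j + a j * v) \<longlonglongrightarrow> 0 * 0 + u * 0 + 0 * v"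
    by (intro tendsto_intros lim)
  then have "(\<lambda>j. a j * b j + u * b j + a j * v) \<longlonglongrightarrow> 0" by simp
  from Lim_null_comparison[OF always_eventually[OF allI[OF bound]] this]
  show ?thesis by (rule LIM_zero_cancel)
qed

context brownian_motion
begin

lemma simple_integral_square_integrable:
  "simple_process Fb n \<tau> \<xi> \<Longrightarrow> 0 \<le> t \<Longrightarrow> square_integrable M (wiener_integral k n \<tau> \<xi> t)"
  using ex_steps[of n \<tau> \<xi> t k] step_sum_measurable step_sum_isometry(1) by (auto simp: square_integrable_def)

end

text \<open>Finite mean energy is not part of being a solution. Making it an assumption here keeps
  the mean-square theory apart from the Gronwall argument that supplies it.\<close>

locale square_integrable_process = continuous_adapted_process M F W X
  for M :: "'a measure" and F and W :: "real \<Rightarrow> 'a \<Rightarrow> real^'m" and X :: "real \<Rightarrow> 'a \<Rightarrow> real^'d" +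
  assumes energy_finite: "0 \<le> T \<Longrightarrow> mean_energy T X < \<infinity>"
begin

abbreviation ito :: "'m \<Rightarrow> real^'d \<Rightarrow> real \<Rightarrow> ('a \<Rightarrow> real) \<Rightarrow> bool" where
  "ito k c t I \<equiv> has_ito_integral M Fb (\<lambda>s \<omega>. W s \<omega> $ k) (\<lambda>s \<omega>. c \<bullet> X s \<omega>) t I"

text \<open>The same indices work for all components, functionals and times up to \<open>T\<close>,
  so products of integrals, or integrals at two times, can be approximated simultaneously.\<close>

lemma ex_ito_L2_approximation:
  assumes T: "0 \<le> T"
  obtains \<nu> \<mu> where "\<And>k c t I. 0 \<le> t \<Longrightarrow> t \<le> T \<Longrightarrow> ito k c t I \<Longrightarrow> L2_limit M (\<lambda>j. riemann_integral k c (\<nu> j) T (\<mu> j) t) I"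
    and "(\<lambda>j. mean_energy T (\<lambda>s \<omega>. riemann (\<nu> j) T (\<mu> j) s \<omega> - X s \<omega>)) \<longlonglongrightarrow> 0"
proof -
  obtain \<nu> \<mu> where approx: "(\<lambda>j. mean_energy T (\<lambda>s \<omega>. riemann (\<nu> j) T (\<mu> j) s \<omega> - X s \<omega>)) \<longlonglongrightarrow> 0"
    using ex_riemann_approximation[OF T energy_finite[OF T]] by blast
  have "L2_limit M (\<lambda>j. riemann_integral k c (\<nu> j) T (\<mu> j) t) I"
    if t: "0 \<le> t" "t \<le> T" and I: "ito k c t I" for k c t I
  proof (rule L2_limitI[OF _ _ ito_L2_limit[OF T approx t I]])
    show "I \<in> borel_measurable M" using I by (auto simp: has_ito_integral_def tendsto_in_probability_def)
    show "square_integrable M (riemann_integral k c (\<nu> j) T (\<mu> j) t)" for j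
      by (rule simple_integral_square_integrable[OF inner_riemann_simple_process[OF T] t(1)])
  qed
  then show ?thesis using approx by (rule that)
qed

lemma ito_square_integrable:
  assumes t: "0 \<le> t" and I: "ito k c t I"
  shows "square_integrable M I"
proof (rule ex_ito_L2_approximation[OF t])
  fix \<nu> \<mu>
  assume "\<And>k c r I. 0 \<le> r \<Longrightarrow> r \<le> t \<Longrightarrow> ito k c r I \<Longrightarrow> L2_limit M (\<lambda>j. riemann_integral k c (\<nu> j) t (\<mu> j) r) I"
  from this[OF t order_refl I] show ?thesis by (simp add: L2_limit_def)
qed

text \<open>Conditioning is expressed by testing against a \<open>Z\<close> known at time
  \<open>s\<close>; the discrete identity survives the mean-square limit.\<close>

lemma ito_martingale:
  assumes st: "0 \<le> s" "s \<le> t" and Is: "ito k c s Is" and It: "ito k c t It"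
    and Z: "Z \<in> borel_measurable (Fb s)" "square_integrable M Z"
  shows "expectation (\<lambda>\<omega>. Z \<omega> * It \<omega>) = expectation (\<lambda>\<omega>. Z \<omega> * Is \<omega>)"
proof -
  have t: "0 \<le> t" using st by simp
  obtain \<nu> \<mu> where L: "\<And>k c r I. 0 \<le> r \<Longrightarrow> r \<le> t \<Longrightarrow> ito k c r I \<Longrightarrow> L2_limit M (\<lambda>j. riemann_integral k c (\<nu> j) t (\<mu> j) r) I"
    by (rule ex_ito_L2_approximation[OF t]) blast
  note Ls = L2_limit_mult[OF L2_limit_const[OF Z(2)] L[OF st Is]]
    and Lt = L2_limit_mult[OF L2_limit_const[OF Z(2)] L[OF t order_refl It]]
  have "expectation (\<lambda>\<omega>. Z \<omega> * riemann_integral k c (\<nu> j) t (\<mu> j) t \<omega>)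
      = expectation (\<lambda>\<omega>. Z \<omega> * riemann_integral k c (\<nu> j) t (\<mu> j) s \<omega>)" for j
  proof -
    note S = inner_riemann_simple_process[OF t]
    have "expectation (\<lambda>\<omega>. Z \<omega> * (riemann_integral k c (\<nu> j) t (\<mu> j) t \<omega> - riemann_integral k c (\<nu> j) t (\<mu> j) s \<omega>)) = 0"
      by (rule simple_integral_martingale(2)[OF S st Z(1) square_integrable_imp_integrable[OF Z(2)]])
    moreover have "integrable M (\<lambda>\<omega>. Z \<omega> * riemann_integral k c (\<nu> j) t (\<mu> j) t \<omega>)"
      "integrable M (\<lambda>\<omega>. Z \<omega> * riemann_integral k c (\<nu> j) t (\<mu> j) s \<omega>)"
      using t st by (intro square_integrable_mult Z simple_integral_square_integrable S; simp)+
    ultimately show ?thesis by (simp add: right_diff_distrib)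
  qed
  then show ?thesis using LIMSEQ_unique[OF Lt] Ls by simp
qed

lemma ito_mean_zero:
  assumes t: "0 \<le> t" and I: "ito k c t I"
  shows "expectation I = 0"
proof -
  obtain \<nu> \<mu> where L: "\<And>k c r I. 0 \<le> r \<Longrightarrow> r \<le> t \<Longrightarrow> ito k c r I \<Longrightarrow> L2_limit M (\<lambda>j. riemann_integral k c (\<nu> j) t (\<mu> j) r) I"
    by (rule ex_ito_L2_approximation[OF t]) blast
  \<comment> \<open>The martingale identity from time 0 with \<open>Z = 1\<close> yields mean zero
    because the integral up to time 0 vanishes.\<close>
  have S0: "riemann_integral k c n t m 0 \<omega> = 0" for n m \<omega>
    using grid_nonneg[OF t, of m] by (simp add: simple_integral_def min_absorb1 del: sum.lessThan_Suc)
  have "expectation (\<lambda>\<omega>. 1 * riemann_integral k c (\<nu> j) t (\<mu> j) t \<omega>) = 0" for j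
  proof -
    have "expectation (\<lambda>\<omega>. 1 * (riemann_integral k c (\<nu> j) t (\<mu> j) t \<omega> - riemann_integral k c (\<nu> j) t (\<mu> j) 0 \<omega>)) = 0"
      by (rule simple_integral_martingale(2)[OF inner_riemann_simple_process[OF t] order_refl t]) auto
    then show ?thesis by (simp only: S0 diff_0_right)
  qed
  with L2_limit_mult[OF L2_limit_const[OF square_integrable_const[of 1]] L[OF t order_refl I]]
  have "(\<lambda>j. 0) \<longlonglongrightarrow> expectation (\<lambda>\<omega>. 1 * I \<omega>)" by simp
  from LIMSEQ_unique[OF this tendsto_const] show ?thesis by simp
qed

lemma ito_orthogonal:
  assumes t: "0 \<le> t" and I: "ito k c t I" "ito l c' t I'" and "k \<noteq> l"
  shows "expectation (\<lambda>\<omega>. I \<omega> * I' \<omega>) = 0"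
proof -
  obtain \<nu> \<mu> where L: "\<And>k c r I. 0 \<le> r \<Longrightarrow> r \<le> t \<Longrightarrow> ito k c r I \<Longrightarrow> L2_limit M (\<lambda>j. riemann_integral k c (\<nu> j) t (\<mu> j) r) I"
    by (rule ex_ito_L2_approximation[OF t]) blast
  have "expectation (\<lambda>\<omega>. riemann_integral k c (\<nu> j) t (\<mu> j) t \<omega> * riemann_integral l c' (\<nu> j) t (\<mu> j) t \<omega>) = 0" for j
    by (rule simple_integral_orthogonal[OF inner_riemann_simple_process[OF t] inner_riemann_simple_process[OF t] t \<open>k \<noteq> l\<close>])
  with L2_limit_mult[OF L[OF t order_refl I(1)] L[OF t order_refl I(2)]]
  have "(\<lambda>j. 0) \<longlonglongrightarrow> expectation (\<lambda>\<omega>. I \<omega> * I' \<omega>)" by simp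
  from LIMSEQ_unique[OF this tendsto_const] show ?thesis .
qed

abbreviation time_space :: "real \<Rightarrow> ('a \<times> real) measure" where
  "time_space t \<equiv> M \<Otimes>\<^sub>M horizon t"

lemma nn_integral_time_space:
  assumes "jointly_measurable t (Y :: real \<Rightarrow> 'a \<Rightarrow> real)"
  shows "(\<integral>\<^sup>+z. ennreal ((case z of (\<omega>, s) \<Rightarrow> Y s \<omega>)\<^sup>2) \<partial>time_space t) = mean_energy t Y"
proof -
  interpret H: finite_measure "horizon t" by (rule finite_measure_horizon)
  have "(\<lambda>z. ennreal ((case z of (\<omega>, s) \<Rightarrow> Y s \<omega>)\<^sup>2)) \<in> borel_measurable (time_space t)"
    using assms by measurable
  from H.nn_integral_fst[OF this] show ?thesis by (simp add: nn_integral_horizon)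
qed

lemma inner_square_integrable:
  assumes "0 \<le> t"
  shows "square_integrable (time_space t) (\<lambda>(\<omega>, s). c \<bullet> X s \<omega>)"
  unfolding square_integrable_iff_nn nn_integral_time_space[OF inner_joint[OF X_joint[OF assms]]]
proof (intro conjI inner_joint X_joint assms)
  have "mean_energy t (\<lambda>s \<omega>. c \<bullet> X s \<omega>) \<le> (\<integral>\<^sup>+\<omega>. ennreal ((norm c)\<^sup>2) * energy t X \<omega> \<partial>M)"
    using inner_le_norm_bound[of c] by (intro nn_integral_mono energy_scaled X_joint assms) auto
  also have "\<dots> = ennreal ((norm c)\<^sup>2) * mean_energy t X"
    by (rule nn_integral_cmult[OF energy_measurable[OF X_joint[OF assms]]])
  also have "\<dots> < \<infinity>" using energy_finite[OF assms] by (simp add: ennreal_mult_less_top)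
  finally show "mean_energy t (\<lambda>s \<omega>. c \<bullet> X s \<omega>) < \<infinity>" .
qed

text \<open>The discrete isometry passes through two mean-square limits, one over the sample space
  and one over its product with time.\<close>

lemma ito_isometry:
  assumes t: "0 \<le> t" and I: "ito k c t I"
  shows "expectation (\<lambda>\<omega>. (I \<omega>)\<^sup>2) = (\<integral>z. (case z of (\<omega>, s) \<Rightarrow> c \<bullet> X s \<omega>)\<^sup>2 \<partial>time_space t)"
proof -
  obtain \<nu> \<mu> where L: "\<And>k c r I. 0 \<le> r \<Longrightarrow> r \<le> t \<Longrightarrow> ito k c r I \<Longrightarrow> L2_limit M (\<lambda>j. riemann_integral k c (\<nu> j) t (\<mu> j) r) I"
    and approx: "(\<lambda>j. mean_energy t (\<lambda>s \<omega>. riemann (\<nu> j) t (\<mu> j) s \<omega> - X s \<omega>)) \<longlonglongrightarrow> 0"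
    by (rule ex_ito_L2_approximation[OF t]) blast
  let ?J = "\<lambda>j. riemann_integral k c (\<nu> j) t (\<mu> j) t" and ?r = "\<lambda>j. riemann (\<nu> j) t (\<mu> j)"
  let ?R = "\<lambda>j (\<omega>, s). c \<bullet> ?r j s \<omega>"
  note P = inner_riemann_simple_process[OF t]
  have S: "square_integrable M (?J j)" for j
    by (rule simple_integral_square_integrable[OF P t])
  have iso: "(\<integral>\<^sup>+\<omega>. ennreal ((?J j \<omega>)\<^sup>2) \<partial>M) = (\<integral>\<^sup>+z. ennreal ((?R j z)\<^sup>2) \<partial>time_space t)" for j
    unfolding nn_integral_time_space[OF inner_joint[OF riemann_joint[OF t]]] simple_integral_isometry[OF P t] inner_riemann ..
  have R: "square_integrable (time_space t) (?R j)" for j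
    using S[of j] inner_joint[OF riemann_joint[OF t]] unfolding square_integrable_iff_nn iso by blast
  have "L2_limit (time_space t) ?R (\<lambda>(\<omega>, s). c \<bullet> X s \<omega>)"
  proof (rule L2_limitI[OF R])
    show "(\<lambda>(\<omega>, s). c \<bullet> X s \<omega>) \<in> borel_measurable (time_space t)" by (intro inner_joint X_joint t)
    have JD: "jointly_measurable t (\<lambda>s \<omega>. ?r j s \<omega> - X s \<omega>)" for j
      by (intro diff_joint riemann_joint X_joint t)
    have "(\<integral>\<^sup>+z. ennreal ((?R j z - (case z of (\<omega>, s) \<Rightarrow> c \<bullet> X s \<omega>))\<^sup>2) \<partial>time_space t)
      \<le> ennreal ((norm c)\<^sup>2) * mean_energy t (\<lambda>s \<omega>. ?r j s \<omega> - X s \<omega>)" for j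
    proof -
      have "(\<integral>\<^sup>+z. ennreal ((?R j z - (case z of (\<omega>, s) \<Rightarrow> c \<bullet> X s \<omega>))\<^sup>2) \<partial>time_space t)
         = (\<integral>\<^sup>+z. ennreal ((case z of (\<omega>, s) \<Rightarrow> c \<bullet> ?r j s \<omega> - c \<bullet> X s \<omega>)\<^sup>2) \<partial>time_space t)"
        by (simp add: split_beta')
      also have "\<dots> = mean_energy t (\<lambda>s \<omega>. c \<bullet> ?r j s \<omega> - c \<bullet> X s \<omega>)"
        by (intro nn_integral_time_space diff_joint inner_joint riemann_joint X_joint t)
      also have "\<dots> \<le> (\<integral>\<^sup>+\<omega>. ennreal ((norm c)\<^sup>2) * energy t (\<lambda>s \<omega>. ?r j s \<omega> - X s \<omega>) \<omega> \<partial>M)"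
        by (intro nn_integral_mono inner_diff_energy_le JD order_refl)
      also have "\<dots> = ennreal ((norm c)\<^sup>2) * mean_energy t (\<lambda>s \<omega>. ?r j s \<omega> - X s \<omega>)"
        by (rule nn_integral_cmult[OF energy_measurable[OF JD]])
      finally show ?thesis .
    qed
    moreover have "(\<lambda>j. ennreal ((norm c)\<^sup>2) * mean_energy t (\<lambda>s \<omega>. ?r j s \<omega> - X s \<omega>)) \<longlonglongrightarrow> 0"
      using ennreal_tendsto_cmult[OF _ approx, of "ennreal ((norm c)\<^sup>2)"] by simp
    ultimately show "(\<lambda>j. \<integral>\<^sup>+z. ennreal ((?R j z - (case z of (\<omega>, s) \<Rightarrow> c \<bullet> X s \<omega>))\<^sup>2) \<partial>time_space t) \<longlonglongrightarrow> 0"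
      by (rule ennreal_squeeze_0)
  qed
  note LX = L2_limit_mult[OF this this]
  have "expectation (\<lambda>\<omega>. (?J j \<omega>)\<^sup>2) = (\<integral>z. (?R j z)\<^sup>2 \<partial>time_space t)" for j
    using iso[of j] square_integrableD(2)[OF S[of j]] square_integrableD(2)[OF R[of j]]
    by (subst (asm) (1 2) nn_integral_eq_integral) (auto simp: Bochner_Integration.integral_nonneg)
  then have "(\<lambda>j. \<integral>z. ?R j z * ?R j z \<partial>time_space t) \<longlonglongrightarrow> expectation (\<lambda>\<omega>. I \<omega> * I \<omega>)"
    using L2_limit_mult[OF L[OF t order_refl I] L[OF t order_refl I]] by (simp add: power2_eq_square)
  from LIMSEQ_unique[OF this LX] show ?thesis by (simp add: power2_eq_square)
qed

end

section \<open>Second moment bound\<close>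

text \<open>Replacing the bound \<open>b / 2 ^ j\<close> by half of it in each application of the integral inequality
  avoids any regularity of \<open>u\<close>.\<close>

lemma gronwall_nn:
  fixes u :: "real \<Rightarrow> ennreal"
  assumes bound: "\<And>t. t \<in> {0..T} \<Longrightarrow> u t \<le> ennreal b" and K: "0 \<le> K0" "0 < K1" "0 \<le> b"
    and ineq: "\<And>t. t \<in> {0..T} \<Longrightarrow> u t \<le> ennreal K0 + ennreal K1 * (\<integral>\<^sup>+s\<in>{0..t}. u s \<partial>lborel)"
    and t: "t \<in> {0..T}"
  shows "u t \<le> ennreal (2 * K0 * exp (2 * K1 * t))"
proof -
  \<comment> \<open>With the doubled rate \<open>2 * K1\<close> in the exponent, integration leaves
    at most half of \<open>D = 2 * K0 + b / 2 ^ j\<close>; adding \<open>K0\<close> restores the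
    part \<open>2 * K0\<close>.\<close>
  have "\<forall>t\<in>{0..T}. u t \<le> ennreal ((2 * K0 + b / 2 ^ j) * exp (2 * K1 * t))" for j :: nat
  proof (induction j)
    case 0
    show ?case
    proof
      fix t assume t: "t \<in> {0..T}"
      have "b \<le> b * exp (2 * K1 * t)" using K t by (simp add: mult_le_cancel_left1)
      also have "\<dots> \<le> (2 * K0 + b / 2 ^ 0) * exp (2 * K1 * t)" using K by (simp add: mult_right_mono)
      finally show "u t \<le> ennreal ((2 * K0 + b / 2 ^ 0) * exp (2 * K1 * t))"
        using bound[OF t] by (meson ennreal_leI order_trans)
    qed
  next
    case (Suc j)
    define D where "D = 2 * K0 + b / 2 ^ j"
    have D: "0 \<le> D" using K by (simp add: D_def)
    show ?case
    proof
      fix t assume t: "t \<in> {0..T}"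
      have "(\<integral>\<^sup>+s\<in>{0..t}. u s \<partial>lborel) \<le> (\<integral>\<^sup>+s. ennreal (D * exp (2 * K1 * s)) * indicator {0..t} s \<partial>lborel)"
        using Suc t by (intro nn_integral_mono) (auto simp: indicator_def D_def)
      also have "\<dots> = ennreal (D / (2 * K1) * exp (2 * K1 * t) - D / (2 * K1) * exp (2 * K1 * 0))"
        using K D t by (intro nn_integral_FTC_Icc) (auto intro!: derivative_eq_intros)
      also have "\<dots> \<le> ennreal (D / (2 * K1) * exp (2 * K1 * t))"
        using K D by (intro ennreal_leI) simp
      finally have "u t \<le> ennreal K0 + ennreal K1 * ennreal (D / (2 * K1) * exp (2 * K1 * t))"
        using ineq[OF t] by (meson add_left_mono mult_left_mono order_trans zero_le)
      also have "\<dots> = ennreal (K0 + K1 * (D / (2 * K1) * exp (2 * K1 * t)))"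
        using K D by (simp add: ennreal_mult'[symmetric])
      also have "\<dots> \<le> ennreal ((2 * K0 + b / 2 ^ Suc j) * exp (2 * K1 * t))"
      proof (rule ennreal_leI)
        have "K0 \<le> K0 * exp (2 * K1 * t)" using K t by (simp add: mult_le_cancel_left1)
        then show "K0 + K1 * (D / (2 * K1) * exp (2 * K1 * t)) \<le> (2 * K0 + b / 2 ^ Suc j) * exp (2 * K1 * t)"
          using K by (simp add: D_def algebra_simps add_divide_distrib)
      qed
      finally show "u t \<le> ennreal ((2 * K0 + b / 2 ^ Suc j) * exp (2 * K1 * t))" .
    qed
  qed
  moreover have "(\<lambda>j. ennreal ((2 * K0 + b / 2 ^ j) * exp (2 * K1 * t))) \<longlonglongrightarrow> ennreal ((2 * K0 + 0) * exp (2 * K1 * t))"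
  proof (intro tendsto_ennrealI tendsto_intros)
    have "(\<lambda>j. b * inverse (2 ^ j)) \<longlonglongrightarrow> b * 0" by (intro tendsto_intros LIMSEQ_inverse_realpow_zero) simp
    then show "(\<lambda>j. b / 2 ^ j) \<longlonglongrightarrow> 0" by (simp add: divide_inverse)
  qed
  ultimately show ?thesis using t by (intro LIMSEQ_le_const) auto
qed

lemma ennreal_affine:
  assumes "0 \<le> x" "0 \<le> y" "0 \<le> c" "\<And>k. 0 \<le> z k"
  shows "ennreal (x + 4 * y + c * (\<Sum>k\<in>K. z k)) = ennreal x + 4 * ennreal y + ennreal c * (\<Sum>k\<in>K. ennreal (z k))"
proof -
  have "ennreal (x + 4 * y + c * (\<Sum>k\<in>K. z k)) = ennreal x + ennreal (4 * y) + ennreal (c * (\<Sum>k\<in>K. z k))"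
    using assms by (simp add: ennreal_plus sum_nonneg)
  also have "ennreal (c * (\<Sum>k\<in>K. z k)) = ennreal c * (\<Sum>k\<in>K. ennreal (z k))"
    using assms by (subst sum_ennreal) (auto intro: ennreal_mult sum_nonneg)
  finally show ?thesis using assms by (simp add: ennreal_mult)
qed

text \<open>Cauchy-Schwarz against the constant 1, whose square integrates to
  \<open>t\<close>.\<close>

lemma integral_square_le_energy:
  fixes f :: "real \<Rightarrow> real"
  assumes t: "0 \<le> t" and f: "square_integrable (horizon t) f"
  shows "ennreal ((\<integral>s. f s \<partial>horizon t)\<^sup>2) \<le> ennreal t * (\<integral>\<^sup>+s. ennreal ((f s)\<^sup>2) \<partial>horizon t)"
proof -
  interpret H: finite_measure "horizon t" by (rule finite_measure_horizon)
  have m: "measure (horizon t) (space (horizon t)) = t"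
    using emeasure_horizon[of t] t by (simp add: measure_def)
  have "\<bar>\<integral>s. f s * 1 \<partial>horizon t\<bar> \<le> sqrt (\<integral>s. (f s)\<^sup>2 \<partial>horizon t) * sqrt (\<integral>s. 1\<^sup>2 \<partial>horizon t)"
    by (rule square_integrable_Cauchy_Schwarz[OF f H.square_integrable_const])
  then have "\<bar>\<integral>s. f s \<partial>horizon t\<bar>\<^sup>2 \<le> (sqrt (\<integral>s. (f s)\<^sup>2 \<partial>horizon t) * sqrt t)\<^sup>2"
    by (intro power_mono) (simp_all only: mult_1_right power_one lebesgue_integral_const m real_scaleR_def abs_ge_zero)
  also have "\<dots> = t * (\<integral>s. (f s)\<^sup>2 \<partial>horizon t)"
    using t by (simp add: power_mult_distrib Bochner_Integration.integral_nonneg)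
  finally have "ennreal ((\<integral>s. f s \<partial>horizon t)\<^sup>2) \<le> ennreal (t * (\<integral>s. (f s)\<^sup>2 \<partial>horizon t))"
    by (intro ennreal_leI) simp
  also have "\<dots> = ennreal t * (\<integral>\<^sup>+s. ennreal ((f s)\<^sup>2) \<partial>horizon t)"
    using f t by (subst nn_integral_eq_integral) (auto simp: square_integrable_def ennreal_mult)
  finally show ?thesis .
qed

lemma set_integral_horizon:
  fixes f :: "real \<Rightarrow> 'b::{banach, second_countable_topology}"
  shows "(LINT s:{0..t}|lborel. f s) = (\<integral>s. f s \<partial>horizon t)"
  by (simp add: set_lebesgue_integral_def integral_restrict_space)

lemma continuous_square_integrable_horizon:
  assumes "continuous_on {0..t} (f :: real \<Rightarrow> real)"
  shows "square_integrable (horizon t) f"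
proof -
  interpret H: finite_measure "horizon t" by (rule finite_measure_horizon)
  have [measurable]: "f \<in> borel_measurable (horizon t)"
    using borel_measurable_continuous_on_restrict[OF assms]
    by (simp add: measurable_def space_restrict_space sets_restrict_space)
  have "compact (f ` {0..t})" using assms by (intro compact_continuous_image) auto
  then have "bounded (f ` {0..t})" by (rule compact_imp_bounded)
  then obtain b where b: "\<forall>s\<in>{0..t}. norm (f s) \<le> b" by (auto simp: bounded_iff)
  have "integrable (horizon t) (\<lambda>s. (f s)\<^sup>2)"
  proof (rule H.integrable_const_bound[where B = "b\<^sup>2"])
    show "AE s in horizon t. norm ((f s)\<^sup>2) \<le> b\<^sup>2"
      using b by (intro AE_I2) (auto simp: space_restrict_space abs_le_square_iff[symmetric] intro: order_trans[OF _ abs_ge_self])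
  qed measurable
  then show ?thesis by (simp add: square_integrable_def)
qed

section \<open>The drift as a pathwise integral\<close>

context continuous_adapted_process
begin

text \<open>With \<open>c = e v* A\<close> this is the drift part of the solution, seen through the
  functional \<open>e\<close>.\<close>

definition drift :: "real^'d \<Rightarrow> real \<Rightarrow> 'a \<Rightarrow> real" where
  "drift c t \<omega> = (\<integral>s. c \<bullet> X s \<omega> \<partial>horizon t)"

lemma inner_X_square_integrable: "\<omega> \<in> space M \<Longrightarrow> square_integrable (horizon t) (\<lambda>s. c \<bullet> X s \<omega>)"
  by (intro continuous_square_integrable_horizon continuous_intros continuous_on_subset[OF X_continuous]) auto

lemma drift_square_le:
  assumes "\<omega> \<in> space M" "0 \<le> t"
  shows "ennreal ((drift c t \<omega>)\<^sup>2) \<le> ennreal t * energy t (\<lambda>s \<omega>. c \<bullet> X s \<omega>) \<omega>"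
  using integral_square_le_energy[OF assms(2) inner_X_square_integrable[OF assms(1)], of c]
  by (simp add: drift_def nn_integral_horizon)

lemma drift_measurable: "0 \<le> t \<Longrightarrow> drift c t \<in> borel_measurable M"
proof -
  assume t: "0 \<le> t"
  interpret H: finite_measure "horizon t" by (rule finite_measure_horizon)
  show ?thesis
    unfolding drift_def[abs_def] by (rule H.borel_measurable_lebesgue_integral[OF inner_joint[OF X_joint[OF t]]])
qed

end

section \<open>The linear equation and the bound on its second moments\<close>

locale linear_sde = brownian_motion M F W
  for M :: "'a measure" and F and W :: "real \<Rightarrow> 'a \<Rightarrow> real^'m" +
  fixes x0 :: "real^'d" and A :: "real^'d^'d" and G :: "'m \<Rightarrow> real^'d^'d" and X :: "real \<Rightarrow> 'a \<Rightarrow> real^'d"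
  assumes solution: "linear_sde_solution M F W x0 A G X"

sublocale linear_sde \<subseteq> continuous_adapted_process M F W X
  using solution by unfold_locales (auto simp: linear_sde_solution_def)

context linear_sde
begin

text \<open>The notion of solution provides the integrals for each \<open>t\<close> separately; this
  fixes one version per time, with no regularity in \<open>t\<close>.\<close>

definition noise :: "real \<Rightarrow> 'm \<Rightarrow> 'a \<Rightarrow> real^'d" where
  "noise t = (SOME I. (\<forall>k. has_ito_integral M Fb (\<lambda>s \<omega>. W s \<omega> $ k) (\<lambda>s \<omega>. G k *v X s \<omega>) t (I k)) \<and>
     (AE \<omega> in M. X t \<omega> = x0 + (LINT s:{0..t}|lborel. A *v X s \<omega>) + (\<Sum>k\<in>UNIV. I k \<omega>)))"

lemma noise:
  assumes "0 \<le> t"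
  shows "has_ito_integral M Fb (\<lambda>s \<omega>. W s \<omega> $ k) (\<lambda>s \<omega>. G k *v X s \<omega>) t (noise t k)"
    and "AE \<omega> in M. X t \<omega> = x0 + (LINT s:{0..t}|lborel. A *v X s \<omega>) + (\<Sum>k\<in>UNIV. noise t k \<omega>)"
proof -
  have "\<exists>I. (\<forall>k. has_ito_integral M Fb (\<lambda>s \<omega>. W s \<omega> $ k) (\<lambda>s \<omega>. G k *v X s \<omega>) t (I k)) \<and>
     (AE \<omega> in M. X t \<omega> = x0 + (LINT s:{0..t}|lborel. A *v X s \<omega>) + (\<Sum>k\<in>UNIV. I k \<omega>))"
    using solution assms unfolding linear_sde_solution_def by blast
  from someI_ex[OF this]
  show "has_ito_integral M Fb (\<lambda>s \<omega>. W s \<omega> $ k) (\<lambda>s \<omega>. G k *v X s \<omega>) t (noise t k)"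
    and "AE \<omega> in M. X t \<omega> = x0 + (LINT s:{0..t}|lborel. A *v X s \<omega>) + (\<Sum>k\<in>UNIV. noise t k \<omega>)"
    unfolding noise_def[symmetric] by blast+
qed

lemma noise_inner:
  assumes "0 \<le> t"
  shows "has_ito_integral M Fb (\<lambda>s \<omega>. W s \<omega> $ k) (\<lambda>s \<omega>. (e v* G k) \<bullet> X s \<omega>) t (\<lambda>\<omega>. e \<bullet> noise t k \<omega>)"
  using has_ito_integral_inner[OF noise(1)[OF assms, of k] assms, where e = e] by (simp add: dot_lmul_matrix)

lemma solution_inner:
  assumes t: "0 \<le> t"
  shows "AE \<omega> in M. e \<bullet> X t \<omega> = e \<bullet> x0 + drift (e v* A) t \<omega> + (\<Sum>k\<in>UNIV. e \<bullet> noise t k \<omega>)"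
  using noise(2)[OF t] AE_space
proof eventually_elim
  case (elim \<omega>)
  \<comment> \<open>Continuity of the path makes the drift integrable, which is what moving
    \<open>e\<close> under the integral requires.\<close>
  have "set_integrable lborel {0..t} (\<lambda>s. A *v X s \<omega>)"
    by (intro borel_integrable_atLeastAtMost' continuous_on_subset[OF X_continuous[OF elim(2)]]
        continuous_on_compose2[OF linear_continuous_on[OF matrix_vector_mul_bounded_linear, of UNIV]]) auto
  then have "integrable (horizon t) (\<lambda>s. A *v X s \<omega>)"
    by (simp add: set_integrable_def integrable_restrict_space)
  then have "e \<bullet> (LINT s:{0..t}|lborel. A *v X s \<omega>) = drift (e v* A) t \<omega>"
    unfolding set_integral_horizon drift_def dot_lmul_matrix by (subst integral_inner_right) auto
  then show ?case using elim(1) by (simp add: inner_add_right inner_sum_right)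
qed

text \<open>Exchanging the integrals produces the time integral of second moments on which Gronwall
  operates.\<close>

lemma truncated_energy:
  assumes t: "0 \<le> t"
  shows "mean_energy t (truncated n) = (\<integral>\<^sup>+s\<in>{0..t}. (\<integral>\<^sup>+\<omega>. ennreal ((norm (truncated n s \<omega>))\<^sup>2) \<partial>M) \<partial>lborel)"
proof -
  interpret H: finite_measure "horizon t" by (rule finite_measure_horizon)
  interpret pair_sigma_finite M "horizon t" ..
  have "(\<lambda>(\<omega>, s). ennreal ((norm (truncated n s \<omega>))\<^sup>2)) \<in> borel_measurable (M \<Otimes>\<^sub>M horizon t)"
    using truncated_joint[OF t, of n] unfolding split_beta' by measurable
  from Fubini'[OF this] show ?thesis unfolding nn_integral_horizon by simp
qed

lemma truncated_inner_energy_le: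
  assumes t: "0 \<le> t"
  shows "mean_energy t (\<lambda>s \<omega>. c \<bullet> truncated n s \<omega>) \<le> ennreal ((norm c)\<^sup>2) * mean_energy t (truncated n)"
proof -
  have "mean_energy t (\<lambda>s \<omega>. c \<bullet> truncated n s \<omega>) \<le> (\<integral>\<^sup>+\<omega>. ennreal ((norm c)\<^sup>2) * energy t (truncated n) \<omega> \<partial>M)"
    using inner_le_norm_bound[of c] by (intro nn_integral_mono energy_scaled truncated_joint t) auto
  also have "\<dots> = ennreal ((norm c)\<^sup>2) * mean_energy t (truncated n)"
    by (rule nn_integral_cmult[OF energy_measurable[OF truncated_joint[OF t]]])
  finally show ?thesis .
qed

text \<open>The integral inequality behind Gronwall, for one functional. On \<open>held n t\<close>
  the solution coincides with its truncation on all of \<open>{0..t}\<close>, so drift and noise are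
  both bounded by the energy of the truncation.\<close>

lemma truncated_component_bound:
  assumes t: "0 \<le> t"
  shows "(\<integral>\<^sup>+\<omega>. ennreal ((e \<bullet> truncated n t \<omega>)\<^sup>2) \<partial>M) \<le> ennreal (4 * (e \<bullet> x0)\<^sup>2)
      + ennreal (4 * t * (norm (e v* A))\<^sup>2 + 2 * real CARD('m) * (\<Sum>k\<in>UNIV. (norm (e v* G k))\<^sup>2)) * mean_energy t (truncated n)"
proof -
  define V where "V = mean_energy t (truncated n)"
  define a where "a = e \<bullet> x0"
  define c where "c = e v* A"
  define m where "m = real CARD('m)"
  define g where "g = (\<Sum>k\<in>UNIV. (norm (e v* G k))\<^sup>2)"
  have mg: "0 \<le> m" "0 \<le> g" by (auto simp: m_def g_def sum_nonneg)
  define h where "h \<omega> = (of_bool (held n t \<omega>) :: real)" for \<omega>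
  let ?D = "\<lambda>\<omega>. h \<omega> * (drift c t \<omega>)\<^sup>2" and ?N = "\<lambda>k \<omega>. h \<omega> * (e \<bullet> noise t k \<omega>)\<^sup>2"
  have h: "0 \<le> h \<omega>" for \<omega> by (simp add: h_def)
  have [measurable]: "h \<in> borel_measurable M"
    using held_measurable_M[OF t, of n] unfolding h_def[abs_def] by (simp add: of_bool_def)
  have [measurable]: "drift c t \<in> borel_measurable M" by (rule drift_measurable[OF t])
  have [measurable]: "(\<lambda>\<omega>. e \<bullet> noise t k \<omega>) \<in> borel_measurable M" for k
    using noise_inner[OF t, of k e] by (auto simp: has_ito_integral_def tendsto_in_probability_def)
  have "(\<integral>\<^sup>+\<omega>. ennreal (?D \<omega>) \<partial>M) \<le> (\<integral>\<^sup>+\<omega>. ennreal t * energy t (\<lambda>s \<omega>. c \<bullet> truncated n s \<omega>) \<omega> \<partial>M)"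
  proof (rule nn_integral_mono)
    fix \<omega> assume \<omega>: "\<omega> \<in> space M"
    show "ennreal (?D \<omega>) \<le> ennreal t * energy t (\<lambda>s \<omega>. c \<bullet> truncated n s \<omega>) \<omega>"
    proof (cases "held n t \<omega>")
      case True
      have "energy t (\<lambda>s \<omega>. c \<bullet> X s \<omega>) \<omega> \<le> energy t (\<lambda>s \<omega>. c \<bullet> truncated n s \<omega>) \<omega>"
        using held_antimono[OF True] by (intro energy_le) (simp add: truncated_def)
      from order_trans[OF drift_square_le[OF \<omega> t] mult_left_mono[OF this]] show ?thesis
        using True by (simp add: h_def)
    qed (simp add: h_def)
  qed
  also have "\<dots> = ennreal t * mean_energy t (\<lambda>s \<omega>. c \<bullet> truncated n s \<omega>)"
    by (rule nn_integral_cmult[OF energy_measurable[OF inner_joint[OF truncated_joint[OF t]]]])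
  also have "\<dots> \<le> ennreal t * (ennreal ((norm c)\<^sup>2) * V)"
    unfolding V_def by (intro mult_left_mono truncated_inner_energy_le t) simp
  finally have drift_le: "(\<integral>\<^sup>+\<omega>. ennreal (?D \<omega>) \<partial>M) \<le> ennreal t * (ennreal ((norm c)\<^sup>2) * V)" .
  have "(\<Sum>k\<in>UNIV. (\<integral>\<^sup>+\<omega>. ennreal (?N k \<omega>) \<partial>M)) \<le> (\<Sum>k\<in>UNIV. ennreal ((norm (e v* G k))\<^sup>2) * V)"
    unfolding V_def h_def
    by (intro sum_mono order_trans[OF ito_truncated_bound[OF noise_inner[OF t] t] truncated_inner_energy_le[OF t]])
  also have "\<dots> = ennreal g * V"
    by (simp add: g_def sum_distrib_right[symmetric] sum_ennreal)
  finally have noise_le: "(\<Sum>k\<in>UNIV. (\<integral>\<^sup>+\<omega>. ennreal (?N k \<omega>) \<partial>M)) \<le> ennreal g * V" .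
  have "(\<integral>\<^sup>+\<omega>. ennreal ((e \<bullet> truncated n t \<omega>)\<^sup>2) \<partial>M)
      \<le> (\<integral>\<^sup>+\<omega>. ennreal (4 * a\<^sup>2) + 4 * ennreal (?D \<omega>) + ennreal (2 * m) * (\<Sum>k\<in>UNIV. ennreal (?N k \<omega>)) \<partial>M)"
  proof (rule nn_integral_mono_AE)
    show "AE \<omega> in M. ennreal ((e \<bullet> truncated n t \<omega>)\<^sup>2)
        \<le> ennreal (4 * a\<^sup>2) + 4 * ennreal (?D \<omega>) + ennreal (2 * m) * (\<Sum>k\<in>UNIV. ennreal (?N k \<omega>))"
      using solution_inner[OF t, of e]
    proof eventually_elim
      case (elim \<omega>)
      define b where "b = drift c t \<omega>"
      \<comment> \<open>Using \<open>(x + y)^2 \<le> 2 x^2 + 2 y^2\<close> twice yields the factors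
        4, 4 and 2; the square of the sum over the noise components costs a further factor
        \<open>m\<close>.\<close>
      define N where "N = (\<Sum>k\<in>UNIV. e \<bullet> noise t k \<omega>)"
      have "N\<^sup>2 \<le> (\<Sum>k\<in>UNIV. (e \<bullet> noise t k \<omega>)\<^sup>2) * m"
        unfolding N_def m_def using sum_squared_le_sum_of_squares[of "\<lambda>k. e \<bullet> noise t k \<omega>" UNIV] by simp
      moreover have "(a + b + N)\<^sup>2 \<le> 2 * (a + b)\<^sup>2 + 2 * N\<^sup>2" "(a + b)\<^sup>2 \<le> 2 * a\<^sup>2 + 2 * b\<^sup>2"
        using power2_diff_le[of "a + b" "- N"] power2_diff_le[of a "- b"] by simp_all
      ultimately have le: "(a + b + N)\<^sup>2 \<le> 4 * a\<^sup>2 + 4 * b\<^sup>2 + 2 * m * (\<Sum>k\<in>UNIV. (e \<bullet> noise t k \<omega>)\<^sup>2)"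
        by (simp add: mult.commute)
      have "(e \<bullet> truncated n t \<omega>)\<^sup>2 = h \<omega> * (a + b + N)\<^sup>2"
        using elim by (simp add: truncated_def h_def a_def b_def N_def c_def)
      also have "\<dots> \<le> h \<omega> * (4 * a\<^sup>2 + 4 * b\<^sup>2 + 2 * m * (\<Sum>k\<in>UNIV. (e \<bullet> noise t k \<omega>)\<^sup>2))"
        by (rule mult_left_mono[OF le h])
      also have "\<dots> \<le> 4 * a\<^sup>2 + 4 * ?D \<omega> + 2 * m * (\<Sum>k\<in>UNIV. ?N k \<omega>)"
        using mg by (simp add: h_def b_def sum_nonneg)
      finally have "ennreal ((e \<bullet> truncated n t \<omega>)\<^sup>2) \<le> ennreal (4 * a\<^sup>2 + 4 * ?D \<omega> + 2 * m * (\<Sum>k\<in>UNIV. ?N k \<omega>))"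
        by (rule ennreal_leI)
      also have "\<dots> = ennreal (4 * a\<^sup>2) + 4 * ennreal (?D \<omega>) + ennreal (2 * m) * (\<Sum>k\<in>UNIV. ennreal (?N k \<omega>))"
        by (rule ennreal_affine) (use h[of \<omega>] mg in auto)
      finally show ?case .
    qed
  qed
  also have "\<dots> = ennreal (4 * a\<^sup>2) + 4 * (\<integral>\<^sup>+\<omega>. ennreal (?D \<omega>) \<partial>M) + ennreal (2 * m) * (\<Sum>k\<in>UNIV. (\<integral>\<^sup>+\<omega>. ennreal (?N k \<omega>) \<partial>M))"
    by (simp add: nn_integral_add nn_integral_cmult nn_integral_sum emeasure_space_1)
  also have "\<dots> \<le> ennreal (4 * a\<^sup>2) + 4 * (ennreal t * (ennreal ((norm c)\<^sup>2) * V)) + ennreal (2 * m) * (ennreal g * V)"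
    by (intro add_mono mult_left_mono drift_le noise_le order_refl) auto
  also have "\<dots> = ennreal (4 * a\<^sup>2) + ennreal (4 * t * (norm c)\<^sup>2 + 2 * m * g) * V"
    using t mg by (simp add: ennreal_plus ennreal_mult distrib_right add.assoc mult.assoc)
  finally show ?thesis by (simp add: V_def a_def c_def m_def g_def)
qed

lemma norm_square_components: "(norm (x :: real^'d))\<^sup>2 = (\<Sum>i\<in>UNIV. (axis i 1 \<bullet> x)\<^sup>2)"
  unfolding power2_norm_eq_inner by (simp add: inner_axis') (simp add: inner_vec_def power2_eq_square)

lemma truncated_moment_bound:
  assumes T: "0 \<le> T"
  shows "\<exists>C\<ge>0. \<forall>n. \<forall>t\<in>{0..T}. (\<integral>\<^sup>+\<omega>. ennreal ((norm (truncated n t \<omega>))\<^sup>2) \<partial>M) \<le> ennreal C"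
proof -
  define \<alpha> where "\<alpha> t e = 4 * t * (norm (e v* A))\<^sup>2 + 2 * real CARD('m) * (\<Sum>k\<in>UNIV. (norm (e v* G k))\<^sup>2)" for t and e :: "real^'d"
  define K0 where "K0 = (\<Sum>i\<in>UNIV. 4 * (axis i 1 \<bullet> x0)\<^sup>2)"
  \<comment> \<open>The added 1 makes \<open>K1\<close> strictly positive, as the Gronwall lemma
    divides by it.\<close>
  define K1 where "K1 = (\<Sum>i\<in>UNIV. \<alpha> T (axis i 1)) + 1"
  have \<alpha>: "0 \<le> \<alpha> t e" "\<alpha> t e \<le> \<alpha> T e" if "t \<in> {0..T}" for t e
    using that by (auto simp: \<alpha>_def sum_nonneg intro!: mult_right_mono)
  have K: "0 \<le> K0" "0 < K1"
    using \<alpha>(1)[of T] T by (auto simp: K0_def K1_def sum_nonneg intro!: add_nonneg_pos)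
  define u where "u n t = (\<integral>\<^sup>+\<omega>. ennreal ((norm (truncated n t \<omega>))\<^sup>2) \<partial>M)" for n t
  \<comment> \<open>This bound grows with \<open>n\<close>, but it serves Gronwall only as an a
    priori bound and does not enter the final constant.\<close>
  have bound: "u n t \<le> ennreal ((real n)\<^sup>2)" if "t \<in> {0..T}" for n t
  proof -
    have "u n t \<le> (\<integral>\<^sup>+\<omega>. ennreal ((real n)\<^sup>2) \<partial>M)"
      unfolding u_def using norm_truncated_le[of t n] that
      by (intro nn_integral_mono ennreal_leI power_mono) auto
    then show ?thesis by (simp add: emeasure_space_1)
  qed
  have ineq: "u n t \<le> ennreal K0 + ennreal K1 * (\<integral>\<^sup>+s\<in>{0..t}. u n s \<partial>lborel)" if t: "t \<in> {0..T}" for n t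
  proof -
    define V where "V = mean_energy t (truncated n)"
    have t0: "0 \<le> t" using t by simp
    note [measurable] = truncated_measurable[OF t0]
    have "u n t = (\<Sum>i\<in>UNIV. (\<integral>\<^sup>+\<omega>. ennreal ((axis i 1 \<bullet> truncated n t \<omega>)\<^sup>2) \<partial>M))"
      unfolding u_def norm_square_components
      by (subst nn_integral_sum[symmetric]) (auto simp: sum_ennreal)
    also have "\<dots> \<le> (\<Sum>i\<in>UNIV. ennreal (4 * (axis i 1 \<bullet> x0)\<^sup>2) + ennreal (\<alpha> t (axis i 1)) * V)"
      unfolding \<alpha>_def V_def by (intro sum_mono truncated_component_bound t0)
    also have "\<dots> \<le> (\<Sum>i\<in>UNIV. ennreal (4 * (axis i 1 \<bullet> x0)\<^sup>2) + ennreal (\<alpha> T (axis i 1)) * V)"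
      using \<alpha>(2)[OF t] by (intro sum_mono add_mono mult_right_mono ennreal_leI) auto
    also have "\<dots> = ennreal K0 + ennreal (\<Sum>i\<in>UNIV. \<alpha> T (axis i 1)) * V"
      using \<alpha>(1)[of T] T by (simp add: sum.distrib sum_distrib_right[symmetric] K0_def sum_ennreal)
    also have "\<dots> \<le> ennreal K0 + ennreal K1 * V"
      by (intro add_mono mult_right_mono ennreal_leI) (auto simp: K1_def)
    finally show ?thesis by (simp add: V_def truncated_energy[OF t0] u_def)
  qed
  have "u n t \<le> ennreal (2 * K0 * exp (2 * K1 * T))" if t: "t \<in> {0..T}" for n t
  proof -
    have "u n t \<le> ennreal (2 * K0 * exp (2 * K1 * t))"
      by (rule gronwall_nn[OF bound K _ ineq t]) auto
    also have "\<dots> \<le> ennreal (2 * K0 * exp (2 * K1 * T))"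
      using K t by (intro ennreal_leI mult_left_mono) auto
    finally show ?thesis .
  qed
  then show ?thesis
    unfolding u_def using K by (intro exI[of _ "2 * K0 * exp (2 * K1 * T)"]) auto
qed

text \<open>Along each path the truncation is eventually inactive, so Fatou's lemma transfers the
  bound that is uniform in the level.\<close>

lemma second_moment_bound:
  assumes T: "0 \<le> T"
  shows "\<exists>C\<ge>0. \<forall>t\<in>{0..T}. (\<integral>\<^sup>+\<omega>. ennreal ((norm (X t \<omega>))\<^sup>2) \<partial>M) \<le> ennreal C"
proof -
  obtain C where C: "0 \<le> C" "\<And>n t. t \<in> {0..T} \<Longrightarrow> (\<integral>\<^sup>+\<omega>. ennreal ((norm (truncated n t \<omega>))\<^sup>2) \<partial>M) \<le> ennreal C"
    using truncated_moment_bound[OF T] by blast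
  have "(\<integral>\<^sup>+\<omega>. ennreal ((norm (X t \<omega>))\<^sup>2) \<partial>M) \<le> ennreal C" if t: "t \<in> {0..T}" for t
  proof -
    have t0: "0 \<le> t" using t by simp
    note [measurable] = truncated_measurable[OF t0]
    have "(\<integral>\<^sup>+\<omega>. ennreal ((norm (X t \<omega>))\<^sup>2) \<partial>M) = (\<integral>\<^sup>+\<omega>. liminf (\<lambda>n. ennreal ((norm (truncated n t \<omega>))\<^sup>2)) \<partial>M)"
    proof (rule nn_integral_cong)
      fix \<omega> assume "\<omega> \<in> space M"
      then obtain n0 where n0: "held n0 t \<omega>" using ex_held by blast
      have "eventually (\<lambda>n. ennreal ((norm (truncated n t \<omega>))\<^sup>2) = ennreal ((norm (X t \<omega>))\<^sup>2)) sequentially"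
        using eventually_ge_at_top[of n0]
        by eventually_elim (use held_mono[OF n0] in \<open>simp add: truncated_def\<close>)
      then have "(\<lambda>n. ennreal ((norm (truncated n t \<omega>))\<^sup>2)) \<longlonglongrightarrow> ennreal ((norm (X t \<omega>))\<^sup>2)"
        by (rule tendsto_eventually)
      from lim_imp_Liminf[OF _ this]
      show "ennreal ((norm (X t \<omega>))\<^sup>2) = liminf (\<lambda>n. ennreal ((norm (truncated n t \<omega>))\<^sup>2))" by simp
    qed
    also have "\<dots> \<le> liminf (\<lambda>n. \<integral>\<^sup>+\<omega>. ennreal ((norm (truncated n t \<omega>))\<^sup>2) \<partial>M)"
      by (rule nn_integral_liminf) measurable
    also have "\<dots> \<le> liminf (\<lambda>n :: nat. ennreal C)"
      using C(2)[OF t] by (intro Liminf_mono always_eventually allI)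
    also have "\<dots> = ennreal C" by (simp add: Liminf_const)
    finally show ?thesis .
  qed
  with C(1) show ?thesis by blast
qed

end

text \<open>The second-moment bound integrates to a finite mean energy, which opens the mean-square
  theory to solutions.\<close>

sublocale linear_sde \<subseteq> square_integrable_process M F W X
proof
  fix T :: real assume T: "0 \<le> T"
  interpret H: finite_measure "horizon T" by (rule finite_measure_horizon)
  interpret P: pair_sigma_finite M "horizon T" ..
  obtain C where C: "\<And>t. t \<in> {0..T} \<Longrightarrow> (\<integral>\<^sup>+\<omega>. ennreal ((norm (X t \<omega>))\<^sup>2) \<partial>M) \<le> ennreal C"
    using second_moment_bound[OF T] by blast
  have "(\<lambda>(\<omega>, s). ennreal ((norm (X s \<omega>))\<^sup>2)) \<in> borel_measurable (M \<Otimes>\<^sub>M horizon T)"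
    using X_joint[OF T] unfolding split_beta' by measurable
  from P.Fubini'[OF this]
  have "mean_energy T X = (\<integral>\<^sup>+s. (\<integral>\<^sup>+\<omega>. ennreal ((norm (X s \<omega>))\<^sup>2) \<partial>M) \<partial>horizon T)"
    unfolding nn_integral_horizon by simp
  also have "\<dots> \<le> (\<integral>\<^sup>+s. ennreal C \<partial>horizon T)"
    using C by (intro nn_integral_mono) (simp add: space_restrict_space)
  also have "\<dots> < \<infinity>"
    unfolding nn_integral_const emeasure_horizon by (simp add: ennreal_mult_less_top)
  finally show "mean_energy T X < \<infinity>" .
qed

section \<open>Moment equations\<close>

lemma integral_continuous_horizon:
  fixes f :: "real \<Rightarrow> real"
  assumes "continuous_on {0..t} f"
  shows "(\<integral>s. f s \<partial>horizon t) = integral {0..t} f"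
  using set_borel_integral_eq_integral(2)[OF borel_integrable_atLeastAtMost'[OF assms]]
  by (simp add: set_integral_horizon)

text \<open>The derivative of the square of a primitive, integrated; it turns the squared drift into
  a time integral.\<close>

lemma square_of_primitive:
  fixes f :: "real \<Rightarrow> real"
  assumes t: "0 \<le> t" and f: "continuous_on {0..t} f"
  shows "(\<integral>s. f s \<partial>horizon t)\<^sup>2 = (\<integral>s. 2 * (f s * (\<integral>r. f r \<partial>horizon s)) \<partial>horizon t)"
proof -
  define g where "g s = integral {0..s} f" for s
  have fs: "continuous_on {0..s} f" if "s \<in> {0..t}" for s
    using f that by (auto intro: continuous_on_subset)
  have g: "(\<integral>r. f r \<partial>horizon s) = g s" if "s \<in> {0..t}" for s
    unfolding g_def by (rule integral_continuous_horizon[OF fs[OF that]])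
  have g': "(g has_vector_derivative f s) (at s within {0..t})" if "s \<in> {0..t}" for s
    unfolding g_def[abs_def] by (rule integral_has_vector_derivative[OF f that])
  then have cont_g: "continuous_on {0..t} g"
    by (meson continuous_on_eq_continuous_within has_vector_derivative_continuous)
  have "((\<lambda>s. 2 * (f s * g s)) has_integral (g t)\<^sup>2 - (g 0)\<^sup>2) {0..t}"
  proof (rule fundamental_theorem_of_calculus[OF t])
    fix s assume "s \<in> {0..t}"
    then have "(g has_real_derivative f s) (at s within {0..t})"
      using g' by (simp add: has_real_derivative_iff_has_vector_derivative)
    then have "((\<lambda>s. (g s)\<^sup>2) has_real_derivative 2 * (f s * g s)) (at s within {0..t})"
      by (auto intro!: derivative_eq_intros simp: ac_simps)
    then show "((\<lambda>s. (g s)\<^sup>2) has_vector_derivative 2 * (f s * g s)) (at s within {0..t})"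
      by (simp add: has_real_derivative_iff_has_vector_derivative)
  qed
  moreover have "g 0 = 0" by (simp add: g_def)
  ultimately have "integral {0..t} (\<lambda>s. 2 * (f s * g s)) = (g t)\<^sup>2"
    by (auto dest: integral_unique)
  moreover have "(\<integral>s. 2 * (f s * g s) \<partial>horizon t) = integral {0..t} (\<lambda>s. 2 * (f s * g s))"
    by (intro integral_continuous_horizon continuous_intros f cont_g)
  moreover have "(\<integral>s. 2 * (f s * (\<integral>r. f r \<partial>horizon s)) \<partial>horizon t) = (\<integral>s. 2 * (f s * g s) \<partial>horizon t)"
    by (intro Bochner_Integration.integral_cong) (auto simp: g space_restrict_space)
  ultimately show ?thesis using g[of t] t by simp
qed

section \<open>Joint measurability of the drift\<close>

context continuous_adapted_process
begin

text \<open>The variable upper limit is moved into the integrand as the condition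
  \<open>r \<le> s\<close>, which leaves an integral with parameters over a fixed interval.\<close>

lemma drift_joint:
  assumes t: "0 \<le> t"
  shows "jointly_measurable t (drift c)"
proof -
  interpret H: finite_measure "horizon t" by (rule finite_measure_horizon)
  let ?N = "M \<Otimes>\<^sub>M horizon t"
  have X: "(\<lambda>z. X (snd z) (fst z)) \<in> borel_measurable ?N"
    using X_joint[OF t] by (simp add: split_beta')
  have id: "(\<lambda>s. s) \<in> borel_measurable (horizon t)" by (rule measurable_restrict_space1) simp
  have "(\<lambda>y. (fst (fst y), snd y)) \<in> measurable (?N \<Otimes>\<^sub>M horizon t) ?N" by measurable
  from measurable_compose[OF this X]
  have [measurable]: "(\<lambda>y. X (snd y) (fst (fst y))) \<in> borel_measurable (?N \<Otimes>\<^sub>M horizon t)" by simp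
  have [measurable]: "(\<lambda>y. snd y) \<in> borel_measurable (?N \<Otimes>\<^sub>M horizon t)" "(\<lambda>y. snd (fst y)) \<in> borel_measurable (?N \<Otimes>\<^sub>M horizon t)"
    by (rule measurable_compose[OF _ id]; measurable)+
  have "(\<lambda>y. if snd y \<le> snd (fst y) then c \<bullet> X (snd y) (fst (fst y)) else 0) \<in> borel_measurable (?N \<Otimes>\<^sub>M horizon t)"
    by measurable
  then have "(\<lambda>z. \<integral>r. (if r \<le> snd z then c \<bullet> X r (fst z) else 0) \<partial>horizon t) \<in> borel_measurable ?N"
    by (intro H.borel_measurable_lebesgue_integral) (simp add: split_beta')
  moreover have "(\<integral>r. (if r \<le> snd z then c \<bullet> X r (fst z) else 0) \<partial>horizon t) = (case z of (\<omega>, s) \<Rightarrow> drift c s \<omega>)"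
    if "z \<in> space ?N" for z
  proof -
    obtain \<omega> s where z: "z = (\<omega>, s)" by (cases z)
    have s: "0 \<le> s" "s \<le> t" using that by (auto simp: z space_pair_measure space_restrict_space)
    have "(\<integral>r. (if r \<le> s then c \<bullet> X r \<omega> else 0) \<partial>horizon t)
        = (\<integral>r. indicator {0..t} r *\<^sub>R (if r \<le> s then c \<bullet> X r \<omega> else 0) \<partial>lborel)"
      by (simp add: integral_restrict_space)
    also have "\<dots> = (\<integral>r. indicator {0..s} r *\<^sub>R (c \<bullet> X r \<omega>) \<partial>lborel)"
      using s by (intro Bochner_Integration.integral_cong) (auto simp: indicator_def)
    also have "\<dots> = drift c s \<omega>" unfolding drift_def by (simp add: integral_restrict_space)
    finally show ?thesis unfolding z fst_conv snd_conv prod.case .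
  qed
  ultimately show ?thesis by (simp cong: measurable_cong)
qed

end

section \<open>Square integrability over sample space and time\<close>

context square_integrable_process
begin

lemma time_space_Fubini:
  fixes Y :: "real \<Rightarrow> 'a \<Rightarrow> real"
  assumes "integrable (time_space t) (\<lambda>(\<omega>, s). Y s \<omega>)"
  shows "integrable (horizon t) (\<lambda>s. expectation (Y s))"
    and "(\<integral>z. (case z of (\<omega>, s) \<Rightarrow> Y s \<omega>) \<partial>time_space t) = (\<integral>s. expectation (Y s) \<partial>horizon t)"
    and "expectation (\<lambda>\<omega>. \<integral>s. Y s \<omega> \<partial>horizon t) = (\<integral>s. expectation (Y s) \<partial>horizon t)"
proof -
  interpret H: finite_measure "horizon t" by (rule finite_measure_horizon)
  interpret P: pair_sigma_finite M "horizon t" ..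
  show "integrable (horizon t) (\<lambda>s. expectation (Y s))"
    using P.integrable_snd[OF assms] .
  show 1: "(\<integral>z. (case z of (\<omega>, s) \<Rightarrow> Y s \<omega>) \<partial>time_space t) = (\<integral>s. expectation (Y s) \<partial>horizon t)"
    using P.integral_snd[OF assms] by simp
  show "expectation (\<lambda>\<omega>. \<integral>s. Y s \<omega> \<partial>horizon t) = (\<integral>s. expectation (Y s) \<partial>horizon t)"
    using P.integral_fst'[OF assms] 1 by simp
qed

lemma drift_square_integrable:
  assumes t: "0 \<le> t"
  shows "square_integrable M (drift c t)"
  unfolding square_integrable_iff_nn
proof
  have J: "jointly_measurable t (\<lambda>s \<omega>. c \<bullet> X s \<omega>)" by (intro inner_joint X_joint t)
  have "(\<integral>\<^sup>+\<omega>. ennreal ((drift c t \<omega>)\<^sup>2) \<partial>M) \<le> (\<integral>\<^sup>+\<omega>. ennreal t * energy t (\<lambda>s \<omega>. c \<bullet> X s \<omega>) \<omega> \<partial>M)"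
    by (intro nn_integral_mono drift_square_le t)
  also have "\<dots> = ennreal t * mean_energy t (\<lambda>s \<omega>. c \<bullet> X s \<omega>)"
    by (rule nn_integral_cmult[OF energy_measurable[OF J]])
  also have "\<dots> < \<infinity>"
    using inner_square_integrable[OF t, of c]
    unfolding square_integrable_iff_nn nn_integral_time_space[OF J] by (simp add: ennreal_mult_less_top)
  finally show "(\<integral>\<^sup>+\<omega>. ennreal ((drift c t \<omega>)\<^sup>2) \<partial>M) < \<infinity>" .
qed (rule drift_measurable[OF t])

lemma drift_square_integrable_time_space:
  assumes t: "0 \<le> t"
  shows "square_integrable (time_space t) (\<lambda>(\<omega>, s). drift c s \<omega>)"
  unfolding square_integrable_iff_nn nn_integral_time_space[OF drift_joint[OF t]]
proof (intro conjI drift_joint t)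
  have J: "jointly_measurable t (\<lambda>s \<omega>. c \<bullet> X s \<omega>)" by (intro inner_joint X_joint t)
  have "mean_energy t (drift c) \<le> (\<integral>\<^sup>+\<omega>. (ennreal t * ennreal t) * energy t (\<lambda>s \<omega>. c \<bullet> X s \<omega>) \<omega> \<partial>M)"
  proof (rule nn_integral_mono)
    fix \<omega> assume \<omega>: "\<omega> \<in> space M"
    have "energy t (drift c) \<omega> \<le> (\<integral>\<^sup>+s. ennreal t * energy t (\<lambda>s \<omega>. c \<bullet> X s \<omega>) \<omega> \<partial>horizon t)"
      unfolding nn_integral_horizon[where f = "\<lambda>s. ennreal ((norm (drift c s \<omega>))\<^sup>2)"]
    proof (rule nn_integral_mono)
      fix s assume "s \<in> space (horizon t)"
      then have s: "0 \<le> s" "s \<le> t" by (auto simp: space_restrict_space)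
      have "ennreal ((norm (drift c s \<omega>))\<^sup>2) \<le> ennreal s * energy s (\<lambda>s \<omega>. c \<bullet> X s \<omega>) \<omega>"
        using drift_square_le[OF \<omega> s(1), of c] by simp
      also have "\<dots> \<le> ennreal t * energy t (\<lambda>s \<omega>. c \<bullet> X s \<omega>) \<omega>"
        using s by (intro mult_mono ennreal_leI energy_mono) auto
      finally show "ennreal ((norm (drift c s \<omega>))\<^sup>2) \<le> ennreal t * energy t (\<lambda>s \<omega>. c \<bullet> X s \<omega>) \<omega>" .
    qed
    also have "\<dots> = (ennreal t * ennreal t) * energy t (\<lambda>s \<omega>. c \<bullet> X s \<omega>) \<omega>"
      unfolding nn_integral_const emeasure_horizon using t by (simp add: ac_simps)
    finally show "energy t (drift c) \<omega> \<le> (ennreal t * ennreal t) * energy t (\<lambda>s \<omega>. c \<bullet> X s \<omega>) \<omega>" .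
  qed
  also have "\<dots> = (ennreal t * ennreal t) * mean_energy t (\<lambda>s \<omega>. c \<bullet> X s \<omega>)"
    by (rule nn_integral_cmult[OF energy_measurable[OF J]])
  also have "\<dots> < \<infinity>"
    using inner_square_integrable[OF t, of c]
    unfolding square_integrable_iff_nn nn_integral_time_space[OF J] by (simp add: ennreal_mult_less_top)
  finally show "mean_energy t (drift c) < \<infinity>" .
qed

text \<open>Serves for the noise at the final time, a factor that does not vary with the integration
  time.\<close>

lemma past_square_integrable_time_space:
  assumes N: "square_integrable M N"
  shows "square_integrable (time_space t) (\<lambda>(\<omega>, s). N \<omega>)"
proof -
  interpret H: finite_measure "horizon t" by (rule finite_measure_horizon)
  note [measurable] = square_integrableD(1)[OF N]
  have J: "jointly_measurable t (\<lambda>s. N)" by measurable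
  have "mean_energy t (\<lambda>s. N) = (\<integral>\<^sup>+\<omega>. ennreal (max 0 t) * ennreal ((N \<omega>)\<^sup>2) \<partial>M)"
    unfolding nn_integral_horizon nn_integral_const emeasure_horizon by (simp add: mult.commute)
  also have "\<dots> = ennreal (max 0 t) * (\<integral>\<^sup>+\<omega>. ennreal ((N \<omega>)\<^sup>2) \<partial>M)"
    by (rule nn_integral_cmult) measurable
  also have "\<dots> < \<infinity>" using N by (simp add: square_integrable_iff_nn ennreal_mult_less_top)
  finally show ?thesis using J unfolding square_integrable_iff_nn nn_integral_time_space[OF J] by blast
qed

end

section \<open>Equations for the first and second moments\<close>

context linear_sde
begin

lemma X_inner_square_integrable:
  assumes t: "0 \<le> t"
  shows "square_integrable M (\<lambda>\<omega>. e \<bullet> X t \<omega>)"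
  unfolding square_integrable_iff_nn
proof
  note [measurable] = X_measurable[OF t]
  show "(\<lambda>\<omega>. e \<bullet> X t \<omega>) \<in> borel_measurable M" by measurable
  obtain C where C: "(\<integral>\<^sup>+\<omega>. ennreal ((norm (X t \<omega>))\<^sup>2) \<partial>M) \<le> ennreal C"
  proof -
    obtain C where "\<forall>s\<in>{0..t}. (\<integral>\<^sup>+\<omega>. ennreal ((norm (X s \<omega>))\<^sup>2) \<partial>M) \<le> ennreal C"
      using second_moment_bound[OF t] by blast
    then show ?thesis using t by (intro that[of C]) auto
  qed
  have "(\<integral>\<^sup>+\<omega>. ennreal ((e \<bullet> X t \<omega>)\<^sup>2) \<partial>M) \<le> (\<integral>\<^sup>+\<omega>. ennreal ((norm e)\<^sup>2) * ennreal ((norm (X t \<omega>))\<^sup>2) \<partial>M)"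
  proof (rule nn_integral_mono)
    fix \<omega>
    have "\<bar>e \<bullet> X t \<omega>\<bar>\<^sup>2 \<le> (norm e * norm (X t \<omega>))\<^sup>2"
      using inner_le_norm_bound[of e "X t \<omega>"] by (intro power_mono) auto
    then show "ennreal ((e \<bullet> X t \<omega>)\<^sup>2) \<le> ennreal ((norm e)\<^sup>2) * ennreal ((norm (X t \<omega>))\<^sup>2)"
      by (simp add: ennreal_mult[symmetric] power_mult_distrib ennreal_leI)
  qed
  also have "\<dots> = ennreal ((norm e)\<^sup>2) * (\<integral>\<^sup>+\<omega>. ennreal ((norm (X t \<omega>))\<^sup>2) \<partial>M)"
    by (rule nn_integral_cmult) measurable
  also have "\<dots> < \<infinity>" using C by (simp add: ennreal_mult_less_top) (use ennreal_less_top le_less_trans in blast)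
  finally show "(\<integral>\<^sup>+\<omega>. ennreal ((e \<bullet> X t \<omega>)\<^sup>2) \<partial>M) < \<infinity>" .
qed

definition total_noise :: "real^'d \<Rightarrow> real \<Rightarrow> 'a \<Rightarrow> real" where
  "total_noise e t \<omega> = (\<Sum>k\<in>UNIV. e \<bullet> noise t k \<omega>)"

lemma solution_decomposition:
  "0 \<le> t \<Longrightarrow> AE \<omega> in M. e \<bullet> X t \<omega> = e \<bullet> x0 + drift (e v* A) t \<omega> + total_noise e t \<omega>"
  using solution_inner[of t e] by (simp add: total_noise_def)

lemma noise_square_integrable: "0 \<le> t \<Longrightarrow> square_integrable M (\<lambda>\<omega>. e \<bullet> noise t k \<omega>)"
  by (rule ito_square_integrable[OF _ noise_inner])

lemma total_noise_square_integrable: "0 \<le> t \<Longrightarrow> square_integrable M (total_noise e t)"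
  unfolding total_noise_def[abs_def] by (intro square_integrable_sum noise_square_integrable)

lemma total_noise_mean: "0 \<le> t \<Longrightarrow> expectation (total_noise e t) = 0"
  unfolding total_noise_def[abs_def]
  by (subst Bochner_Integration.integral_sum)
     (auto simp: ito_mean_zero[OF _ noise_inner] intro!: square_integrable_imp_integrable noise_square_integrable)

lemma total_noise_martingale:
  assumes st: "0 \<le> s" "s \<le> t" and Z: "Z \<in> borel_measurable (Fb s)" "square_integrable M Z"
  shows "expectation (\<lambda>\<omega>. Z \<omega> * total_noise e t \<omega>) = expectation (\<lambda>\<omega>. Z \<omega> * total_noise e s \<omega>)"
proof -
  have t: "0 \<le> t" using st by simp
  have int: "integrable M (\<lambda>\<omega>. Z \<omega> * (e \<bullet> noise r k \<omega>))" if "0 \<le> r" for r k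
    by (intro square_integrable_mult Z noise_square_integrable that)
  have "expectation (\<lambda>\<omega>. Z \<omega> * (e \<bullet> noise t k \<omega>)) = expectation (\<lambda>\<omega>. Z \<omega> * (e \<bullet> noise s k \<omega>))" for k
    by (rule ito_martingale[OF st noise_inner[OF st(1)] noise_inner[OF t] Z])
  then show ?thesis
    using int[OF t] int[OF st(1)] by (simp add: total_noise_def sum_distrib_left)
qed

text \<open>Distinct components are orthogonal, so only the isometry terms of the double sum
  survive.\<close>

lemma total_noise_square:
  assumes t: "0 \<le> t"
  shows "expectation (\<lambda>\<omega>. (total_noise e t \<omega>)\<^sup>2) = (\<Sum>k\<in>UNIV. \<integral>z. (case z of (\<omega>, s) \<Rightarrow> (e v* G k) \<bullet> X s \<omega>)\<^sup>2 \<partial>time_space t)"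
proof -
  have int: "integrable M (\<lambda>\<omega>. (e \<bullet> noise t k \<omega>) * (e \<bullet> noise t l \<omega>))" for k l
    by (intro square_integrable_mult noise_square_integrable t)
  have off: "expectation (\<lambda>\<omega>. (e \<bullet> noise t k \<omega>) * (e \<bullet> noise t l \<omega>))
      = (if l = k then \<integral>z. (case z of (\<omega>, s) \<Rightarrow> (e v* G k) \<bullet> X s \<omega>)\<^sup>2 \<partial>time_space t else 0)" for k l
  proof (cases "k = l")
    case True
    then show ?thesis using ito_isometry[OF t noise_inner[OF t, of l e]] by (simp add: power2_eq_square)
  next
    case False
    then show ?thesis using ito_orthogonal[OF t noise_inner[OF t] noise_inner[OF t] False] by auto
  qed
  have "expectation (\<lambda>\<omega>. (total_noise e t \<omega>)\<^sup>2) = expectation (\<lambda>\<omega>. \<Sum>k\<in>UNIV. \<Sum>l\<in>UNIV. (e \<bullet> noise t k \<omega>) * (e \<bullet> noise t l \<omega>))"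
    by (simp add: total_noise_def power2_eq_square sum_product)
  also have "\<dots> = (\<Sum>k\<in>UNIV. \<Sum>l\<in>UNIV. expectation (\<lambda>\<omega>. (e \<bullet> noise t k \<omega>) * (e \<bullet> noise t l \<omega>)))"
    using int by (simp add: Bochner_Integration.integral_sum Bochner_Integration.integrable_sum)
  also have "\<dots> = (\<Sum>k\<in>UNIV. \<integral>z. (case z of (\<omega>, s) \<Rightarrow> (e v* G k) \<bullet> X s \<omega>)\<^sup>2 \<partial>time_space t)"
    unfolding off by simp
  finally show ?thesis .
qed

lemma mean_equation:
  assumes t: "0 \<le> t"
  shows "integrable (horizon t) (\<lambda>s. expectation (\<lambda>\<omega>. c \<bullet> X s \<omega>))"
    and "expectation (\<lambda>\<omega>. e \<bullet> X t \<omega>) = e \<bullet> x0 + (\<integral>s. expectation (\<lambda>\<omega>. (e v* A) \<bullet> X s \<omega>) \<partial>horizon t)"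
proof -
  interpret H: finite_measure "horizon t" by (rule finite_measure_horizon)
  interpret Q: finite_measure "time_space t"
    by (rule finite_measure_pair_measure) unfold_locales
  have int: "integrable (time_space t) (\<lambda>(\<omega>, s). c \<bullet> X s \<omega>)" for c
    by (rule Q.square_integrable_imp_integrable[OF inner_square_integrable[OF t]])
  show "integrable (horizon t) (\<lambda>s. expectation (\<lambda>\<omega>. c \<bullet> X s \<omega>))"
    by (rule time_space_Fubini(1)[OF int])
  have "expectation (\<lambda>\<omega>. e \<bullet> X t \<omega>) = expectation (\<lambda>\<omega>. e \<bullet> x0 + drift (e v* A) t \<omega> + total_noise e t \<omega>)"
    using solution_decomposition[OF t, of e] square_integrableD(1)[OF X_inner_square_integrable[OF t]]
      square_integrableD(1)[OF drift_square_integrable[OF t]] square_integrableD(1)[OF total_noise_square_integrable[OF t]]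
    by (intro integral_cong_AE) auto
  also have "\<dots> = e \<bullet> x0 + expectation (drift (e v* A) t) + expectation (total_noise e t)"
    using square_integrable_imp_integrable[OF drift_square_integrable[OF t, of "e v* A"]]
      square_integrable_imp_integrable[OF total_noise_square_integrable[OF t, of e]]
    by (simp add: prob_space)
  also have "expectation (drift (e v* A) t) = (\<integral>s. expectation (\<lambda>\<omega>. (e v* A) \<bullet> X s \<omega>) \<partial>horizon t)"
    unfolding drift_def[abs_def] by (rule time_space_Fubini(3)[OF int])
  finally show "expectation (\<lambda>\<omega>. e \<bullet> X t \<omega>) = e \<bullet> x0 + (\<integral>s. expectation (\<lambda>\<omega>. (e v* A) \<bullet> X s \<omega>) \<partial>horizon t)"
    by (simp add: total_noise_mean[OF t])
qed

text \<open>Expanding \<open>e \<bullet> X t = e \<bullet> x0 + D t + N t\<close> into drift and noise, the cross term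
  \<open>E (D t * N t)\<close> is the integral of \<open>E (D' s * N t) = E (D' s * N s)\<close> because \<open>N\<close> is a martingale;
  with \<open>D t\<^sup>2 = 2 \<integral> D' s * D s ds\<close> the drift terms recombine to \<open>2 E (D' s * (e \<bullet> X s))\<close>.\<close>

lemma second_moment_equation:
  assumes t: "0 \<le> t"
  shows "integrable (horizon t) (\<lambda>s. expectation (\<lambda>\<omega>. (c \<bullet> X s \<omega>) * (c' \<bullet> X s \<omega>)))"
    and "expectation (\<lambda>\<omega>. (e \<bullet> X t \<omega>)\<^sup>2) = (e \<bullet> x0)\<^sup>2 +
      (\<integral>s. 2 * expectation (\<lambda>\<omega>. ((e v* A) \<bullet> X s \<omega>) * (e \<bullet> X s \<omega>)) + (\<Sum>k\<in>UNIV. expectation (\<lambda>\<omega>. ((e v* G k) \<bullet> X s \<omega>)\<^sup>2)) \<partial>horizon t)"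
proof -
  interpret H: finite_measure "horizon t" by (rule finite_measure_horizon)
  interpret Q: finite_measure "time_space t"
    by (rule finite_measure_pair_measure) unfold_locales
  have prod: "integrable (time_space t) (\<lambda>(\<omega>, s). Y s \<omega> * Y' s \<omega>)"
    if "square_integrable (time_space t) (\<lambda>(\<omega>, s). Y s \<omega>)" "square_integrable (time_space t) (\<lambda>(\<omega>, s). Y' s \<omega>)"
    for Y Y' :: "real \<Rightarrow> 'a \<Rightarrow> real"
    using square_integrable_mult[OF that] by (simp add: split_beta')
  have XX: "integrable (time_space t) (\<lambda>(\<omega>, s). (c \<bullet> X s \<omega>) * (c' \<bullet> X s \<omega>))" for c c'
    by (intro prod inner_square_integrable t)
  show int_XX: "integrable (horizon t) (\<lambda>s. expectation (\<lambda>\<omega>. (c \<bullet> X s \<omega>) * (c' \<bullet> X s \<omega>)))" for c c'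
    by (rule time_space_Fubini(1)[OF XX])
  define a where "a = e \<bullet> x0"
  define c where "c = e v* A"
  define D where "D = drift c"
  define N where "N = total_noise e"
  let ?y = "\<lambda>s. expectation (\<lambda>\<omega>. c \<bullet> X s \<omega>)"
    and ?yD = "\<lambda>s. expectation (\<lambda>\<omega>. (c \<bullet> X s \<omega>) * D s \<omega>)"
    and ?yN = "\<lambda>s. expectation (\<lambda>\<omega>. (c \<bullet> X s \<omega>) * N s \<omega>)"
    and ?g = "\<lambda>s. \<Sum>k\<in>UNIV. expectation (\<lambda>\<omega>. ((e v* G k) \<bullet> X s \<omega>)\<^sup>2)"
  note D_sq = drift_square_integrable[OF t, of c, folded D_def]
  note N_sq = total_noise_square_integrable[OF t, of e, folded N_def]
  have int_y: "integrable (time_space t) (\<lambda>(\<omega>, s). c \<bullet> X s \<omega>)"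
    by (rule Q.square_integrable_imp_integrable[OF inner_square_integrable[OF t]])
  have int_yD: "integrable (time_space t) (\<lambda>(\<omega>, s). (c \<bullet> X s \<omega>) * D s \<omega>)"
    unfolding D_def by (intro prod inner_square_integrable drift_square_integrable_time_space t)
  \<comment> \<open>The noise is taken at the fixed time \<open>t\<close>: joint measurability of
    \<open>N\<close> in time is not at hand, so Fubini is applied to \<open>N t\<close> instead of
    \<open>N s\<close>.\<close>
  have int_yN: "integrable (time_space t) (\<lambda>(\<omega>, s). (c \<bullet> X s \<omega>) * N t \<omega>)"
    by (intro prod inner_square_integrable past_square_integrable_time_space N_sq t)
  have ED: "expectation (D t) = (\<integral>s. ?y s \<partial>horizon t)"
    unfolding D_def drift_def[abs_def] by (rule time_space_Fubini(3)[OF int_y])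
  have EN: "expectation (N t) = 0" unfolding N_def by (rule total_noise_mean[OF t])
  have ED2: "expectation (\<lambda>\<omega>. (D t \<omega>)\<^sup>2) = (\<integral>s. 2 * ?yD s \<partial>horizon t)"
  proof -
    have "expectation (\<lambda>\<omega>. (D t \<omega>)\<^sup>2) = expectation (\<lambda>\<omega>. \<integral>s. 2 * ((c \<bullet> X s \<omega>) * D s \<omega>) \<partial>horizon t)"
    proof (rule Bochner_Integration.integral_cong)
      fix \<omega> assume "\<omega> \<in> space M"
      then show "(D t \<omega>)\<^sup>2 = (\<integral>s. 2 * ((c \<bullet> X s \<omega>) * D s \<omega>) \<partial>horizon t)"
        unfolding D_def drift_def
        by (intro square_of_primitive t continuous_intros continuous_on_subset[OF X_continuous]) auto
    qed simp
    also have "\<dots> = 2 * expectation (\<lambda>\<omega>. \<integral>s. (c \<bullet> X s \<omega>) * D s \<omega> \<partial>horizon t)" by simp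
    also have "\<dots> = 2 * (\<integral>s. ?yD s \<partial>horizon t)"
      by (simp only: time_space_Fubini(3)[OF int_yD])
    finally show ?thesis by simp
  qed
  have EDN: "expectation (\<lambda>\<omega>. D t \<omega> * N t \<omega>) = (\<integral>s. ?yN s \<partial>horizon t)"
    and int_N: "integrable (horizon t) (\<lambda>s. ?yN s)"
  proof -
    \<comment> \<open>At each fixed \<open>s\<close> the martingale property exchanges
      \<open>N t\<close> for \<open>N s\<close> under the expectation.\<close>
    have mart: "expectation (\<lambda>\<omega>. (c \<bullet> X s \<omega>) * N t \<omega>) = ?yN s" if "s \<in> space (horizon t)" for s
    proof -
      have s: "0 \<le> s" "s \<le> t" using that by (auto simp: space_restrict_space)
      show ?thesis
        unfolding N_def by (intro total_noise_martingale s X_inner_square_integrable borel_measurable_inner borel_measurable_const X_adapted)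
    qed
    have "expectation (\<lambda>\<omega>. D t \<omega> * N t \<omega>) = expectation (\<lambda>\<omega>. \<integral>s. (c \<bullet> X s \<omega>) * N t \<omega> \<partial>horizon t)"
      by (simp add: D_def drift_def)
    also have "\<dots> = (\<integral>s. expectation (\<lambda>\<omega>. (c \<bullet> X s \<omega>) * N t \<omega>) \<partial>horizon t)"
      by (rule time_space_Fubini(3)[OF int_yN])
    also have "\<dots> = (\<integral>s. ?yN s \<partial>horizon t)"
      by (intro Bochner_Integration.integral_cong mart) simp
    finally show "expectation (\<lambda>\<omega>. D t \<omega> * N t \<omega>) = (\<integral>s. ?yN s \<partial>horizon t)" .
    \<comment> \<open>Integrability in \<open>s\<close> is inherited from the version with
      \<open>N t\<close>, which takes the same values.\<close>
    show "integrable (horizon t) (\<lambda>s. ?yN s)"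
      by (rule Bochner_Integration.integrable_cong[THEN iffD1, OF refl mart time_space_Fubini(1)[OF int_yN]])
  qed
  have EN2: "expectation (\<lambda>\<omega>. (N t \<omega>)\<^sup>2) = (\<integral>s. ?g s \<partial>horizon t)"
  proof -
    have "(\<integral>z. (case z of (\<omega>, s) \<Rightarrow> (e v* G k) \<bullet> X s \<omega>)\<^sup>2 \<partial>time_space t) = (\<integral>s. expectation (\<lambda>\<omega>. ((e v* G k) \<bullet> X s \<omega>)\<^sup>2) \<partial>horizon t)" for k
      using time_space_Fubini(2)[OF XX, of "e v* G k" "e v* G k"] by (simp add: power2_eq_square split_beta')
    then show ?thesis
      unfolding N_def total_noise_square[OF t] using int_XX[of "e v* G k" "e v* G k" for k]
      by (subst Bochner_Integration.integral_sum) (auto simp: power2_eq_square)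
  qed
  have "expectation (\<lambda>\<omega>. (e \<bullet> X t \<omega>)\<^sup>2) = expectation (\<lambda>\<omega>. (a + D t \<omega> + N t \<omega>)\<^sup>2)"
  proof (rule integral_cong_AE)
    show "AE \<omega> in M. (e \<bullet> X t \<omega>)\<^sup>2 = (a + D t \<omega> + N t \<omega>)\<^sup>2"
      using solution_decomposition[OF t, of e] by eventually_elim (simp add: a_def D_def N_def c_def)
  qed (use square_integrableD(1)[OF X_inner_square_integrable[OF t]] square_integrableD(1)[OF D_sq] square_integrableD(1)[OF N_sq] in measurable)
  also have "\<dots> = expectation (\<lambda>\<omega>. a\<^sup>2 + 2 * a * D t \<omega> + 2 * a * N t \<omega> + (D t \<omega>)\<^sup>2 + (N t \<omega>)\<^sup>2 + 2 * (D t \<omega> * N t \<omega>))"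
    by (intro Bochner_Integration.integral_cong) (auto simp: power2_eq_square algebra_simps)
  also have "\<dots> = a\<^sup>2 + 2 * a * expectation (D t) + 2 * a * expectation (N t) + expectation (\<lambda>\<omega>. (D t \<omega>)\<^sup>2)
      + expectation (\<lambda>\<omega>. (N t \<omega>)\<^sup>2) + 2 * expectation (\<lambda>\<omega>. D t \<omega> * N t \<omega>)"
    using square_integrable_imp_integrable[OF D_sq] square_integrable_imp_integrable[OF N_sq]
      square_integrableD(2)[OF D_sq] square_integrableD(2)[OF N_sq] square_integrable_mult[OF D_sq N_sq]
    by (simp add: prob_space)
  also have "\<dots> = a\<^sup>2 + (\<integral>s. (2 * a * ?y s + 2 * ?yD s
        + 2 * ?yN s) + ?g s \<partial>horizon t)"
    unfolding ED ED2 EN2 EDN EN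
    using time_space_Fubini(1)[OF int_y] time_space_Fubini(1)[OF int_yD] int_N
      int_XX[of "e v* G k" "e v* G k" for k]
    by (simp add: power2_eq_square)
  \<comment> \<open>At each \<open>s\<close> the first three terms are twice the expansion of
    \<open>E ((c \<bullet> X s) * (e \<bullet> X s))\<close> along
    \<open>e \<bullet> X s = a + D s + N s\<close>.\<close>
  also have "(\<integral>s. (2 * a * ?y s + 2 * ?yD s
        + 2 * ?yN s) + ?g s \<partial>horizon t)
    = (\<integral>s. 2 * expectation (\<lambda>\<omega>. (c \<bullet> X s \<omega>) * (e \<bullet> X s \<omega>)) + ?g s \<partial>horizon t)"
  proof (rule Bochner_Integration.integral_cong)
    fix s assume "s \<in> space (horizon t)"
    then have s: "0 \<le> s" by (simp add: space_restrict_space)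
    note y_sq = X_inner_square_integrable[OF s, of c]
    note D_sq = drift_square_integrable[OF s, of c, folded D_def]
    note N_sq = total_noise_square_integrable[OF s, of e, folded N_def]
    have "expectation (\<lambda>\<omega>. (c \<bullet> X s \<omega>) * (e \<bullet> X s \<omega>))
       = expectation (\<lambda>\<omega>. a * (c \<bullet> X s \<omega>) + (c \<bullet> X s \<omega>) * D s \<omega> + (c \<bullet> X s \<omega>) * N s \<omega>)"
    proof (rule integral_cong_AE)
      show "AE \<omega> in M. (c \<bullet> X s \<omega>) * (e \<bullet> X s \<omega>) = a * (c \<bullet> X s \<omega>) + (c \<bullet> X s \<omega>) * D s \<omega> + (c \<bullet> X s \<omega>) * N s \<omega>"
        using solution_decomposition[OF s, of e] by eventually_elim (simp add: a_def D_def N_def c_def algebra_simps)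
    qed (use X_measurable[OF s] square_integrableD(1)[OF D_sq] square_integrableD(1)[OF N_sq] in measurable)
    also have "\<dots> = a * ?y s + ?yD s + ?yN s"
      using square_integrable_imp_integrable[OF y_sq] square_integrable_mult[OF y_sq D_sq] square_integrable_mult[OF y_sq N_sq]
      by simp
    finally show "(2 * a * ?y s + 2 * ?yD s
        + 2 * ?yN s) + ?g s
      = 2 * expectation (\<lambda>\<omega>. (c \<bullet> X s \<omega>) * (e \<bullet> X s \<omega>)) + ?g s"
      by simp
  qed simp
  finally show "expectation (\<lambda>\<omega>. (e \<bullet> X t \<omega>)\<^sup>2) = (e \<bullet> x0)\<^sup>2 +
      (\<integral>s. 2 * expectation (\<lambda>\<omega>. ((e v* A) \<bullet> X s \<omega>) * (e \<bullet> X s \<omega>)) + (\<Sum>k\<in>UNIV. expectation (\<lambda>\<omega>. ((e v* G k) \<bullet> X s \<omega>)\<^sup>2)) \<partial>horizon t)"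
    by (simp add: a_def c_def)
qed

end

section \<open>Identifiability\<close>

lemma has_vector_derivative_componentwise:
  fixes p :: "real \<Rightarrow> real^'n"
  assumes "\<And>i. ((\<lambda>t. p t $ i) has_vector_derivative d $ i) (at t within S)"
  shows "(p has_vector_derivative d) (at t within S)"
  unfolding has_vector_derivative_def
proof (subst has_derivative_componentwise_within, intro ballI)
  fix b :: "real^'n" assume "b \<in> Basis"
  then obtain i where "b = axis i 1" by (auto simp: Basis_vec_def)
  then show "((\<lambda>x. p x \<bullet> b) has_derivative (\<lambda>x. (x *\<^sub>R d) \<bullet> b)) (at t within S)"
    using assms[of i] by (simp add: has_vector_derivative_def inner_axis)
qed

text \<open>A bootstrap: an integrable rate makes \<open>p\<close> continuous, hence the rate
  continuous, hence \<open>p\<close> differentiable.\<close>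

lemma linear_ode_of_integral_equation:
  fixes p :: "real \<Rightarrow> real^'n" and B :: "real^'n^'n"
  assumes int: "\<And>t i. 0 \<le> t \<Longrightarrow> integrable (horizon t) (\<lambda>s. (B *v p s) $ i)"
    and eq: "\<And>t i. 0 \<le> t \<Longrightarrow> p t $ i = v $ i + (\<integral>s. (B *v p s) $ i \<partial>horizon t)"
  shows "p 0 = v" and "0 \<le> t \<Longrightarrow> (p has_vector_derivative B *v p t) (at t within {0..})"
proof -
  have set_int: "set_integrable lborel {0..t} (\<lambda>s. (B *v p s) $ i)" if "0 \<le> t" for t i
    using int[OF that, of i] by (simp add: set_integrable_def integrable_restrict_space)
  have hk: "(\<lambda>s. (B *v p s) $ i) integrable_on {0..t}" "p t $ i = v $ i + integral {0..t} (\<lambda>s. (B *v p s) $ i)"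
    if "0 \<le> t" for t i
    using set_borel_integral_eq_integral[OF set_int[OF that, of i]] eq[OF that, of i]
    by (simp_all add: set_integral_horizon)
  show "p 0 = v"
    using hk(2)[OF order_refl] by (simp add: vec_eq_iff)
  assume t: "0 \<le> t"
  \<comment> \<open>The interval extends beyond \<open>t\<close>, so that near \<open>t\<close> it
    coincides with the half-line.\<close>
  let ?T = "t + 1"
  have "continuous_on {0..?T} (\<lambda>s. p s $ i)" for i
  proof -
    have "continuous_on {0..?T} (\<lambda>s. v $ i + integral {0..s} (\<lambda>s. (B *v p s) $ i))"
      using t by (intro continuous_intros indefinite_integral_continuous_1 hk(1)) auto
    then show ?thesis
      by (rule continuous_on_eq) (use hk(2) in auto)
  qed
  then have cont: "continuous_on {0..?T} (\<lambda>s. (B *v p s) $ i)" for i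
    unfolding matrix_vector_mult_def by (simp add: continuous_on_sum continuous_on_mult_left)
  have "((\<lambda>s. p s $ i) has_vector_derivative (B *v p t) $ i) (at t within {0..?T})" for i
  proof -
    have "((\<lambda>s. v $ i + integral {0..s} (\<lambda>s. (B *v p s) $ i)) has_vector_derivative 0 + (B *v p t) $ i) (at t within {0..?T})"
      using t by (intro has_vector_derivative_add has_vector_derivative_const integral_has_vector_derivative[OF cont]) auto
    then have "((\<lambda>s. v $ i + integral {0..s} (\<lambda>s. (B *v p s) $ i)) has_vector_derivative (B *v p t) $ i) (at t within {0..?T})"
      by simp
    then show ?thesis
      by (rule has_vector_derivative_transform[rotated 2]) (use t hk(2) in auto)
  qed
  then have "(p has_vector_derivative B *v p t) (at t within {0..?T})"
    by (rule has_vector_derivative_componentwise)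
  moreover have "at t within {0..?T} = at t within {0..}"
    by (rule at_within_nhd[of _ "{..<?T}"]) auto
  ultimately show "(p has_vector_derivative B *v p t) (at t within {0..})" by simp
qed

text \<open>The second moment equation is available for quadratic forms; this recovers the entries
  from them.\<close>

lemma symmetric_matrix_polarization:
  fixes K :: "real^'n^'n"
  assumes "transpose K = K"
  shows "K $ i $ j = ((axis i 1 + axis j 1) \<bullet> (K *v (axis i 1 + axis j 1)) - axis i 1 \<bullet> (K *v axis i 1) - axis j 1 \<bullet> (K *v axis j 1)) / 2"
proof -
  have "axis a 1 \<bullet> (K *v axis b 1) = K $ a $ b" for a b
    by (simp add: inner_axis' matrix_vector_mul_component inner_axis)
  moreover have "K $ j $ i = K $ i $ j"
    using arg_cong[OF assms, of "\<lambda>P. P $ i $ j"] by (simp add: transpose_def)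
  ultimately show ?thesis by (simp add: inner_add_left inner_add_right matrix_vector_right_distrib)
qed

section \<open>Moment functions as solutions of linear differential equations\<close>

context linear_sde
begin

definition mean_vector :: "real \<Rightarrow> real^'d" where
  "mean_vector t = (\<chi> i. expectation (\<lambda>\<omega>. X t \<omega> $ i))"

definition moment_matrix :: "real \<Rightarrow> real^'d^'d" where
  "moment_matrix t = (\<chi> i j. expectation (\<lambda>\<omega>. X t \<omega> $ i * X t \<omega> $ j))"

lemma component_square_integrable: "0 \<le> t \<Longrightarrow> square_integrable M (\<lambda>\<omega>. X t \<omega> $ i)"
  using X_inner_square_integrable[of t "axis i 1"] by (simp add: inner_axis')

lemma inner_mean_vector:
  assumes t: "0 \<le> t"
  shows "expectation (\<lambda>\<omega>. c \<bullet> X t \<omega>) = c \<bullet> mean_vector t"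
  using square_integrable_imp_integrable[OF component_square_integrable[OF t]]
  by (simp add: inner_vec_def mean_vector_def)

lemma inner_moment_matrix:
  assumes t: "0 \<le> t"
  shows "expectation (\<lambda>\<omega>. (c \<bullet> X t \<omega>) * (c' \<bullet> X t \<omega>)) = c \<bullet> (moment_matrix t *v c')"
proof -
  have "expectation (\<lambda>\<omega>. (c \<bullet> X t \<omega>) * (c' \<bullet> X t \<omega>))
      = expectation (\<lambda>\<omega>. \<Sum>i\<in>UNIV. \<Sum>j\<in>UNIV. (c $ i * c' $ j) * (X t \<omega> $ i * X t \<omega> $ j))"
    by (simp add: inner_vec_def sum_product ac_simps)
  also have "\<dots> = (\<Sum>i\<in>UNIV. \<Sum>j\<in>UNIV. (c $ i * c' $ j) * expectation (\<lambda>\<omega>. X t \<omega> $ i * X t \<omega> $ j))"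
    using square_integrable_mult[OF component_square_integrable[OF t] component_square_integrable[OF t]]
    by (simp add: Bochner_Integration.integral_sum Bochner_Integration.integrable_sum)
  also have "\<dots> = c \<bullet> (moment_matrix t *v c')"
    by (simp add: inner_vec_def matrix_vector_mult_def moment_matrix_def sum_distrib_left ac_simps)
  finally show ?thesis .
qed

lemma transpose_moment_matrix: "transpose (moment_matrix t) = moment_matrix t"
  by (simp add: transpose_def moment_matrix_def vec_eq_iff mult.commute)

lemma mean_vector_ode:
  shows "mean_vector 0 = x0" and "0 \<le> t \<Longrightarrow> (mean_vector has_vector_derivative A *v mean_vector t) (at t within {0..})"
proof -
  have component: "(A *v mean_vector s) $ i = expectation (\<lambda>\<omega>. (axis i 1 v* A) \<bullet> X s \<omega>)" if "0 \<le> s" for s i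
    using inner_mean_vector[OF that, of "axis i 1 v* A"] by (simp add: dot_lmul_matrix inner_axis')
  have cong: "(\<integral>s. (A *v mean_vector s) $ i \<partial>horizon t) = (\<integral>s. expectation (\<lambda>\<omega>. (axis i 1 v* A) \<bullet> X s \<omega>) \<partial>horizon t)" for t i
    by (intro Bochner_Integration.integral_cong component) (auto simp: space_restrict_space)
  have int: "integrable (horizon t) (\<lambda>s. (A *v mean_vector s) $ i)" if "0 \<le> t" for t i
    by (rule Bochner_Integration.integrable_cong[THEN iffD2, OF refl component mean_equation(1)[OF that]])
       (simp add: space_restrict_space)
  have eq: "mean_vector t $ i = x0 $ i + (\<integral>s. (A *v mean_vector s) $ i \<partial>horizon t)" if "0 \<le> t" for t i
    using mean_equation(2)[OF that, of "axis i 1"] inner_mean_vector[OF that, of "axis i 1"]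
    unfolding cong by (simp add: inner_axis')
  show "mean_vector 0 = x0" and "0 \<le> t \<Longrightarrow> (mean_vector has_vector_derivative A *v mean_vector t) (at t within {0..})"
    using linear_ode_of_integral_equation[OF int eq] by auto
qed

abbreviation moment_rate :: "real \<Rightarrow> real^'d^'d" where
  "moment_rate t \<equiv> moment_operator A G (moment_matrix t)"

text \<open>Matches the rate in \<open>second_moment_equation\<close> with a quadratic form of
  \<open>moment_operator\<close>. The two drift terms coincide by symmetry of the moment matrix,
  which gives the factor 2.\<close>

lemma inner_moment_rate:
  assumes t: "0 \<le> t"
  shows "e \<bullet> (moment_rate t *v e) = 2 * expectation (\<lambda>\<omega>. ((e v* A) \<bullet> X t \<omega>) * (e \<bullet> X t \<omega>))
    + (\<Sum>k\<in>UNIV. expectation (\<lambda>\<omega>. ((e v* G k) \<bullet> X t \<omega>)\<^sup>2))"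
proof -
  let ?S = "moment_matrix t"
  have sym: "a \<bullet> (?S *v b) = b \<bullet> (?S *v a)" for a b
    by (metis dot_lmul_matrix inner_commute transpose_matrix_vector transpose_moment_matrix)
  have "e \<bullet> (?S ** transpose A *v e) = (e v* A) \<bullet> (?S *v e)"
    using sym[of e "e v* A"] by (simp add: matrix_vector_mul_assoc[symmetric] transpose_matrix_vector)
  moreover have "e \<bullet> (A ** ?S *v e) = (e v* A) \<bullet> (?S *v e)"
    by (simp add: matrix_vector_mul_assoc[symmetric] dot_lmul_matrix)
  moreover have "e \<bullet> (G k ** ?S ** transpose (G k) *v e) = (e v* G k) \<bullet> (?S *v (e v* G k))" for k
    by (simp add: matrix_vector_mul_assoc[symmetric] dot_lmul_matrix transpose_matrix_vector)
  ultimately show ?thesis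
    unfolding power2_eq_square inner_moment_matrix[OF t]
    by (simp add: moment_operator_def matrix_vector_mult_add_rdistrib matrix_vector_mult_sum_distrib inner_add_right inner_sum_right)
qed

lemma moment_matrix_ode:
  assumes AA: "AA = kronecker_sum A A + (\<Sum>k\<in>UNIV. kronecker_product (G k) (G k))"
  shows "vectorize (moment_matrix 0) = vectorize (outer x0 x0)"
    and "0 \<le> t \<Longrightarrow> ((\<lambda>t. vectorize (moment_matrix t)) has_vector_derivative AA *v vectorize (moment_matrix t)) (at t within {0..})"
proof -
  have rate: "AA *v vectorize (moment_matrix s) = vectorize (moment_rate s)" for s
    by (simp add: AA moment_operator_vectorize)
  have quad_int: "integrable (horizon t) (\<lambda>s. e \<bullet> (moment_rate s *v e))" if "0 \<le> t" for t e
  proof (rule Bochner_Integration.integrable_cong[THEN iffD2, OF refl inner_moment_rate])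
    show "integrable (horizon t) (\<lambda>s. 2 * expectation (\<lambda>\<omega>. ((e v* A) \<bullet> X s \<omega>) * (e \<bullet> X s \<omega>))
      + (\<Sum>k\<in>UNIV. expectation (\<lambda>\<omega>. ((e v* G k) \<bullet> X s \<omega>)\<^sup>2)))"
      unfolding power2_eq_square using second_moment_equation(1)[OF that]
      by (intro Bochner_Integration.integrable_add Bochner_Integration.integrable_sum integrable_mult_right) auto
  qed (simp add: space_restrict_space)
  have quad: "e \<bullet> (moment_matrix t *v e) = e \<bullet> (outer x0 x0 *v e) + (\<integral>s. e \<bullet> (moment_rate s *v e) \<partial>horizon t)"
    if t: "0 \<le> t" for t e
  proof -
    have "e \<bullet> (outer x0 x0 *v e) = (e \<bullet> x0)\<^sup>2"
      by (simp add: outer_def matrix_vector_mult_def inner_vec_def power2_eq_square sum_distrib_left sum_distrib_right ac_simps)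
    moreover have "(\<integral>s. e \<bullet> (moment_rate s *v e) \<partial>horizon t) = (\<integral>s. 2 * expectation (\<lambda>\<omega>. ((e v* A) \<bullet> X s \<omega>) * (e \<bullet> X s \<omega>))
      + (\<Sum>k\<in>UNIV. expectation (\<lambda>\<omega>. ((e v* G k) \<bullet> X s \<omega>)\<^sup>2)) \<partial>horizon t)"
      by (intro Bochner_Integration.integral_cong inner_moment_rate) (auto simp: space_restrict_space)
    ultimately show ?thesis
      using second_moment_equation(2)[OF t, of e] inner_moment_matrix[OF t, of e e]
      by (simp add: power2_eq_square)
  qed
  \<comment> \<open>The rate is symmetric because the moment matrix is, so both integrability and
    the equation pass from quadratic forms to entries.\<close>
  have int: "integrable (horizon t) (\<lambda>s. moment_rate s $ i $ j)" if "0 \<le> t" for t i j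
    unfolding symmetric_matrix_polarization[OF transpose_moment_operator[OF transpose_moment_matrix], where i = i and j = j]
    by (intro integrable_divide Bochner_Integration.integrable_diff quad_int that)
  have eq: "moment_matrix t $ i $ j = outer x0 x0 $ i $ j + (\<integral>s. moment_rate s $ i $ j \<partial>horizon t)" if "0 \<le> t" for t i j
    unfolding symmetric_matrix_polarization[OF transpose_moment_operator[OF transpose_moment_matrix], where i = i and j = j]
      symmetric_matrix_polarization[OF transpose_moment_matrix, of _ i j] symmetric_matrix_polarization[OF transpose_outer, where i = i and j = j]
      quad[OF that]
    using quad_int[OF that] by (simp add: diff_divide_distrib add_divide_distrib)
  have int': "integrable (horizon t) (\<lambda>s. (AA *v vectorize (moment_matrix s)) $ ij)" if "0 \<le> t" for t ij
    unfolding rate using int[OF that] by (simp add: vectorize_def)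
  have eq': "vectorize (moment_matrix t) $ ij = vectorize (outer x0 x0) $ ij + (\<integral>s. (AA *v vectorize (moment_matrix s)) $ ij \<partial>horizon t)"
    if "0 \<le> t" for t ij
    unfolding rate using eq[OF that] by (simp add: vectorize_def)
  show "vectorize (moment_matrix 0) = vectorize (outer x0 x0)"
    and "0 \<le> t \<Longrightarrow> ((\<lambda>t. vectorize (moment_matrix t)) has_vector_derivative AA *v vectorize (moment_matrix t)) (at t within {0..})"
    using linear_ode_of_integral_equation[OF int' eq'] by auto
qed

end

text \<open>The law enters through one time coordinate at a time, a measurable function on the
  product space.\<close>

lemma same_law_expectation:
  fixes X X' :: "real \<Rightarrow> 'a \<Rightarrow> real^'d" and f :: "real^'d \<Rightarrow> real"
  assumes law: "same_law M X X'" and t: "0 \<le> t"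
    and X: "\<And>t. 0 \<le> t \<Longrightarrow> X t \<in> borel_measurable M" and X': "\<And>t. 0 \<le> t \<Longrightarrow> X' t \<in> borel_measurable M"
    and [measurable]: "f \<in> borel_measurable borel"
  shows "(\<integral>\<omega>. f (X t \<omega>) \<partial>M) = (\<integral>\<omega>. f (X' t \<omega>) \<partial>M)"
proof -
  let ?P = "PiM {0..} (\<lambda>_. borel) :: (real \<Rightarrow> real^'d) measure"
  have f: "(\<lambda>x. f (x t)) \<in> borel_measurable ?P"
    using t by (intro measurable_compose[OF measurable_component_singleton]) auto
  have "(\<integral>\<omega>. f (Y t \<omega>) \<partial>M) = (\<integral>x. f (x t) \<partial>distr M ?P (\<lambda>\<omega>. \<lambda>t\<in>{0..}. Y t \<omega>))"
    if Y: "\<And>t. 0 \<le> t \<Longrightarrow> Y t \<in> borel_measurable M" for Y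
  proof (subst integral_distr[OF _ f])
    show "(\<lambda>\<omega>. \<lambda>t\<in>{0..}. Y t \<omega>) \<in> measurable M ?P"
      using Y by (intro measurable_restrict) auto
  qed (use t in simp)
  from this[of X] this[of X'] X X' law show ?thesis by (simp add: same_law_def)
qed

text \<open>The trajectories agree on the half-line only, so the derivative of \<open>p'\<close> is
  carried over to \<open>p\<close> within that set.\<close>

lemma krylov_eq_of_common_trajectory:
  fixes B B' :: "real^'n^'n"
  assumes "\<And>t. 0 \<le> t \<Longrightarrow> (p has_vector_derivative B *v p t) (at t within {0..})"
    and "\<And>t. 0 \<le> t \<Longrightarrow> (p' has_vector_derivative B' *v p' t) (at t within {0..})"
    and eq: "\<And>t. 0 \<le> t \<Longrightarrow> p t = p' t"
  shows "krylov B (p 0) j = krylov B' (p 0) j"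
proof (rule krylov_eq_of_linear_ode[OF assms(1)])
  fix t :: real assume t: "0 \<le> t"
  show "(p has_vector_derivative B' *v p t) (at t within {0..})"
    using assms(2)[OF t] unfolding eq[OF t]
    by (rule has_vector_derivative_transform[rotated 2]) (use t eq in auto)
qed auto

theorem theorem3p5:
  fixes M :: "'a measure" and F :: "real \<Rightarrow> 'a measure" and W :: "real \<Rightarrow> 'a \<Rightarrow> real^'m"
    and x0 :: "real^'d" and A :: "real^'d^'d" and G :: "'m \<Rightarrow> real^'d^'d"
    and AA :: "real^('d \<times> 'd)^('d \<times> 'd)" and v :: "real^('d \<times> 'd)"
  assumes "brownian_motion M F W"
    and "AA = kronecker_sum A A + (\<Sum>k\<in>UNIV. kronecker_product (G k) (G k))"
    and "v = vectorize (outer x0 x0)"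
    and "hconcat_rank (krylov A x0) (CARD('d) - 1) = CARD('d)"
    and "hconcat_rank (krylov AA v) ((CARD('d)^2 + CARD('d) - 2) div 2)
           = (CARD('d)^2 + CARD('d)) div 2"
  shows "identifiable_from M F W x0 A G"
  unfolding identifiable_from_def
proof (intro allI impI notI)
  fix A' G' X X'
  assume ne: "\<exists>x. (A, diffusion_matrix G x) \<noteq> (A', diffusion_matrix G' x)"
    and sol: "linear_sde_solution M F W x0 A G X" and sol': "linear_sde_solution M F W x0 A' G' X'"
    and law: "same_law M X X'"
  interpret brownian_motion M F W by fact
  interpret S: linear_sde M F W x0 A G X by unfold_locales (rule sol)
  interpret S': linear_sde M F W x0 A' G' X' by unfold_locales (rule sol')
  note same = same_law_expectation[OF law _ S.X_measurable S'.X_measurable]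
  \<comment> \<open>First and second moments are expectations of functions of one time coordinate,
    hence fixed by the law.\<close>
  have mean: "S.mean_vector t = S'.mean_vector t" if "0 \<le> t" for t
    using same[OF that, of "\<lambda>x. x $ i" for i] by (simp add: S.mean_vector_def S'.mean_vector_def)
  have moment: "vectorize (S.moment_matrix t) = vectorize (S'.moment_matrix t)" if "0 \<le> t" for t
    using same[OF that, of "\<lambda>x. x $ i * x $ j" for i j] by (simp add: S.moment_matrix_def S'.moment_matrix_def)
  define AA' where "AA' = kronecker_sum A' A' + (\<Sum>k\<in>UNIV. kronecker_product (G' k) (G' k))"
  have k1: "krylov A x0 j = krylov A' x0 j" for j
    using krylov_eq_of_common_trajectory[OF S.mean_vector_ode(2) S'.mean_vector_ode(2) mean]
    by (simp add: S.mean_vector_ode(1))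
  have k2: "krylov AA v j = krylov AA' v j" for j
    using krylov_eq_of_common_trajectory[OF S.moment_matrix_ode(2)[OF assms(2)] S'.moment_matrix_ode(2)[OF AA'_def] moment]
    by (simp add: S.moment_matrix_ode(1)[OF assms(2)] assms(3))
  \<comment> \<open>The bound in the second rank condition is the index of the last column in (A2),
    one less than the number of columns since counting starts at 0.\<close>
  have "A = A'" "diffusion_matrix G x = diffusion_matrix G' x" for x
    using identifiable_of_krylov_eq[OF assms(2) AA'_def assms(3-5) k1 k2] by blast+
  with ne show False by simp
qed

end
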